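(* Let $G$ be a non-abelian limit group and $K$ an infinite field which is interpretable in $\mathbb N$. Then for any $n\in\mathbb N$ there is a formula $\phi_n$ of the first-order language of rings such that $\phi_n$ is not equivalent in $K(G)$ to any boolean combination of formulas from $\Pi_n$ or $\Sigma_n$ (with constants from $K(G)$).
   Context: $K(G)$ is the group algebra, viewed as a structure in the language of unitary rings $\{+,\cdot,0,1\}$. A limit group is a finitely generated fully residually free group: for any finite set of distinct elements of $G$ there is a homomorphism from $G$ to a free group injective on this set. "$K$ is interpretable in $\mathbb N$" means that the field $K$ is first-order interpretable (as a quotient of a definable set by a definable equivalence relation, with definable operations) in the arithmetic $\mathbb N=\langle\mathbb N;+,\cdot,0,1\rangle$. A formula in prenex normal form $Q_1y_1\cdots Q_sy_s\,\phi_0$ ($\phi_0$ quantifier-free) is $\Sigma_n$ if its quantifier prefix begins with an existential quantifier and alternates $n-1$ times between series of existential and universal quantifiers, and $\Pi_n$ if the prefix begins with a universal quantifier and alternates $n-1$ times; $\Sigma_0=\Pi_0$ is the class of quantifier-free formulas. Two formulas are equivalent in a structure if they define the same set in it. *)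

theory Defs
  imports "HOL-Algebra.Ring" "HOL-Algebra.Generated_Groups"
begin

section \<open>First-order formulas in the language of unitary rings\<close>

text \<open>
  The type parameter is the type of constants that may occur in a formula; a formula of the
  pure language is one without constants. Variables are natural numbers.
\<close>

datatype (consts_tm: 'a) tm =
    Var nat
  | Const 'a
  | Zero
  | One
  | Add "'a tm" "'a tm"
  | Mult "'a tm" "'a tm"

datatype (consts_fm: 'a) fm =
    Eq "'a tm" "'a tm"
  | Neg "'a fm"
  | Conj "'a fm" "'a fm"
  | Disj "'a fm" "'a fm"
  | Ex nat "'a fm"
  | All nat "'a fm"

primrec eval_tm :: "('a, 'm) ring_scheme \<Rightarrow> (nat \<Rightarrow> 'a) \<Rightarrow> 'a tm \<Rightarrow> 'a" where
  "eval_tm R e (Var i) = e i"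
| "eval_tm R e (Const c) = c"
| "eval_tm R e Zero = \<zero>\<^bsub>R\<^esub>"
| "eval_tm R e One = \<one>\<^bsub>R\<^esub>"
| "eval_tm R e (Add s t) = eval_tm R e s \<oplus>\<^bsub>R\<^esub> eval_tm R e t"
| "eval_tm R e (Mult s t) = eval_tm R e s \<otimes>\<^bsub>R\<^esub> eval_tm R e t"

primrec sat :: "('a, 'm) ring_scheme \<Rightarrow> (nat \<Rightarrow> 'a) \<Rightarrow> 'a fm \<Rightarrow> bool" where
  "sat R e (Eq s t) \<longleftrightarrow> eval_tm R e s = eval_tm R e t"
| "sat R e (Neg \<phi>) \<longleftrightarrow> \<not> sat R e \<phi>"
| "sat R e (Conj \<phi> \<psi>) \<longleftrightarrow> sat R e \<phi> \<and> sat R e \<psi>"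
| "sat R e (Disj \<phi> \<psi>) \<longleftrightarrow> sat R e \<phi> \<or> sat R e \<psi>"
| "sat R e (Ex i \<phi>) \<longleftrightarrow> (\<exists>a \<in> carrier R. sat R (e(i := a)) \<phi>)"
| "sat R e (All i \<phi>) \<longleftrightarrow> (\<forall>a \<in> carrier R. sat R (e(i := a)) \<phi>)"

primrec vars_tm :: "'a tm \<Rightarrow> nat set" where
  "vars_tm (Var i) = {i}"
| "vars_tm (Const c) = {}"
| "vars_tm Zero = {}"
| "vars_tm One = {}"
| "vars_tm (Add s t) = vars_tm s \<union> vars_tm t"
| "vars_tm (Mult s t) = vars_tm s \<union> vars_tm t"

primrec free_vars :: "'a fm \<Rightarrow> nat set" where
  "free_vars (Eq s t) = vars_tm s \<union> vars_tm t"
| "free_vars (Neg \<phi>) = free_vars \<phi>"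
| "free_vars (Conj \<phi> \<psi>) = free_vars \<phi> \<union> free_vars \<psi>"
| "free_vars (Disj \<phi> \<psi>) = free_vars \<phi> \<union> free_vars \<psi>"
| "free_vars (Ex i \<phi>) = free_vars \<phi> - {i}"
| "free_vars (All i \<phi>) = free_vars \<phi> - {i}"

definition equivalent_in :: "('a, 'm) ring_scheme \<Rightarrow> 'a fm \<Rightarrow> 'a fm \<Rightarrow> bool" where
  "equivalent_in R \<phi> \<psi> \<longleftrightarrow>
     (\<forall>e. (\<forall>i. e i \<in> carrier R) \<longrightarrow> (sat R e \<phi> \<longleftrightarrow> sat R e \<psi>))"


section \<open>The classes of prenex formulas and their boolean combinations\<close>

primrec quantifier_free :: "'a fm \<Rightarrow> bool" where
  "quantifier_free (Eq s t) \<longleftrightarrow> True"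
| "quantifier_free (Neg \<phi>) \<longleftrightarrow> quantifier_free \<phi>"
| "quantifier_free (Conj \<phi> \<psi>) \<longleftrightarrow> quantifier_free \<phi> \<and> quantifier_free \<psi>"
| "quantifier_free (Disj \<phi> \<psi>) \<longleftrightarrow> quantifier_free \<phi> \<and> quantifier_free \<psi>"
| "quantifier_free (Ex i \<phi>) \<longleftrightarrow> False"
| "quantifier_free (All i \<phi>) \<longleftrightarrow> False"

datatype quantifier = Exists | Forall

primrec quantify :: "quantifier \<times> nat \<Rightarrow> 'a fm \<Rightarrow> 'a fm" where
  "quantify (Q, i) = (case Q of Exists \<Rightarrow> Ex i | Forall \<Rightarrow> All i)"

definition prenex :: "(quantifier \<times> nat) list \<Rightarrow> 'a fm \<Rightarrow> 'a fm" where
  "prenex qs \<phi> = foldr quantify qs \<phi>"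

text \<open>
  A prefix with \<open>n > 0\<close> maximal blocks of equal quantifiers alternates \<open>n - 1\<close> times;
  the prefix with no blocks is empty.
\<close>

definition quantifier_blocks :: "(quantifier \<times> nat) list \<Rightarrow> nat" where
  "quantifier_blocks qs = length (remdups_adj (map fst qs))"

definition prenex_class :: "quantifier \<Rightarrow> nat \<Rightarrow> 'a set \<Rightarrow> 'a fm set" where
  "prenex_class Q n C =
     {prenex qs \<phi> | qs \<phi>. quantifier_free \<phi> \<and> consts_fm \<phi> \<subseteq> C \<and>
        quantifier_blocks qs = n \<and> (n > 0 \<longrightarrow> fst (hd qs) = Q)}"

definition Sigma_formulas :: "nat \<Rightarrow> 'a set \<Rightarrow> 'a fm set" where
  "Sigma_formulas n C = prenex_class Exists n C"

definition Pi_formulas :: "nat \<Rightarrow> 'a set \<Rightarrow> 'a fm set" where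
  "Pi_formulas n C = prenex_class Forall n C"

inductive_set boolean_combinations :: "'a fm set \<Rightarrow> 'a fm set" for \<Phi> :: "'a fm set" where
  base: "\<phi> \<in> \<Phi> \<Longrightarrow> \<phi> \<in> boolean_combinations \<Phi>"
| Neg: "\<phi> \<in> boolean_combinations \<Phi> \<Longrightarrow> Neg \<phi> \<in> boolean_combinations \<Phi>"
| Conj: "\<phi> \<in> boolean_combinations \<Phi> \<Longrightarrow> \<psi> \<in> boolean_combinations \<Phi> \<Longrightarrow>
    Conj \<phi> \<psi> \<in> boolean_combinations \<Phi>"
| Disj: "\<phi> \<in> boolean_combinations \<Phi> \<Longrightarrow> \<psi> \<in> boolean_combinations \<Phi> \<Longrightarrow>
    Disj \<phi> \<psi> \<in> boolean_combinations \<Phi>"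


section \<open>Interpretability\<close>

definition definable :: "('a, 'm) ring_scheme \<Rightarrow> nat \<Rightarrow> 'a list set \<Rightarrow> bool" where
  "definable R d X \<longleftrightarrow>
     (\<exists>\<phi>. consts_fm \<phi> = {} \<and> free_vars \<phi> \<subseteq> {..<d} \<and>
        X = {xs. length xs = d \<and> set xs \<subseteq> carrier R \<and> sat R (\<lambda>i. xs ! i) \<phi>})"

text \<open>
  \<open>A\<close> is isomorphic, via \<open>h\<close>, to a structure on the quotient of a definable set \<open>D\<close> of
  \<open>d\<close>-tuples of \<open>B\<close> by a definable equivalence relation \<open>E\<close>; the preimages in \<open>D\<close> of the
  constants and of the graphs of the operations of \<open>A\<close> are definable. Tuples of tuples are
  encoded by concatenation.
\<close>

definition interpretable_in :: "('k, 'm) ring_scheme \<Rightarrow> ('a, 'n) ring_scheme \<Rightarrow> bool" where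
  "interpretable_in A B \<longleftrightarrow>
     (\<exists>d D E h.
        definable B d D \<and>
        equiv D E \<and>
        definable B (2 * d) {xs @ ys | xs ys. (xs, ys) \<in> E} \<and>
        bij_betw h (D // E) (carrier A) \<and>
        definable B d {xs \<in> D. h (E `` {xs}) = \<zero>\<^bsub>A\<^esub>} \<and>
        definable B d {xs \<in> D. h (E `` {xs}) = \<one>\<^bsub>A\<^esub>} \<and>
        definable B (3 * d) {xs @ ys @ zs | xs ys zs. xs \<in> D \<and> ys \<in> D \<and> zs \<in> D \<and>
          h (E `` {xs}) \<oplus>\<^bsub>A\<^esub> h (E `` {ys}) = h (E `` {zs})} \<and>
        definable B (3 * d) {xs @ ys @ zs | xs ys zs. xs \<in> D \<and> ys \<in> D \<and> zs \<in> D \<and>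
          h (E `` {xs}) \<otimes>\<^bsub>A\<^esub> h (E `` {ys}) = h (E `` {zs})})"

text \<open>The record type \<open>ring\<close> serves here only as the signature; \<open>\<nat>\<close> is not a ring.\<close>

definition nat_arithmetic :: "nat ring" where
  "nat_arithmetic = \<lparr>carrier = UNIV, mult = (*), one = 1, zero = 0, add = (+)\<rparr>"


section \<open>Group algebras\<close>

text \<open>
  Elements are finitely supported functions from the group to the field, with the value zero
  outside the carrier of the group. The sum in the convolution product is restricted to the
  support of the first factor in order to be finite.
\<close>

definition group_algebra ::
  "('k, 'm) ring_scheme \<Rightarrow> ('g, 'n) monoid_scheme \<Rightarrow> ('g \<Rightarrow> 'k) ring" where
  "group_algebra K G =
     \<lparr>carrier = {f. (\<forall>x \<in> carrier G. f x \<in> carrier K) \<and> (\<forall>x. x \<notin> carrier G \<longrightarrow> f x = \<zero>\<^bsub>K\<^esub>) \<and>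
                    finite {x. f x \<noteq> \<zero>\<^bsub>K\<^esub>}},
      mult = (\<lambda>f g x. if x \<in> carrier G
        then (\<Oplus>\<^bsub>K\<^esub>y \<in> {y \<in> carrier G. f y \<noteq> \<zero>\<^bsub>K\<^esub>}. f y \<otimes>\<^bsub>K\<^esub> g (inv\<^bsub>G\<^esub> y \<otimes>\<^bsub>G\<^esub> x))
        else \<zero>\<^bsub>K\<^esub>),
      one = (\<lambda>x. if x = \<one>\<^bsub>G\<^esub> then \<one>\<^bsub>K\<^esub> else \<zero>\<^bsub>K\<^esub>),
      zero = (\<lambda>x. \<zero>\<^bsub>K\<^esub>),
      add = (\<lambda>f g x. f x \<oplus>\<^bsub>K\<^esub> g x)\<rparr>"


section \<open>Free groups and limit groups\<close>

text \<open>
  A letter \<open>(s, True)\<close> stands for the generator \<open>s\<close> and \<open>(s, False)\<close> for its inverse. The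
  free group on \<open>S\<close> consists of the reduced words; \<open>push_letter\<close> multiplies a reduced word
  by a letter from the left.
\<close>

type_synonym 's word = "('s \<times> bool) list"

definition inverse_letter :: "'s \<times> bool \<Rightarrow> 's \<times> bool" where
  "inverse_letter x = (fst x, \<not> snd x)"

definition reduced :: "'s word \<Rightarrow> bool" where
  "reduced w \<longleftrightarrow> successively (\<lambda>x y. y \<noteq> inverse_letter x) w"

definition push_letter :: "'s \<times> bool \<Rightarrow> 's word \<Rightarrow> 's word" where
  "push_letter x w =
     (case w of [] \<Rightarrow> [x] | y # v \<Rightarrow> if y = inverse_letter x then v else x # w)"

definition free_group :: "'s set \<Rightarrow> 's word monoid" where
  "free_group S =
     \<lparr>carrier = {w. set w \<subseteq> S \<times> UNIV \<and> reduced w},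
      mult = foldr push_letter,
      one = []\<rparr>"

lemma inverse_letter_inverse_letter [simp]: "inverse_letter (inverse_letter x) = x"
  by (simp add: inverse_letter_def)

lemma reduced_Nil [simp]: "reduced []"
  by (simp add: reduced_def)

lemma reduced_Cons: "reduced (x # w) \<longleftrightarrow> (w = [] \<or> hd w \<noteq> inverse_letter x) \<and> reduced w"
  by (cases w) (auto simp: reduced_def)

lemma reduced_push_letter: "reduced w \<Longrightarrow> reduced (push_letter x w)"
  by (auto simp: push_letter_def reduced_Cons split: list.splits)

lemma set_push_letter: "set (push_letter x w) \<subseteq> insert x (set w)"
  by (auto simp: push_letter_def split: list.splits if_splits)

lemma push_letter_cancel:
  assumes "reduced w"
  shows "push_letter x (push_letter (inverse_letter x) w) = w"
  using assms by (auto simp: push_letter_def reduced_Cons neq_Nil_conv split: list.splits)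

lemma push_letter_reduced: "reduced (x # w) \<Longrightarrow> push_letter x w = x # w"
  by (auto simp: push_letter_def reduced_Cons split: list.splits)

lemma reduced_foldr: "reduced v \<Longrightarrow> reduced (foldr push_letter u v)"
  by (induction u) (auto simp: reduced_push_letter)

lemma set_foldr: "set (foldr push_letter u v) \<subseteq> set u \<union> set v"
  by (induction u) (use set_push_letter in fastforce)+

lemma foldr_push_letter:
  assumes "reduced w"
  shows "foldr push_letter (push_letter x v) w = push_letter x (foldr push_letter v w)"
proof (cases v)
  case (Cons y v')
  show ?thesis
  proof (cases "y = inverse_letter x")
    case True
    then show ?thesis
      using Cons assms push_letter_cancel[OF reduced_foldr, of w x v']
      by (simp add: push_letter_def)
  qed (simp add: Cons push_letter_def)
qed (simp add: push_letter_def)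

lemma foldr_push_letter_assoc:
  assumes "reduced w"
  shows "foldr push_letter (foldr push_letter u v) w =
    foldr push_letter u (foldr push_letter v w)"
  using assms by (induction u) (auto simp: foldr_push_letter)

lemma foldr_push_letter_Nil: "reduced u \<Longrightarrow> foldr push_letter u [] = u"
  by (induction u) (auto simp: reduced_Cons push_letter_reduced)

lemma foldr_push_letter_inverse:
  assumes "reduced w"
  shows "foldr push_letter (rev (map inverse_letter u)) (foldr push_letter u w) = w"
  using assms
proof (induction u)
  case (Cons x u)
  then show ?case
    using push_letter_cancel[OF reduced_foldr, of w "inverse_letter x" u] by simp
qed simp

lemma group_free_group: "group (free_group S)"
proof (rule groupI)
  fix u assume u: "u \<in> carrier (free_group S)"
  define v where "v = foldr push_letter (rev (map inverse_letter u)) []"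
  have "set v \<subseteq> set (map inverse_letter u)"
    using set_foldr[of "rev (map inverse_letter u)" "[]"] by (simp add: v_def)
  then have "v \<in> carrier (free_group S)"
    using u reduced_foldr[of "[]" "rev (map inverse_letter u)"]
    by (force simp: free_group_def v_def inverse_letter_def)
  moreover have "foldr push_letter v u = []"
  proof -
    have "foldr push_letter v u = foldr push_letter (rev (map inverse_letter u)) u"
      unfolding v_def
      using u foldr_push_letter_assoc[of u "rev (map inverse_letter u)" "[]"]
      by (simp add: free_group_def)
    also have "u = foldr push_letter u []"
      using u by (simp add: free_group_def foldr_push_letter_Nil)
    finally show ?thesis
      using foldr_push_letter_inverse[of "[]" u] u
      by (simp add: free_group_def foldr_push_letter_Nil)
  qed
  ultimately show "\<exists>v \<in> carrier (free_group S). v \<otimes>\<^bsub>free_group S\<^esub> u = \<one>\<^bsub>free_group S\<^esub>"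
    by (auto simp: free_group_def)
next
  fix u v assume "u \<in> carrier (free_group S)" "v \<in> carrier (free_group S)"
  then show "u \<otimes>\<^bsub>free_group S\<^esub> v \<in> carrier (free_group S)"
    using set_foldr[of u v] by (auto simp: free_group_def reduced_foldr)
qed (auto simp: free_group_def foldr_push_letter_assoc)

definition finitely_generated_group :: "('g, 'n) monoid_scheme \<Rightarrow> bool" where
  "finitely_generated_group G \<longleftrightarrow>
     group G \<and> (\<exists>S. finite S \<and> S \<subseteq> carrier G \<and> generate G S = carrier G)"

text \<open>
  Taking natural numbers as free generators is no restriction: the images of finitely many
  elements involve only finitely many generators, and killing the other generators is a
  homomorphism that is the identity on these images.
\<close>

definition fully_residually_free :: "('g, 'n) monoid_scheme \<Rightarrow> bool" where
  "fully_residually_free G \<longleftrightarrow>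
     (\<forall>X. finite X \<and> X \<subseteq> carrier G \<longrightarrow>
        (\<exists>(S :: nat set) h. h \<in> hom G (free_group S) \<and> inj_on h X))"

definition limit_group :: "('g, 'n) monoid_scheme \<Rightarrow> bool" where
  "limit_group G \<longleftrightarrow> finitely_generated_group G \<and> fully_residually_free G"

end

theory Submission
  imports Defs
begin

text \<open>
  The ring \<open>R = K(G)\<close> codes its own finite sequences. Its units are monomials, so the constants
  \<open>k\<close> for which \<open>k\<close> and \<open>k + 1\<close> are invertible form a definable infinite set. There are \<open>t\<close> and
  \<open>t'\<close> in \<open>G\<close> with \<open>(t - k) R \<inter> (t' - k) R = 0\<close> for every nonzero constant \<open>k\<close>. By the Chinese
  remainder theorem a finite function \<open>k\<^sub>i \<mapsto> x\<^sub>i\<close> from constants to \<open>R\<close> is coded by a pair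
  \<open>(c, c')\<close> with \<open>c \<equiv> x\<^sub>i\<close> modulo \<open>(t - k\<^sub>i) R\<close> and \<open>c' \<equiv> x\<^sub>i\<close> modulo \<open>(t' - k\<^sub>i) R\<close>, and the
  trivial intersection makes the decoding unique.

  Consequently a formula with constants from \<open>R\<close> is coded by an element of \<open>R\<close>, as the graph of
  its subformulas with nodes labelled by constants of \<open>K\<close>, and truth of formulas with at most \<open>n\<close>
  nested quantifier blocks is definable in \<open>R\<close> from \<open>t\<close> and \<open>t'\<close>. Diagonalizing against this truth
  definition gives \<open>\<phi>\<^sub>n\<close>; the parameters \<open>t\<close> and \<open>t'\<close> become free variables.

  For \<open>t\<close> and \<open>t'\<close> take \<open>x\<^sup>2\<close> and \<open>y\<^sup>2\<close>, where the images of \<open>x\<close> and \<open>y\<close> in a free group do not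
  commute and have minimal total length. No word can then be shortened (or kept at its length)
  both by a nontrivial power of \<open>t\<close> and by one of \<open>t'\<close>, whereas a longest element of the support of
  a nonzero element of \<open>(t - k) R \<inter> (t' - k) R\<close> would be such a word.
\<close>

section \<open>Predicates defined by formulas without constants\<close>

text \<open>\<open>K(G)\<close> is not commutative and \<open>(t - k) R\<close> is only a right
  ideal, so a congruence modulo it fixes \<open>x\<close> only up to elements of that ideal; the
  second parameter \<open>t'\<close> is there to remove this ambiguity. The labels need no order or
  successor: differences of distinct scalars are central units, which is all that the Chinese
  remainder theorem asks of them. One formula can treat inputs of unbounded size because the size is
  hidden in the codes. A single coded valuation covers every term and connective, and a block of any
  number of quantifiers becomes one quantifier over a coded assignment. Only the nesting of blocks
  is left; each level costs one more layer of the truth definition, which is why \<open>n\<close> is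
  fixed in advance. Squares are taken because the length argument fails for first powers. With free
  generators \<open>a\<close>, \<open>c\<close>, \<open>d\<close>, the pair \<open>ac\<close>,
  \<open>ad\<close> satisfies the length conditions obtained from minimality, but the word
  \<open>ac\<close> is lengthened by the inverse of neither: the results are the empty word and
  \<open>d^-1 c\<close>.\<close>

lemma finite_vars_tm [simp]: "finite (vars_tm s)"
  by (induction s) auto

lemma finite_free_vars [simp]: "finite (free_vars \<phi>)"
  by (induction \<phi>) auto

lemma eval_tm_cong: "(\<And>i. i \<in> vars_tm s \<Longrightarrow> e i = e' i) \<Longrightarrow> eval_tm R e s = eval_tm R e' s"
  by (induction s) auto

lemma sat_cong: "(\<And>i. i \<in> free_vars \<phi> \<Longrightarrow> e i = e' i) \<Longrightarrow> sat R e \<phi> \<longleftrightarrow> sat R e' \<phi>"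
proof (induction \<phi> arbitrary: e e')
  case (Eq s u)
  have "eval_tm R e s = eval_tm R e' s" "eval_tm R e u = eval_tm R e' u"
    by (auto intro!: eval_tm_cong Eq)
  then show ?case by simp
next
  case (Neg \<phi>)
  have "sat R e \<phi> \<longleftrightarrow> sat R e' \<phi>" by (rule Neg.IH) (simp add: Neg.prems)
  then show ?case by simp
next
  case (Conj \<phi> \<psi>)
  have "sat R e \<phi> \<longleftrightarrow> sat R e' \<phi>" by (rule Conj.IH) (simp add: Conj.prems)
  moreover have "sat R e \<psi> \<longleftrightarrow> sat R e' \<psi>" by (rule Conj.IH) (simp add: Conj.prems)
  ultimately show ?case by simp
next
  case (Disj \<phi> \<psi>)
  have "sat R e \<phi> \<longleftrightarrow> sat R e' \<phi>" by (rule Disj.IH) (simp add: Disj.prems)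
  moreover have "sat R e \<psi> \<longleftrightarrow> sat R e' \<psi>" by (rule Disj.IH) (simp add: Disj.prems)
  ultimately show ?case by simp
next
  case (Ex i \<phi>)
  have "sat R (e(i := a)) \<phi> \<longleftrightarrow> sat R (e'(i := a)) \<phi>" for a
    by (rule Ex.IH) (simp add: Ex.prems)
  then show ?case by simp
next
  case (All i \<phi>)
  have "sat R (e(i := a)) \<phi> \<longleftrightarrow> sat R (e'(i := a)) \<phi>" for a
    by (rule All.IH) (simp add: All.prems)
  then show ?case by simp
qed

primrec rename_tm :: "(nat \<Rightarrow> nat) \<Rightarrow> 'a tm \<Rightarrow> 'a tm" where
  "rename_tm r (Var i) = Var (r i)"
| "rename_tm r (Const c) = Const c"
| "rename_tm r Zero = Zero"
| "rename_tm r One = One"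
| "rename_tm r (Add s u) = Add (rename_tm r s) (rename_tm r u)"
| "rename_tm r (Mult s u) = Mult (rename_tm r s) (rename_tm r u)"

lemma consts_rename_tm [simp]: "consts_tm (rename_tm r s) = consts_tm s"
  by (induction s) auto

lemma eval_rename_tm [simp]: "eval_tm R e (rename_tm r s) = eval_tm R (\<lambda>i. e (r i)) s"
  by (induction s) auto

lemma rename_binder:
  assumes "j \<notin> r ` free_vars \<phi>"
  shows "sat R (\<lambda>m. (e(j := a)) ((r(i := j)) m)) \<phi> \<longleftrightarrow> sat R ((\<lambda>m. e (r m))(i := a)) \<phi>"
proof (rule sat_cong)
  fix m assume "m \<in> free_vars \<phi>"
  then have "r m \<noteq> j" using assms by blast
  then show "(e(j := a)) ((r(i := j)) m) = ((\<lambda>m. e (r m))(i := a)) m" by simp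
qed

text \<open>Proved as an existence statement rather than defined by recursion, because each binder
  moves to a variable \<open>j\<close> chosen outside the image of the free variables under
  \<open>r\<close>, so that nothing is captured.\<close>

lemma rename_fm:
  "\<exists>\<phi>'. consts_fm \<phi>' = consts_fm \<phi> \<and> (\<forall>e. sat R e \<phi>' \<longleftrightarrow> sat R (\<lambda>i. e (r i)) \<phi>)"
proof (induction \<phi> arbitrary: r)
  case (Eq s u)
  show ?case by (intro exI[of _ "Eq (rename_tm r s) (rename_tm r u)"]) simp
next
  case (Neg \<phi>)
  obtain \<phi>' where "consts_fm \<phi>' = consts_fm \<phi> \<and> (\<forall>e. sat R e \<phi>' \<longleftrightarrow> sat R (\<lambda>i. e (r i)) \<phi>)"
    using Neg[of r] by blast
  then show ?case by (intro exI[of _ "Neg \<phi>'"]) simp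
next
  case (Conj \<phi> \<psi>)
  obtain \<phi>' where "consts_fm \<phi>' = consts_fm \<phi> \<and> (\<forall>e. sat R e \<phi>' \<longleftrightarrow> sat R (\<lambda>i. e (r i)) \<phi>)"
    using Conj(1)[of r] by blast
  moreover obtain \<psi>' where "consts_fm \<psi>' = consts_fm \<psi> \<and> (\<forall>e. sat R e \<psi>' \<longleftrightarrow> sat R (\<lambda>i. e (r i)) \<psi>)"
    using Conj(2)[of r] by blast
  ultimately show ?case by (intro exI[of _ "Conj \<phi>' \<psi>'"]) simp
next
  case (Disj \<phi> \<psi>)
  obtain \<phi>' where "consts_fm \<phi>' = consts_fm \<phi> \<and> (\<forall>e. sat R e \<phi>' \<longleftrightarrow> sat R (\<lambda>i. e (r i)) \<phi>)"
    using Disj(1)[of r] by blast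
  moreover obtain \<psi>' where "consts_fm \<psi>' = consts_fm \<psi> \<and> (\<forall>e. sat R e \<psi>' \<longleftrightarrow> sat R (\<lambda>i. e (r i)) \<psi>)"
    using Disj(2)[of r] by blast
  ultimately show ?case by (intro exI[of _ "Disj \<phi>' \<psi>'"]) simp
next
  case (Ex i \<phi>)
  obtain j where j: "j \<notin> r ` free_vars \<phi>"
    using ex_new_if_finite[of "r ` free_vars \<phi>"] by auto
  obtain \<phi>' where "consts_fm \<phi>' = consts_fm \<phi> \<and>
      (\<forall>e. sat R e \<phi>' \<longleftrightarrow> sat R (\<lambda>m. e ((r(i := j)) m)) \<phi>)"
    using Ex[of "r(i := j)"] by blast
  then have "sat R (e(j := a)) \<phi>' \<longleftrightarrow> sat R ((\<lambda>m. e (r m))(i := a)) \<phi>" "consts_fm \<phi>' = consts_fm \<phi>" for e a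
    by (simp_all only: rename_binder[OF j])
  then show ?case by (intro exI[of _ "Ex j \<phi>'"]) simp
next
  case (All i \<phi>)
  obtain j where j: "j \<notin> r ` free_vars \<phi>"
    using ex_new_if_finite[of "r ` free_vars \<phi>"] by auto
  obtain \<phi>' where "consts_fm \<phi>' = consts_fm \<phi> \<and>
      (\<forall>e. sat R e \<phi>' \<longleftrightarrow> sat R (\<lambda>m. e ((r(i := j)) m)) \<phi>)"
    using All[of "r(i := j)"] by blast
  then have "sat R (e(j := a)) \<phi>' \<longleftrightarrow> sat R ((\<lambda>m. e (r m))(i := a)) \<phi>" "consts_fm \<phi>' = consts_fm \<phi>" for e a
    by (simp_all only: rename_binder[OF j])
  then show ?case by (intro exI[of _ "All j \<phi>'"]) simp
qed

definition environment :: "('a, 'm) ring_scheme \<Rightarrow> (nat \<Rightarrow> 'a) \<Rightarrow> bool" where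
  "environment R e \<longleftrightarrow> (\<forall>i. e i \<in> carrier R)"

definition expressible_tm :: "('a, 'm) ring_scheme \<Rightarrow> ((nat \<Rightarrow> 'a) \<Rightarrow> 'a) \<Rightarrow> bool" where
  "expressible_tm R f \<longleftrightarrow> (\<exists>s. consts_tm s = {} \<and> (\<forall>e. environment R e \<longrightarrow> eval_tm R e s = f e))"

text \<open>Predicates on environments stand in for formulas: a HOL definition is shown to be
  first-order by unfolding it and applying closure rules, so the large formulas below are never
  written out.\<close>

definition expressible :: "('a, 'm) ring_scheme \<Rightarrow> ((nat \<Rightarrow> 'a) \<Rightarrow> bool) \<Rightarrow> bool" where
  "expressible R P \<longleftrightarrow> (\<exists>\<phi>. consts_fm \<phi> = {} \<and> (\<forall>e. environment R e \<longrightarrow> (sat R e \<phi> \<longleftrightarrow> P e)))"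

lemma expressible_tm_var: "expressible_tm R (\<lambda>e. e i)"
  unfolding expressible_tm_def by (intro exI[of _ "Var i"]) simp

lemma expressible_tm_zero: "expressible_tm R (\<lambda>e. \<zero>\<^bsub>R\<^esub>)"
  unfolding expressible_tm_def by (intro exI[of _ Zero]) simp

lemma expressible_tm_one: "expressible_tm R (\<lambda>e. \<one>\<^bsub>R\<^esub>)"
  unfolding expressible_tm_def by (intro exI[of _ One]) simp

lemma expressible_tm_add:
  assumes "expressible_tm R f" "expressible_tm R g"
  shows "expressible_tm R (\<lambda>e. f e \<oplus>\<^bsub>R\<^esub> g e)"
proof -
  obtain s u where "consts_tm s = {} \<and> (\<forall>e. environment R e \<longrightarrow> eval_tm R e s = f e)"
    "consts_tm u = {} \<and> (\<forall>e. environment R e \<longrightarrow> eval_tm R e u = g e)"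
    using assms unfolding expressible_tm_def by blast
  then show ?thesis unfolding expressible_tm_def by (intro exI[of _ "Add s u"]) simp
qed

lemma expressible_tm_mult:
  assumes "expressible_tm R f" "expressible_tm R g"
  shows "expressible_tm R (\<lambda>e. f e \<otimes>\<^bsub>R\<^esub> g e)"
proof -
  obtain s u where "consts_tm s = {} \<and> (\<forall>e. environment R e \<longrightarrow> eval_tm R e s = f e)"
    "consts_tm u = {} \<and> (\<forall>e. environment R e \<longrightarrow> eval_tm R e u = g e)"
    using assms unfolding expressible_tm_def by blast
  then show ?thesis unfolding expressible_tm_def by (intro exI[of _ "Mult s u"]) simp
qed

lemma expressible_eq:
  assumes "expressible_tm R f" "expressible_tm R g"
  shows "expressible R (\<lambda>e. f e = g e)"
proof -
  obtain s u where "consts_tm s = {} \<and> (\<forall>e. environment R e \<longrightarrow> eval_tm R e s = f e)"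
    "consts_tm u = {} \<and> (\<forall>e. environment R e \<longrightarrow> eval_tm R e u = g e)"
    using assms unfolding expressible_tm_def by blast
  then show ?thesis unfolding expressible_def by (intro exI[of _ "Eq s u"]) simp
qed

lemma expressible_not:
  assumes "expressible R P"
  shows "expressible R (\<lambda>e. \<not> P e)"
proof -
  obtain \<phi> where "consts_fm \<phi> = {} \<and> (\<forall>e. environment R e \<longrightarrow> (sat R e \<phi> \<longleftrightarrow> P e))"
    using assms unfolding expressible_def by blast
  then show ?thesis unfolding expressible_def by (intro exI[of _ "Neg \<phi>"]) simp
qed

lemma expressible_conj:
  assumes "expressible R P" "expressible R Q"
  shows "expressible R (\<lambda>e. P e \<and> Q e)"
proof -
  obtain \<phi> \<psi> where "consts_fm \<phi> = {} \<and> (\<forall>e. environment R e \<longrightarrow> (sat R e \<phi> \<longleftrightarrow> P e))"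
    "consts_fm \<psi> = {} \<and> (\<forall>e. environment R e \<longrightarrow> (sat R e \<psi> \<longleftrightarrow> Q e))"
    using assms unfolding expressible_def by blast
  then show ?thesis unfolding expressible_def by (intro exI[of _ "Conj \<phi> \<psi>"]) simp
qed

lemma expressible_disj: "expressible R P \<Longrightarrow> expressible R Q \<Longrightarrow> expressible R (\<lambda>e. P e \<or> Q e)"
  using expressible_not[OF expressible_conj[OF expressible_not expressible_not]] by simp

lemma expressible_imp: "expressible R P \<Longrightarrow> expressible R Q \<Longrightarrow> expressible R (\<lambda>e. P e \<longrightarrow> Q e)"
  using expressible_not[OF expressible_conj[OF _ expressible_not]] by simp

lemma expressible_False: "expressible R (\<lambda>e. False)"
  using expressible_not[OF expressible_eq[OF expressible_tm_zero expressible_tm_zero]] by simp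

text \<open>The premise binds \<open>x\<close> in the style of de Bruijn: it becomes variable 0 and the others shift.\<close>
lemma expressible_ex:
  assumes "expressible R (\<lambda>e. P (e 0) (\<lambda>i. e (Suc i)))"
  shows "expressible R (\<lambda>e. \<exists>x \<in> carrier R. P x e)"
proof -
  obtain \<phi> where \<phi>: "consts_fm \<phi> = {}"
    "\<And>e. environment R e \<Longrightarrow> sat R e \<phi> \<longleftrightarrow> P (e 0) (\<lambda>i. e (Suc i))"
    using assms unfolding expressible_def by blast
  define N where "N = Suc (Max (insert 0 (free_vars \<phi>)))"
  have N: "i < N" if "i \<in> free_vars \<phi>" for i
    unfolding N_def using that by (simp add: less_Suc_eq_le)
  \<comment> \<open>The renaming \<open>case_nat N id\<close> undoes the shift: variable 0 becomes
    the fresh \<open>N\<close>, and \<open>Suc i\<close> becomes \<open>i\<close> again.\<close>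
  obtain \<phi>' where \<phi>': "consts_fm \<phi>' = consts_fm \<phi>"
    "\<And>e. sat R e \<phi>' \<longleftrightarrow> sat R (\<lambda>i. e (case_nat N id i)) \<phi>"
    using rename_fm[of \<phi> R "case_nat N id"] by blast
  have "sat R e (Ex N \<phi>') \<longleftrightarrow> (\<exists>x \<in> carrier R. P x e)" if e: "environment R e" for e
  proof -
    have "sat R (e(N := x)) \<phi>' \<longleftrightarrow> P x e" if x: "x \<in> carrier R" for x
    proof -
      have "sat R (e(N := x)) \<phi>' \<longleftrightarrow> sat R (case_nat x e) \<phi>"
        unfolding \<phi>'(2) using N by (intro sat_cong) (force split: nat.splits)
      also have "\<dots> \<longleftrightarrow> P x e"
        using e x by (subst \<phi>(2)) (auto simp: environment_def split: nat.splits)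
      finally show ?thesis .
    qed
    then show ?thesis by simp
  qed
  then show ?thesis
    unfolding expressible_def using \<phi>(1) \<phi>'(1) by (intro exI[of _ "Ex N \<phi>'"]) simp
qed

lemma expressible_all:
  assumes "expressible R (\<lambda>e. P (e 0) (\<lambda>i. e (Suc i)))"
  shows "expressible R (\<lambda>e. \<forall>x \<in> carrier R. P x e)"
  using expressible_not[OF expressible_ex[of R "\<lambda>x e. \<not> P x e", OF expressible_not[OF assms]]] by simp

lemmas expressible_intros = expressible_tm_var expressible_tm_zero expressible_tm_one expressible_tm_add expressible_tm_mult
  expressible_eq expressible_not expressible_conj expressible_disj expressible_imp expressible_False expressible_ex expressible_all

section \<open>Coding finite functions in a ring\<close>

definition scalar :: "('a, 'm) ring_scheme \<Rightarrow> 'a \<Rightarrow> bool" where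
  "scalar R k \<longleftrightarrow> k \<in> carrier R \<and> (\<exists>u \<in> carrier R. k \<otimes>\<^bsub>R\<^esub> u = \<one>\<^bsub>R\<^esub>) \<and>
     (\<exists>u \<in> carrier R. (k \<oplus>\<^bsub>R\<^esub> \<one>\<^bsub>R\<^esub>) \<otimes>\<^bsub>R\<^esub> u = \<one>\<^bsub>R\<^esub>)"

text \<open>
  The first two entries of \<open>\<pi>\<close> are elements \<open>t\<close> and \<open>t'\<close>; the equations say
  \<open>d = (t - k) u\<close>, \<open>x = (t - 1) a + (t' - 1) b\<close>, \<open>a = z + (t - k) u\<close> and \<open>b = z + (t' - k) v\<close>.
\<close>
definition mem :: "('a, 'm) ring_scheme \<Rightarrow> (nat \<Rightarrow> 'a) \<Rightarrow> 'a \<Rightarrow> 'a \<Rightarrow> bool" where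
  "mem R \<pi> d k \<longleftrightarrow> scalar R k \<and> (\<exists>u \<in> carrier R. d \<oplus>\<^bsub>R\<^esub> k \<otimes>\<^bsub>R\<^esub> u = \<pi> 0 \<otimes>\<^bsub>R\<^esub> u)"

definition codes_pair :: "('a, 'm) ring_scheme \<Rightarrow> (nat \<Rightarrow> 'a) \<Rightarrow> 'a \<Rightarrow> 'a \<Rightarrow> 'a \<Rightarrow> bool" where
  "codes_pair R \<pi> x a b \<longleftrightarrow>
     x \<oplus>\<^bsub>R\<^esub> (a \<oplus>\<^bsub>R\<^esub> b) = \<pi> 0 \<otimes>\<^bsub>R\<^esub> a \<oplus>\<^bsub>R\<^esub> \<pi> 1 \<otimes>\<^bsub>R\<^esub> b"

definition lookup :: "('a, 'm) ring_scheme \<Rightarrow> (nat \<Rightarrow> 'a) \<Rightarrow> 'a \<Rightarrow> 'a \<Rightarrow> 'a \<Rightarrow> bool" where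
  "lookup R \<pi> x k z \<longleftrightarrow>
     (\<exists>a \<in> carrier R. \<exists>b \<in> carrier R. codes_pair R \<pi> x a b \<and>
        (\<exists>u \<in> carrier R. a \<oplus>\<^bsub>R\<^esub> k \<otimes>\<^bsub>R\<^esub> u = z \<oplus>\<^bsub>R\<^esub> \<pi> 0 \<otimes>\<^bsub>R\<^esub> u) \<and>
        (\<exists>v \<in> carrier R. b \<oplus>\<^bsub>R\<^esub> k \<otimes>\<^bsub>R\<^esub> v = z \<oplus>\<^bsub>R\<^esub> \<pi> 1 \<otimes>\<^bsub>R\<^esub> v))"

section \<open>The Chinese remainder theorem at central points of a noncommutative ring\<close>

context ring
begin

lemma add_eq_iff_eq_minus:
  assumes "x \<in> carrier R" "y \<in> carrier R" "z \<in> carrier R"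
  shows "x \<oplus> y = z \<longleftrightarrow> x = z \<ominus> y"
proof
  assume "x \<oplus> y = z"
  moreover have "x = (x \<oplus> y) \<ominus> y" using assms by algebra
  ultimately show "x = z \<ominus> y" by simp
next
  assume "x = z \<ominus> y"
  then show "x \<oplus> y = z" using assms by algebra
qed

lemma eq_if_minus_eq_zero:
  assumes "x \<ominus> y = \<zero>" "x \<in> carrier R" "y \<in> carrier R"
  shows "x = y"
proof -
  have "x = (x \<ominus> y) \<oplus> y" using assms(2,3) by algebra
  then show ?thesis using assms by simp
qed

text \<open>The language has no subtraction, so \<open>mem\<close> and \<open>lookup\<close> state
  their equations with the negative terms moved to the other side; this brings them back to
  divisibility by \<open>a - k\<close>.\<close>

lemma root_equation_iff:
  assumes "a \<in> carrier R" "k \<in> carrier R" "x \<in> carrier R" "z \<in> carrier R" "u \<in> carrier R"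
  shows "x \<oplus> k \<otimes> u = z \<oplus> a \<otimes> u \<longleftrightarrow> x \<ominus> z = (a \<ominus> k) \<otimes> u"
proof -
  have "x \<oplus> k \<otimes> u = z \<oplus> a \<otimes> u \<longleftrightarrow> x = z \<oplus> a \<otimes> u \<ominus> k \<otimes> u"
    using assms by (intro add_eq_iff_eq_minus) auto
  also have "z \<oplus> a \<otimes> u \<ominus> k \<otimes> u = (a \<ominus> k) \<otimes> u \<oplus> z"
    using assms by algebra
  also have "x = (a \<ominus> k) \<otimes> u \<oplus> z \<longleftrightarrow> x \<ominus> z = (a \<ominus> k) \<otimes> u"
    using assms add_eq_iff_eq_minus[of "(a \<ominus> k) \<otimes> u" z x] by auto
  finally show ?thesis .
qed

text \<open>With these two properties the elements of \<open>Z\<close> act as evaluation points for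
  polynomials in a ring element: centrality makes evaluation multiplicative, and unit differences
  make the values outside the roots invertible.\<close>

definition separated_central :: "'a set \<Rightarrow> bool" where
  "separated_central Z \<longleftrightarrow> Z \<subseteq> carrier R \<and> (\<forall>k \<in> Z. \<forall>x \<in> carrier R. k \<otimes> x = x \<otimes> k) \<and>
     (\<forall>k \<in> Z. \<forall>l \<in> Z. k \<noteq> l \<longrightarrow> k \<ominus> l \<in> Units R)"

lemma separated_centralD:
  assumes "separated_central Z"
  shows "k \<in> Z \<Longrightarrow> k \<in> carrier R" "k \<in> Z \<Longrightarrow> x \<in> carrier R \<Longrightarrow> k \<otimes> x = x \<otimes> k"
    "k \<in> Z \<Longrightarrow> l \<in> Z \<Longrightarrow> k \<noteq> l \<Longrightarrow> k \<ominus> l \<in> Units R"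
  using assms unfolding separated_central_def by blast+

text \<open>\<open>d\<close> is the product of \<open>a - s\<close> over \<open>s\<close> in
  \<open>A\<close>, a polynomial in \<open>a\<close> with central coefficients. Its remainder modulo
  \<open>(a - k) R\<close> is its value at \<open>k\<close>, the product of the
  \<open>k - s\<close>, which is a central unit for \<open>k\<close> in \<open>Z\<close> outside
  \<open>A\<close>.\<close>

lemma vanishing_polynomial:
  assumes a: "a \<in> carrier R" and A: "finite A" "A \<subseteq> Z"
    and "separated_central Z"
  shows "\<exists>d \<in> carrier R. d \<otimes> a = a \<otimes> d \<and>
    (\<forall>k \<in> A. \<exists>u \<in> carrier R. d = (a \<ominus> k) \<otimes> u) \<and>
    (\<forall>k \<in> Z - A. \<exists>z \<in> Units R. (\<forall>x \<in> carrier R. z \<otimes> x = x \<otimes> z) \<and>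
       (\<exists>u \<in> carrier R. d \<ominus> z = (a \<ominus> k) \<otimes> u))"
  using A
proof (induction A)
  case empty
  show ?case
  proof (rule bexI[of _ \<one>], intro conjI ballI)
    show "\<exists>z\<in>Units R. (\<forall>x\<in>carrier R. z \<otimes> x = x \<otimes> z) \<and> (\<exists>u\<in>carrier R. \<one> \<ominus> z = (a \<ominus> k) \<otimes> u)"
      if "k \<in> Z - {}" for k
    proof -
      have "\<one> \<ominus> \<one> = (a \<ominus> k) \<otimes> \<zero>" using that a separated_centralD(1)[OF assms(4), of k] by (simp add: minus_eq r_neg)
      then have "\<exists>u\<in>carrier R. \<one> \<ominus> \<one> = (a \<ominus> k) \<otimes> u" by (rule bexI) (rule zero_closed)
      moreover have "\<forall>x\<in>carrier R. \<one> \<otimes> x = x \<otimes> \<one>" by simp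
      ultimately show ?thesis using Units_one_closed by blast
    qed
  qed (use a in auto)
next
  case (insert s A)
  note Z = separated_centralD[OF assms(4)]
  have "A \<subseteq> Z" using insert.prems by simp
  then obtain d where d: "d \<in> carrier R" "d \<otimes> a = a \<otimes> d"
    "\<forall>k \<in> A. \<exists>u \<in> carrier R. d = (a \<ominus> k) \<otimes> u"
    "\<forall>k \<in> Z - A. \<exists>z \<in> Units R. (\<forall>x \<in> carrier R. z \<otimes> x = x \<otimes> z) \<and>
       (\<exists>u \<in> carrier R. d \<ominus> z = (a \<ominus> k) \<otimes> u)"
    by (elim insert.IH[THEN bexE] conjE) (rule that)
  have s: "s \<in> Z" "s \<in> carrier R" "s \<otimes> a = a \<otimes> s" "s \<otimes> d = d \<otimes> s"
    using insert.prems Z(1,2) a d(1) by auto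
  show ?case
  proof (rule bexI[of _ "d \<otimes> (a \<ominus> s)"], intro conjI ballI)
    show "d \<otimes> (a \<ominus> s) \<in> carrier R" using d(1) a s(2) by simp
    have "d \<otimes> (a \<ominus> s) \<otimes> a = d \<otimes> a \<otimes> a \<ominus> d \<otimes> (s \<otimes> a)"
      using d(1) a s(2) by algebra
    also have "\<dots> = a \<otimes> (d \<otimes> (a \<ominus> s))"
      unfolding s(3) d(2) using d(1,2) a s(2) m_assoc[of d a s] by algebra
    finally show "d \<otimes> (a \<ominus> s) \<otimes> a = a \<otimes> (d \<otimes> (a \<ominus> s))" .
    show "\<exists>u\<in>carrier R. d \<otimes> (a \<ominus> s) = (a \<ominus> k) \<otimes> u" if k: "k \<in> insert s A" for k
    proof (cases "k = s")
      case True
      have "d \<otimes> (a \<ominus> s) = (a \<ominus> s) \<otimes> d"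
        using d(1,2) a s by algebra
      then show ?thesis using True d(1) by blast
    next
      case False
      then obtain u where "u \<in> carrier R" "d = (a \<ominus> k) \<otimes> u" using d(3) k by blast
      then show ?thesis
        using a s(2) Z(1) insert.prems k by (intro bexI[of _ "u \<otimes> (a \<ominus> s)"]) (auto simp: m_assoc)
    qed
    show "\<exists>z\<in>Units R. (\<forall>x\<in>carrier R. z \<otimes> x = x \<otimes> z) \<and>
        (\<exists>u\<in>carrier R. d \<otimes> (a \<ominus> s) \<ominus> z = (a \<ominus> k) \<otimes> u)" if k: "k \<in> Z - insert s A" for k
    proof -
      obtain z u where z: "z \<in> Units R" "\<forall>x\<in>carrier R. z \<otimes> x = x \<otimes> z"
        and u: "u \<in> carrier R" "d \<ominus> z = (a \<ominus> k) \<otimes> u" using bspec[OF d(4), of k] k by blast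
      have kZ: "k \<in> Z" "k \<in> carrier R" and zc: "z \<in> carrier R" using k Z(1) z(1) by auto
      have ks: "k \<ominus> s \<in> Units R" using Z(3)[of k s] k s(1) by auto
      show ?thesis
      proof (rule bexI[of _ "z \<otimes> (k \<ominus> s)"], intro conjI ballI)
        show "z \<otimes> (k \<ominus> s) \<in> Units R" using z(1) ks by simp
        show "z \<otimes> (k \<ominus> s) \<otimes> x = x \<otimes> (z \<otimes> (k \<ominus> s))" if x: "x \<in> carrier R" for x
        proof -
          have "z \<otimes> (k \<ominus> s) \<otimes> x = z \<otimes> (k \<otimes> x \<ominus> s \<otimes> x)"
            using x zc kZ(2) s(2) by algebra
          also have "\<dots> = (z \<otimes> x) \<otimes> (k \<ominus> s)"
            unfolding Z(2)[OF kZ(1) x] Z(2)[OF s(1) x] using x zc kZ(2) s(2) by algebra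
          also have "\<dots> = x \<otimes> (z \<otimes> (k \<ominus> s))"
            unfolding z(2)[rule_format, OF x] using x zc kZ(2) s(2) by algebra
          finally show ?thesis .
        qed
        \<comment> \<open>Remainders multiply. The first summand is already a right multiple of
          \<open>a - k\<close>; centrality of \<open>z\<close> is what makes the second one such a
          multiple.\<close>
        have "d \<otimes> (a \<ominus> s) \<ominus> z \<otimes> (k \<ominus> s) = (d \<ominus> z) \<otimes> (a \<ominus> s) \<oplus> z \<otimes> (a \<ominus> k)"
          using d(1) a s(2) zc kZ(2) by algebra
        also have "z \<otimes> (a \<ominus> k) = (a \<ominus> k) \<otimes> z"
          by (rule z(2)[rule_format]) (use a kZ(2) in simp)
        also have "(d \<ominus> z) \<otimes> (a \<ominus> s) \<oplus> (a \<ominus> k) \<otimes> z = (a \<ominus> k) \<otimes> (u \<otimes> (a \<ominus> s) \<oplus> z)"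
          unfolding u(2) using u(1) a s(2) zc kZ(2) by algebra
        finally have "d \<otimes> (a \<ominus> s) \<ominus> z \<otimes> (k \<ominus> s) = (a \<ominus> k) \<otimes> (u \<otimes> (a \<ominus> s) \<oplus> z)" .
        moreover have "u \<otimes> (a \<ominus> s) \<oplus> z \<in> carrier R" using u(1) a s(2) zc by simp
        ultimately show "\<exists>u\<in>carrier R. d \<otimes> (a \<ominus> s) \<ominus> z \<otimes> (k \<ominus> s) = (a \<ominus> k) \<otimes> u" by blast
      qed
    qed
  qed
qed

text \<open>Newton interpolation: a solution \<open>c\<close> for \<open>A\<close> is corrected by
  \<open>d y\<close>, where \<open>d\<close> vanishes at the points of \<open>A\<close> and has the
  unit remainder \<open>z\<close> at the new point \<open>s\<close>; so \<open>y\<close> is the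
  missing difference \<open>f s - c\<close> divided by \<open>z\<close>.\<close>

lemma chinese_remainder:
  assumes a: "a \<in> carrier R" and A: "finite A" "A \<subseteq> Z"
    and "separated_central Z"
    and f: "\<And>k. k \<in> A \<Longrightarrow> f k \<in> carrier R"
  shows "\<exists>c \<in> carrier R. \<forall>k \<in> A. \<exists>u \<in> carrier R. c \<ominus> f k = (a \<ominus> k) \<otimes> u"
  using A f
proof (induction A)
  case empty
  then show ?case by auto
next
  case (insert s A)
  note Z = separated_centralD[OF assms(4)]
  obtain c where c: "c \<in> carrier R" "\<And>k. k \<in> A \<Longrightarrow> \<exists>u \<in> carrier R. c \<ominus> f k = (a \<ominus> k) \<otimes> u"
    using insert.IH insert.prems by blast
  have A: "finite A" "A \<subseteq> Z" and s: "s \<in> Z - A" "s \<in> carrier R" and fs: "f s \<in> carrier R"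
    using insert.hyps insert.prems Z(1) by auto
  obtain d where d: "d \<in> carrier R" "\<And>k. k \<in> A \<Longrightarrow> \<exists>u \<in> carrier R. d = (a \<ominus> k) \<otimes> u"
    and "\<exists>z \<in> Units R. (\<forall>x \<in> carrier R. z \<otimes> x = x \<otimes> z) \<and> (\<exists>u \<in> carrier R. d \<ominus> z = (a \<ominus> s) \<otimes> u)"
    using vanishing_polynomial[OF a A assms(4)] s(1) by blast
  then obtain z u where z: "z \<in> Units R" and u: "u \<in> carrier R" "d \<ominus> z = (a \<ominus> s) \<otimes> u"
    by blast
  define y where "y = inv z \<otimes> (f s \<ominus> c)"
  have zc: "z \<in> carrier R" and iz: "inv z \<in> carrier R" using z by auto
  then have y: "y \<in> carrier R" unfolding y_def using fs c(1) by simp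
  have "z \<otimes> y = (z \<otimes> inv z) \<otimes> (f s \<ominus> c)"
    unfolding y_def using zc iz fs c(1) by (simp only: m_assoc minus_closed)
  then have zy: "z \<otimes> y = f s \<ominus> c" using z fs c(1) by simp
  show ?case
  proof (rule bexI[of _ "c \<oplus> d \<otimes> y"], rule ballI)
    show "c \<oplus> d \<otimes> y \<in> carrier R" using c(1) d(1) y by simp
    show "\<exists>u \<in> carrier R. c \<oplus> d \<otimes> y \<ominus> f k = (a \<ominus> k) \<otimes> u" if k: "k \<in> insert s A" for k
    proof (cases "k = s")
      case True
      have "c \<oplus> d \<otimes> y \<ominus> f s = (d \<ominus> z) \<otimes> y \<oplus> z \<otimes> y \<oplus> c \<ominus> f s"
        using c(1) d(1) y zc fs by algebra
      also have "\<dots> = (a \<ominus> s) \<otimes> (u \<otimes> y)"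
        unfolding u(2) zy using c(1) u(1) y fs a s(2) by algebra
      finally show ?thesis using True u(1) y by blast
    next
      case False
      then have kA: "k \<in> A" using k by simp
      then obtain v w where v: "v \<in> carrier R" "c \<ominus> f k = (a \<ominus> k) \<otimes> v"
        and w: "w \<in> carrier R" "d = (a \<ominus> k) \<otimes> w" using c(2) d(2) by blast
      have kc: "k \<in> carrier R" "f k \<in> carrier R" using kA insert.prems Z(1) by auto
      have "c \<oplus> d \<otimes> y \<ominus> f k = (c \<ominus> f k) \<oplus> d \<otimes> y"
        using c(1) d(1) y kc by algebra
      also have "\<dots> = (a \<ominus> k) \<otimes> (v \<oplus> w \<otimes> y)"
        unfolding v(2) unfolding w(2) using v(1) w(1) y a kc by algebra
      finally show ?thesis using v(1) w(1) y by blast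
    qed
  qed
qed

end

text \<open>Everything about the ring that coding requires. In \<open>independent\<close> the case
  \<open>k = 1\<close> is listed separately because pairs are coded with it, while 1 is not a
  \<open>scalar\<close> in characteristic 2.\<close>

locale coding = ring R for R (structure) +
  fixes t t'
  assumes one_not_zero: "\<one> \<noteq> \<zero>"
    and params_closed: "t \<in> carrier R" "t' \<in> carrier R"
    and infinite_scalars: "infinite (Collect (scalar R))"
    and scalar_central: "scalar R k \<Longrightarrow> x \<in> carrier R \<Longrightarrow> k \<otimes> x = x \<otimes> k"
    and scalar_diff: "scalar R k \<Longrightarrow> scalar R l \<Longrightarrow> k \<noteq> l \<Longrightarrow> k \<ominus> l \<in> Units R"
    and independent: "scalar R k \<or> k = \<one> \<Longrightarrow> u \<in> carrier R \<Longrightarrow> v \<in> carrier R \<Longrightarrow>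
      (t \<ominus> k) \<otimes> u = (t' \<ominus> k) \<otimes> v \<Longrightarrow> u = \<zero> \<and> v = \<zero>"
begin

lemma scalar_closed: "scalar R k \<Longrightarrow> k \<in> carrier R"
  by (simp add: scalar_def)

lemma scalars: "separated_central (Collect (scalar R))"
  unfolding separated_central_def using scalar_closed scalar_central scalar_diff by auto

end

text \<open>Formulas have no constants and see \<open>t\<close> and \<open>t'\<close> only as values
  of variables; \<open>\<pi>\<close> lists these values, and its further entries will hold a
  program.\<close>

locale coding_params = coding +
  fixes \<pi> :: "nat \<Rightarrow> 'a"
  assumes params: "\<pi> 0 = t" "\<pi> 1 = t'"
begin

lemma codes_pair_iff:
  assumes "x \<in> carrier R" "a \<in> carrier R" "b \<in> carrier R"
  shows "codes_pair R \<pi> x a b \<longleftrightarrow> x = (t \<ominus> \<one>) \<otimes> a \<oplus> (t' \<ominus> \<one>) \<otimes> b"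
proof -
  have "codes_pair R \<pi> x a b \<longleftrightarrow> x = t \<otimes> a \<oplus> t' \<otimes> b \<ominus> (a \<oplus> b)"
    unfolding codes_pair_def params using assms params_closed by (intro add_eq_iff_eq_minus) auto
  also have "t \<otimes> a \<oplus> t' \<otimes> b \<ominus> (a \<oplus> b) = (t \<ominus> \<one>) \<otimes> a \<oplus> (t' \<ominus> \<one>) \<otimes> b"
    using assms params_closed by algebra
  finally show ?thesis .
qed

lemma codes_pair_exists:
  assumes "a \<in> carrier R" "b \<in> carrier R"
  shows "\<exists>x \<in> carrier R. codes_pair R \<pi> x a b"
  using assms params_closed codes_pair_iff[of "(t \<ominus> \<one>) \<otimes> a \<oplus> (t' \<ominus> \<one>) \<otimes> b" a b] by auto

text \<open>Two decodings of \<open>x\<close> give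
  \<open>(t - 1) (a - a') = (t' - 1) (b' - b)\<close>, and \<open>independent\<close> at 1 makes
  both factors vanish.\<close>

lemma codes_pair_unique:
  assumes "x \<in> carrier R" "a \<in> carrier R" "b \<in> carrier R" "a' \<in> carrier R" "b' \<in> carrier R"
    and "codes_pair R \<pi> x a b" "codes_pair R \<pi> x a' b'"
  shows "a = a' \<and> b = b'"
proof -
  have eq: "(t \<ominus> \<one>) \<otimes> a \<oplus> (t' \<ominus> \<one>) \<otimes> b = (t \<ominus> \<one>) \<otimes> a' \<oplus> (t' \<ominus> \<one>) \<otimes> b'"
    using assms by (simp add: codes_pair_iff)
  have "(t \<ominus> \<one>) \<otimes> (a \<ominus> a') =
    (t \<ominus> \<one>) \<otimes> a \<oplus> (t' \<ominus> \<one>) \<otimes> b \<ominus> (t' \<ominus> \<one>) \<otimes> b \<ominus> (t \<ominus> \<one>) \<otimes> a'"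
    using assms(2-5) params_closed by algebra
  also note eq
  also have "(t \<ominus> \<one>) \<otimes> a' \<oplus> (t' \<ominus> \<one>) \<otimes> b' \<ominus> (t' \<ominus> \<one>) \<otimes> b \<ominus> (t \<ominus> \<one>) \<otimes> a' =
    (t' \<ominus> \<one>) \<otimes> (b' \<ominus> b)"
    using assms(2-5) params_closed by algebra
  finally have "a \<ominus> a' = \<zero> \<and> b' \<ominus> b = \<zero>"
    using assms(2-5) by (intro independent[of \<one>]) auto
  then show ?thesis
    using eq_if_minus_eq_zero[of a a'] eq_if_minus_eq_zero[of b' b] assms(2-5) by simp
qed

lemma mem_iff:
  assumes "d \<in> carrier R" "k \<in> carrier R"
  shows "mem R \<pi> d k \<longleftrightarrow> scalar R k \<and> (\<exists>u \<in> carrier R. d = (t \<ominus> k) \<otimes> u)"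
proof -
  have "d \<oplus> k \<otimes> u = t \<otimes> u \<longleftrightarrow> d = (t \<ominus> k) \<otimes> u" if "u \<in> carrier R" for u
    using root_equation_iff[of t k d \<zero> u] assms that params_closed by (simp add: minus_eq)
  then show ?thesis unfolding mem_def params by blast
qed

lemma lookup_iff:
  assumes "x \<in> carrier R" "k \<in> carrier R" "z \<in> carrier R"
  shows "lookup R \<pi> x k z \<longleftrightarrow> (\<exists>a \<in> carrier R. \<exists>b \<in> carrier R. codes_pair R \<pi> x a b \<and>
    (\<exists>u \<in> carrier R. a \<ominus> z = (t \<ominus> k) \<otimes> u) \<and> (\<exists>v \<in> carrier R. b \<ominus> z = (t' \<ominus> k) \<otimes> v))"
  unfolding lookup_def params
  using root_equation_iff[OF params_closed(1) assms(2) _ assms(3)]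
    root_equation_iff[OF params_closed(2) assms(2) _ assms(3)] by (simp cong: bex_cong)

text \<open>The pair \<open>(a, b)\<close> is determined by \<open>x\<close>, so
  \<open>z - z'\<close> is a right multiple of \<open>t - k\<close> (through \<open>a\<close>) and
  of \<open>t' - k\<close> (through \<open>b\<close>); by \<open>independent\<close> it is
  0.\<close>

lemma lookup_unique:
  assumes "lookup R \<pi> x k z" "lookup R \<pi> x k z'" "scalar R k"
    "x \<in> carrier R" "z \<in> carrier R" "z' \<in> carrier R"
  shows "z = z'"
proof -
  have k: "k \<in> carrier R" using assms(3) by (rule scalar_closed)
  obtain a b u v where ab: "a \<in> carrier R" "b \<in> carrier R" "codes_pair R \<pi> x a b"
    and uv: "u \<in> carrier R" "v \<in> carrier R" "a \<ominus> z = (t \<ominus> k) \<otimes> u" "b \<ominus> z = (t' \<ominus> k) \<otimes> v"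
    using assms(1,4,5) k by (auto simp: lookup_iff)
  obtain a' b' u' v' where ab': "a' \<in> carrier R" "b' \<in> carrier R" "codes_pair R \<pi> x a' b'"
    and uv': "u' \<in> carrier R" "v' \<in> carrier R" "a' \<ominus> z' = (t \<ominus> k) \<otimes> u'" "b' \<ominus> z' = (t' \<ominus> k) \<otimes> v'"
    using assms(2,4,6) k by (auto simp: lookup_iff)
  have eq: "a' = a" "b' = b"
    using codes_pair_unique[of x a b a' b'] ab ab' assms(4) by auto
  have "(t \<ominus> k) \<otimes> (u' \<ominus> u) = (a \<ominus> z') \<ominus> (a \<ominus> z)"
    using uv'(3) unfolding eq uv(3) using uv(1) uv'(1) params_closed k by (simp add: r_minus r_distr minus_eq)
  also have "\<dots> = (b \<ominus> z') \<ominus> (b \<ominus> z)"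
    using ab(1,2) assms(5,6) by algebra
  also have "\<dots> = (t' \<ominus> k) \<otimes> (v' \<ominus> v)"
    using uv'(4) unfolding eq uv(4) using uv(2) uv'(2) params_closed k by (simp add: r_minus r_distr minus_eq)
  finally have "u' \<ominus> u = \<zero>"
    using independent[of k "u' \<ominus> u" "v' \<ominus> v"] assms(3) uv(1,2) uv'(1,2) by simp
  then have "u' = u" using uv(1) uv'(1) eq_if_minus_eq_zero by blast
  then have "a \<ominus> z = a \<ominus> z'" using uv(3) uv'(3) eq by simp
  moreover have "z = a \<ominus> (a \<ominus> z)" "z' = a \<ominus> (a \<ominus> z')" using ab(1) assms(5,6) by algebra+
  ultimately show ?thesis by simp
qed

lemma lookup_exists:
  assumes "finite A" "\<And>k. k \<in> A \<Longrightarrow> scalar R k" "\<And>k. k \<in> A \<Longrightarrow> f k \<in> carrier R"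
  shows "\<exists>x \<in> carrier R. \<forall>k \<in> A. \<forall>z \<in> carrier R. lookup R \<pi> x k z \<longleftrightarrow> z = f k"
proof -
  have A: "A \<subseteq> Collect (scalar R)" using assms(2) by blast
  obtain a where a: "a \<in> carrier R" "\<forall>k \<in> A. \<exists>u \<in> carrier R. a \<ominus> f k = (t \<ominus> k) \<otimes> u"
    by (rule bexE[OF chinese_remainder[OF params_closed(1) assms(1) A scalars assms(3)]])
  obtain b where b: "b \<in> carrier R" "\<forall>k \<in> A. \<exists>u \<in> carrier R. b \<ominus> f k = (t' \<ominus> k) \<otimes> u"
    by (rule bexE[OF chinese_remainder[OF params_closed(2) assms(1) A scalars assms(3)]])
  obtain x where x: "x \<in> carrier R" "codes_pair R \<pi> x a b"
    using codes_pair_exists[OF a(1) b(1)] by blast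
  have "lookup R \<pi> x k (f k)" if "k \<in> A" for k
    using lookup_iff[OF x(1) scalar_closed[OF assms(2)[OF that]] assms(3)[OF that]]
      bspec[OF a(2) that] bspec[OF b(2) that] a(1) b(1) x(2) by blast
  then have "lookup R \<pi> x k z \<longleftrightarrow> z = f k" if "k \<in> A" "z \<in> carrier R" for k z
    using lookup_unique[of x k z "f k"] x(1) assms(2,3) that by blast
  then show ?thesis using x(1) by blast
qed

text \<open>At a scalar \<open>k\<close> outside \<open>A\<close> the vanishing polynomial has a
  unit remainder. If it were also a multiple of \<open>t - k\<close>, then \<open>t - k\<close>
  would have a right inverse, so \<open>t' - k\<close> would be a right multiple of
  \<open>t - k\<close>, and \<open>independent\<close> would give \<open>1 = 0\<close>.\<close>

lemma mem_exists:
  assumes "finite A" "\<And>k. k \<in> A \<Longrightarrow> scalar R k"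
  shows "\<exists>d \<in> carrier R. \<forall>k \<in> carrier R. mem R \<pi> d k \<longleftrightarrow> k \<in> A"
proof -
  have A: "A \<subseteq> Collect (scalar R)" using assms(2) by blast
  obtain d where d: "d \<in> carrier R" "\<forall>k \<in> A. \<exists>u \<in> carrier R. d = (t \<ominus> k) \<otimes> u"
    "\<forall>k \<in> Collect (scalar R) - A.
      \<exists>z \<in> Units R. (\<forall>x \<in> carrier R. z \<otimes> x = x \<otimes> z) \<and> (\<exists>u \<in> carrier R. d \<ominus> z = (t \<ominus> k) \<otimes> u)"
    using vanishing_polynomial[OF params_closed(1) assms(1) A scalars] by (elim bexE conjE) (rule that)
  have False if k: "scalar R k" "k \<notin> A" and u: "u \<in> carrier R" "d = (t \<ominus> k) \<otimes> u" for k u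
  proof -
    have kc: "k \<in> carrier R" using k(1) by (rule scalar_closed)
    obtain z u' where z: "z \<in> Units R" and u': "u' \<in> carrier R" "d \<ominus> z = (t \<ominus> k) \<otimes> u'"
      using bspec[OF d(3), of k] k by blast
    have zc: "z \<in> carrier R" "inv z \<in> carrier R" using z by auto
    have "z = d \<ominus> (d \<ominus> z)" using d(1) zc by algebra
    also have "\<dots> = (t \<ominus> k) \<otimes> u \<ominus> (t \<ominus> k) \<otimes> u'" unfolding u'(2) using u(2) by simp
    also have "\<dots> = (t \<ominus> k) \<otimes> (u \<ominus> u')" using u(1) u'(1) params_closed kc by algebra
    finally have "z \<otimes> inv z = (t \<ominus> k) \<otimes> (u \<ominus> u') \<otimes> inv z" by simp
    then have "\<one> = (t \<ominus> k) \<otimes> ((u \<ominus> u') \<otimes> inv z)"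
      using z zc u(1) u'(1) params_closed kc by (simp add: m_assoc)
    then have "\<one> \<otimes> (t' \<ominus> k) = (t \<ominus> k) \<otimes> ((u \<ominus> u') \<otimes> inv z) \<otimes> (t' \<ominus> k)" by simp
    then have "(t \<ominus> k) \<otimes> (((u \<ominus> u') \<otimes> inv z) \<otimes> (t' \<ominus> k)) = (t' \<ominus> k) \<otimes> \<one>"
      using zc u(1) u'(1) params_closed kc by (simp add: m_assoc)
    then have "\<one> = \<zero>"
      using independent[of k "((u \<ominus> u') \<otimes> inv z) \<otimes> (t' \<ominus> k)" \<one>]
        k(1) zc u(1) u'(1) params_closed kc by simp
    then show False using one_not_zero by contradiction
  qed
  then have "mem R \<pi> d k \<longleftrightarrow> k \<in> A" if "k \<in> carrier R" for k
    using mem_iff[OF d(1) that] d(2) assms(2) by blast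
  then show ?thesis using d(1) by blast
qed

end

section \<open>A truth definition for formulas with boundedly many quantifier blocks\<close>

text \<open>Terms and formulas share one type, so that one coded valuation serves both:
  \<open>NMult\<close> doubles as conjunction, and \<open>NEq\<close> with the constant 0 as
  negation.\<close>

datatype (consts_node: 'a) node =
    is_NVar: NVar nat
  | is_NConst: NConst 'a
  | is_NAdd: NAdd "'a node" "'a node"
  | is_NMult: NMult "'a node" "'a node"
  | is_NEq: NEq "'a node" "'a node"
  | is_NEx: NEx "nat set" "'a node"

text \<open>\<open>NEx X d\<close> quantifies over all variables in \<open>X\<close> at once; truth values are 0 and 1.\<close>
primrec node_value :: "('a, 'm) ring_scheme \<Rightarrow> 'a node \<Rightarrow> (nat \<Rightarrow> 'a) \<Rightarrow> 'a" where
  "node_value R (NVar i) = (\<lambda>e. e i)"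
| "node_value R (NConst c) = (\<lambda>e. c)"
| "node_value R (NAdd a b) = (\<lambda>e. node_value R a e \<oplus>\<^bsub>R\<^esub> node_value R b e)"
| "node_value R (NMult a b) = (\<lambda>e. node_value R a e \<otimes>\<^bsub>R\<^esub> node_value R b e)"
| "node_value R (NEq a b) = (\<lambda>e. if node_value R a e = node_value R b e then \<one>\<^bsub>R\<^esub> else \<zero>\<^bsub>R\<^esub>)"
| "node_value R (NEx X d) = (\<lambda>e. if \<exists>e'. environment R e' \<and> (\<forall>i. i \<notin> X \<longrightarrow> e' i = e i) \<and> node_value R d e' = \<one>\<^bsub>R\<^esub>
     then \<one>\<^bsub>R\<^esub> else \<zero>\<^bsub>R\<^esub>)"

primrec depth :: "'a node \<Rightarrow> nat" where
  "depth (NVar i) = 0"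
| "depth (NConst c) = 0"
| "depth (NAdd a b) = max (depth a) (depth b)"
| "depth (NMult a b) = max (depth a) (depth b)"
| "depth (NEq a b) = max (depth a) (depth b)"
| "depth (NEx X d) = Suc (depth d)"

primrec subnodes :: "'a node \<Rightarrow> 'a node set" where
  "subnodes (NVar i) = {NVar i}"
| "subnodes (NConst c) = {NConst c}"
| "subnodes (NAdd a b) = insert (NAdd a b) (subnodes a \<union> subnodes b)"
| "subnodes (NMult a b) = insert (NMult a b) (subnodes a \<union> subnodes b)"
| "subnodes (NEq a b) = insert (NEq a b) (subnodes a \<union> subnodes b)"
| "subnodes (NEx X d) = insert (NEx X d) (subnodes d)"

lemma subnodes_self [simp]: "s \<in> subnodes s"
  by (cases s) auto

lemma finite_subnodes [simp]: "finite (subnodes s)"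
  by (induction s) auto

lemma subnodes_trans: "s \<in> subnodes d \<Longrightarrow> subnodes s \<subseteq> subnodes d"
  by (induction d) auto

lemma consts_subnodes: "s \<in> subnodes d \<Longrightarrow> consts_node s \<subseteq> consts_node d"
  by (induction d) auto

primrec left_child :: "'a node \<Rightarrow> 'a node" where
  "left_child (NVar i) = NVar i"
| "left_child (NConst c) = NConst c"
| "left_child (NAdd a b) = a"
| "left_child (NMult a b) = a"
| "left_child (NEq a b) = a"
| "left_child (NEx X d) = d"

primrec right_child :: "'a node \<Rightarrow> 'a node" where
  "right_child (NVar i) = NVar i"
| "right_child (NConst c) = NConst c"
| "right_child (NAdd a b) = b"
| "right_child (NMult a b) = b"
| "right_child (NEq a b) = b"
| "right_child (NEx X d) = d"

primrec bound_vars :: "'a node \<Rightarrow> nat set" where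
  "bound_vars (NVar i) = {}"
| "bound_vars (NConst c) = {}"
| "bound_vars (NAdd a b) = {}"
| "bound_vars (NMult a b) = {}"
| "bound_vars (NEq a b) = {}"
| "bound_vars (NEx X d) = X"

definition is_atom :: "'a node \<Rightarrow> bool" where
  "is_atom s \<longleftrightarrow> is_NVar s \<or> is_NConst s"

text \<open>
  A program is given by \<open>\<pi> 2, \<dots>, \<pi> 8\<close>: the sets of atoms, additions, multiplications,
  equations and quantifiers, and the two child functions, where the right child of a quantifier
  is the set of its bound variables. \<open>v\<close> assigns values to all nodes and \<open>w\<close> to the atoms.
\<close>
definition step :: "('a, 'm) ring_scheme \<Rightarrow> ((nat \<Rightarrow> 'a) \<Rightarrow> 'a \<Rightarrow> 'a \<Rightarrow> bool) \<Rightarrow>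
    (nat \<Rightarrow> 'a) \<Rightarrow> 'a \<Rightarrow> 'a \<Rightarrow> bool" where
  "step R Q \<pi> k w \<longleftrightarrow> (\<exists>v \<in> carrier R.
     (\<forall>j \<in> carrier R. mem R \<pi> (\<pi> 2) j \<longrightarrow>
        (\<exists>z \<in> carrier R. lookup R \<pi> w j z \<and> lookup R \<pi> v j z)) \<and>
     (\<forall>j \<in> carrier R. mem R \<pi> (\<pi> 3) j \<or> mem R \<pi> (\<pi> 4) j \<or> mem R \<pi> (\<pi> 5) j \<longrightarrow>
        (\<exists>a \<in> carrier R. \<exists>b \<in> carrier R. \<exists>x \<in> carrier R. \<exists>y \<in> carrier R. \<exists>z \<in> carrier R.
           lookup R \<pi> (\<pi> 7) j a \<and> lookup R \<pi> (\<pi> 8) j b \<and>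
           lookup R \<pi> v a x \<and> lookup R \<pi> v b y \<and> lookup R \<pi> v j z \<and>
           (mem R \<pi> (\<pi> 3) j \<longrightarrow> z = x \<oplus>\<^bsub>R\<^esub> y) \<and>
           (mem R \<pi> (\<pi> 4) j \<longrightarrow> z = x \<otimes>\<^bsub>R\<^esub> y) \<and>
           (mem R \<pi> (\<pi> 5) j \<longrightarrow> (x = y \<and> z = \<one>\<^bsub>R\<^esub>) \<or> (x \<noteq> y \<and> z = \<zero>\<^bsub>R\<^esub>)))) \<and>
     (\<forall>j \<in> carrier R. mem R \<pi> (\<pi> 6) j \<longrightarrow>
        (Q \<pi> j w \<and> lookup R \<pi> v j \<one>\<^bsub>R\<^esub>) \<or> (\<not> Q \<pi> j w \<and> lookup R \<pi> v j \<zero>\<^bsub>R\<^esub>)) \<and>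
     lookup R \<pi> v k \<one>\<^bsub>R\<^esub>)"

text \<open>\<open>w'\<close> is the assignment after the block: it must agree with \<open>w\<close>
  at every atom outside the set \<open>b\<close> of bound variables, and must still have some value
  at the atoms inside. However many variables the block binds, only \<open>w'\<close> is quantified
  for them.\<close>

definition block :: "('a, 'm) ring_scheme \<Rightarrow> ((nat \<Rightarrow> 'a) \<Rightarrow> 'a \<Rightarrow> 'a \<Rightarrow> bool) \<Rightarrow>
    (nat \<Rightarrow> 'a) \<Rightarrow> 'a \<Rightarrow> 'a \<Rightarrow> bool" where
  "block R T \<pi> j w \<longleftrightarrow>
     (\<exists>w' \<in> carrier R. \<exists>a \<in> carrier R. \<exists>b \<in> carrier R.
        lookup R \<pi> (\<pi> 7) j a \<and> lookup R \<pi> (\<pi> 8) j b \<and>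
        (\<forall>i \<in> carrier R. mem R \<pi> (\<pi> 2) i \<longrightarrow>
           (\<exists>z \<in> carrier R. lookup R \<pi> w' i z \<and> (mem R \<pi> b i \<or> lookup R \<pi> w i z))) \<and>
        T \<pi> a w')"

text \<open>The recursion on \<open>n\<close> takes place outside the ring: each
  \<open>truth R n\<close> is a separate predicate, with its own formula, that nests the previous
  one.\<close>

primrec truth :: "('a, 'm) ring_scheme \<Rightarrow> nat \<Rightarrow> (nat \<Rightarrow> 'a) \<Rightarrow> 'a \<Rightarrow> 'a \<Rightarrow> bool" where
  "truth R 0 = step R (\<lambda>\<pi> j w. False)"
| "truth R (Suc n) = step R (block R (truth R n))"

lemma expressible_True_if: "(\<And>e. environment R e \<Longrightarrow> P e) \<Longrightarrow> expressible R P"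
  using expressible_not[OF expressible_False, of R] unfolding expressible_def by simp

lemma expressible_carrier: "expressible R (\<lambda>e. e k \<in> carrier R)"
  by (rule expressible_True_if) (simp add: environment_def)

lemma expressible_scalar: "expressible R (\<lambda>e. scalar R (e k))"
  unfolding scalar_def by (intro expressible_intros expressible_carrier)

text \<open>The parameters sit at arbitrary variables \<open>r i\<close>, because every binder
  treated by \<open>expressible_ex\<close> shifts the variables that hold them.\<close>

lemma expressible_mem: "expressible R (\<lambda>e. mem R (\<lambda>i. e (r i)) (e d) (e k))"
  unfolding mem_def by (intro expressible_intros expressible_scalar)

lemma expressible_codes_pair: "expressible R (\<lambda>e. codes_pair R (\<lambda>i. e (r i)) (e x) (e a) (e b))"
  unfolding codes_pair_def by (intro expressible_intros)

lemma expressible_lookup: "expressible R (\<lambda>e. lookup R (\<lambda>i. e (r i)) (e x) (e k) (e z))"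
  unfolding lookup_def by (intro expressible_intros expressible_codes_pair)

lemma expressible_lookup_zero: "expressible R (\<lambda>e. lookup R (\<lambda>i. e (r i)) (e x) (e k) \<zero>\<^bsub>R\<^esub>)"
  unfolding lookup_def by (intro expressible_intros expressible_codes_pair)

lemma expressible_lookup_one: "expressible R (\<lambda>e. lookup R (\<lambda>i. e (r i)) (e x) (e k) \<one>\<^bsub>R\<^esub>)"
  unfolding lookup_def by (intro expressible_intros expressible_codes_pair)

lemma expressible_step:
  assumes "\<And>r j w. expressible R (\<lambda>e. Q (\<lambda>i. e (r i)) (e j) (e w))"
  shows "expressible R (\<lambda>e. step R Q (\<lambda>i. e (r i)) (e k) (e w))"
  unfolding step_def
  by (intro expressible_intros expressible_mem expressible_lookup expressible_lookup_zero expressible_lookup_one assms)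

lemma expressible_block:
  assumes "\<And>r j w. expressible R (\<lambda>e. T (\<lambda>i. e (r i)) (e j) (e w))"
  shows "expressible R (\<lambda>e. block R T (\<lambda>i. e (r i)) (e k) (e w))"
  unfolding block_def
  by (intro expressible_intros expressible_mem expressible_lookup assms)

lemma expressible_truth: "expressible R (\<lambda>e. truth R n (\<lambda>i. e (r i)) (e k) (e w))"
proof (induction n arbitrary: r k w)
  case 0
  show ?case unfolding truth.simps by (intro expressible_step expressible_False)
next
  case (Suc n)
  then show ?case unfolding truth.simps by (intro expressible_step expressible_block)
qed

section \<open>Correctness of the truth definition on coded programs\<close>

context ring
begin

lemma node_value_closed:
  "consts_node s \<subseteq> carrier R \<Longrightarrow> environment R e \<Longrightarrow> node_value R s e \<in> carrier R"
  by (induction s) (auto simp: environment_def)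

text \<open>Evaluation with an oracle \<open>q\<close> at quantifier nodes. It describes what
  \<open>step\<close> computes for an arbitrary \<open>Q\<close>; only for a correct oracle is it
  \<open>node_value\<close>.\<close>

primrec run_value :: "('a node \<Rightarrow> bool) \<Rightarrow> (nat \<Rightarrow> 'a) \<Rightarrow> 'a node \<Rightarrow> 'a" where
  "run_value q e (NVar i) = e i"
| "run_value q e (NConst c) = c"
| "run_value q e (NAdd a b) = run_value q e a \<oplus> run_value q e b"
| "run_value q e (NMult a b) = run_value q e a \<otimes> run_value q e b"
| "run_value q e (NEq a b) = (if run_value q e a = run_value q e b then \<one> else \<zero>)"
| "run_value q e (NEx X d) = (if q (NEx X d) then \<one> else \<zero>)"

lemma run_value_closed:
  "consts_node s \<subseteq> carrier R \<Longrightarrow> environment R e \<Longrightarrow> run_value q e s \<in> carrier R"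
  by (induction s) (auto simp: environment_def)

lemma run_value_eq_node_value:
  assumes "\<one> \<noteq> \<zero>"
    and "\<And>X d. NEx X d \<in> subnodes s \<Longrightarrow> q (NEx X d) \<longleftrightarrow> node_value R (NEx X d) e = \<one>"
  shows "run_value q e s = node_value R s e"
  using assms(2)
proof (induction s)
  case (NEx X d)
  have "q (NEx X d) \<longleftrightarrow> node_value R (NEx X d) e = \<one>" by (rule NEx.prems) simp
  then show ?case using assms(1) by (auto split: if_splits)
qed auto

lemma run_value_atom: "is_atom s \<Longrightarrow> run_value q e s = node_value R s e"
  by (cases s) (auto simp: is_atom_def)

end

text \<open>The labelling \<open>\<kappa>\<close> and the set codes \<open>\<beta>\<close> exist
  only outside the formula, which sees their traces in \<open>\<pi>\<close>. \<open>S\<close> is any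
  set closed under \<open>subnodes\<close>, not the subnodes of a single root, since the diagonal
  argument adds one more atom.\<close>

locale program = coding_params +
  fixes S :: "'a node set" and \<kappa> :: "'a node \<Rightarrow> 'a" and \<beta> :: "nat set \<Rightarrow> 'a"
  assumes finite_nodes: "finite S"
    and nodes_closed: "s \<in> S \<Longrightarrow> subnodes s \<subseteq> S"
    and nodes_consts: "s \<in> S \<Longrightarrow> consts_node s \<subseteq> carrier R"
    and \<kappa>_inj: "inj_on \<kappa> S"
    and \<kappa>_scalar: "s \<in> S \<Longrightarrow> scalar R (\<kappa> s)"
    and \<beta>_closed: "\<beta> X \<in> carrier R"
    and mem_\<beta>: "k \<in> carrier R \<Longrightarrow> mem R \<pi> (\<beta> X) k \<longleftrightarrow> k \<in> \<kappa> ` {s \<in> S. \<exists>i \<in> X. s = NVar i}"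
    and mem_atom: "k \<in> carrier R \<Longrightarrow> mem R \<pi> (\<pi> 2) k \<longleftrightarrow> k \<in> \<kappa> ` {s \<in> S. is_atom s}"
    and mem_add: "k \<in> carrier R \<Longrightarrow> mem R \<pi> (\<pi> 3) k \<longleftrightarrow> k \<in> \<kappa> ` {s \<in> S. is_NAdd s}"
    and mem_mult: "k \<in> carrier R \<Longrightarrow> mem R \<pi> (\<pi> 4) k \<longleftrightarrow> k \<in> \<kappa> ` {s \<in> S. is_NMult s}"
    and mem_eq: "k \<in> carrier R \<Longrightarrow> mem R \<pi> (\<pi> 5) k \<longleftrightarrow> k \<in> \<kappa> ` {s \<in> S. is_NEq s}"
    and mem_ex: "k \<in> carrier R \<Longrightarrow> mem R \<pi> (\<pi> 6) k \<longleftrightarrow> k \<in> \<kappa> ` {s \<in> S. is_NEx s}"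
    and lookup_left: "s \<in> S \<Longrightarrow> z \<in> carrier R \<Longrightarrow>
      lookup R \<pi> (\<pi> 7) (\<kappa> s) z \<longleftrightarrow> z = \<kappa> (left_child s)"
    and lookup_right: "s \<in> S \<Longrightarrow> z \<in> carrier R \<Longrightarrow>
      lookup R \<pi> (\<pi> 8) (\<kappa> s) z \<longleftrightarrow> z = (if is_NEx s then \<beta> (bound_vars s) else \<kappa> (right_child s))"
begin

lemma \<kappa>_closed: "s \<in> S \<Longrightarrow> \<kappa> s \<in> carrier R"
  using \<kappa>_scalar scalar_closed by blast

lemma \<kappa>_image_iff: "s \<in> S \<Longrightarrow> \<kappa> s \<in> \<kappa> ` {s \<in> S. P s} \<longleftrightarrow> P s"
  using \<kappa>_inj by (auto simp: inj_on_def)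

lemmas mem_\<kappa> = mem_atom[OF \<kappa>_closed] mem_add[OF \<kappa>_closed] mem_mult[OF \<kappa>_closed]
  mem_eq[OF \<kappa>_closed] mem_ex[OF \<kappa>_closed] mem_\<beta>[OF \<kappa>_closed]

text \<open>Constants are recorded along with the variables, so that no formula ever has to name
  one. Variables without an atom in \<open>S\<close> leave no trace, hence different environments
  may share a code.\<close>

definition codes_env :: "'a \<Rightarrow> (nat \<Rightarrow> 'a) \<Rightarrow> bool" where
  "codes_env w e \<longleftrightarrow> w \<in> carrier R \<and> environment R e \<and>
     (\<forall>s \<in> S. is_atom s \<longrightarrow> lookup R \<pi> w (\<kappa> s) (node_value R s e))"

lemma lookup_\<kappa>_unique:
  "s \<in> S \<Longrightarrow> x \<in> carrier R \<Longrightarrow> lookup R \<pi> x (\<kappa> s) z \<Longrightarrow> lookup R \<pi> x (\<kappa> s) z' \<Longrightarrow>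
   z \<in> carrier R \<Longrightarrow> z' \<in> carrier R \<Longrightarrow> z = z'"
  using lookup_unique \<kappa>_scalar by blast

lemma lookup_\<kappa>_exists:
  assumes "\<And>s. s \<in> S \<Longrightarrow> f s \<in> carrier R"
  shows "\<exists>x \<in> carrier R. \<forall>s \<in> S. lookup R \<pi> x (\<kappa> s) (f s)"
proof -
  have "\<exists>x \<in> carrier R. \<forall>k \<in> \<kappa> ` S. \<forall>z \<in> carrier R. lookup R \<pi> x k z \<longleftrightarrow> z = f (inv_into S \<kappa> k)"
    using assms \<kappa>_scalar finite_nodes \<kappa>_inj by (intro lookup_exists) auto
  then show ?thesis
    using assms \<kappa>_inj by (auto 4 3)
qed

lemma codes_env_exists:
  assumes "environment R e"
  shows "\<exists>w \<in> carrier R. codes_env w e"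
  using lookup_\<kappa>_exists[of "\<lambda>s. node_value R s e"] node_value_closed nodes_consts assms
  unfolding codes_env_def by blast

text \<open>The local conditions of \<open>step\<close> determine \<open>v\<close> node by node:
  each decoded child label is the label of the actual child, which lies in \<open>S\<close>, and
  values at labels are unique.\<close>

lemma step_valuation_unique:
  assumes w: "codes_env w e" and v: "v \<in> carrier R"
    and atoms: "\<forall>j \<in> carrier R. mem R \<pi> (\<pi> 2) j \<longrightarrow>
        (\<exists>z \<in> carrier R. lookup R \<pi> w j z \<and> lookup R \<pi> v j z)"
    and ops: "\<forall>j \<in> carrier R. mem R \<pi> (\<pi> 3) j \<or> mem R \<pi> (\<pi> 4) j \<or> mem R \<pi> (\<pi> 5) j \<longrightarrow>
        (\<exists>a \<in> carrier R. \<exists>b \<in> carrier R. \<exists>x \<in> carrier R. \<exists>y \<in> carrier R. \<exists>z \<in> carrier R.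
           lookup R \<pi> (\<pi> 7) j a \<and> lookup R \<pi> (\<pi> 8) j b \<and>
           lookup R \<pi> v a x \<and> lookup R \<pi> v b y \<and> lookup R \<pi> v j z \<and>
           (mem R \<pi> (\<pi> 3) j \<longrightarrow> z = x \<oplus> y) \<and>
           (mem R \<pi> (\<pi> 4) j \<longrightarrow> z = x \<otimes> y) \<and>
           (mem R \<pi> (\<pi> 5) j \<longrightarrow> (x = y \<and> z = \<one>) \<or> (x \<noteq> y \<and> z = \<zero>)))"
    and exs: "\<forall>j \<in> carrier R. mem R \<pi> (\<pi> 6) j \<longrightarrow>
        (Q \<pi> j w \<and> lookup R \<pi> v j \<one>) \<or> (\<not> Q \<pi> j w \<and> lookup R \<pi> v j \<zero>)"
  shows "s \<in> S \<Longrightarrow> lookup R \<pi> v (\<kappa> s) (run_value (\<lambda>s. Q \<pi> (\<kappa> s) w) e s)"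
proof (induction s)
  let ?q = "\<lambda>s. Q \<pi> (\<kappa> s) w"
  have atom: "lookup R \<pi> v (\<kappa> s) (run_value ?q e s)" if s: "s \<in> S" "is_atom s" for s
  proof -
    have "mem R \<pi> (\<pi> 2) (\<kappa> s)" using s mem_\<kappa>(1) \<kappa>_image_iff by simp
    then obtain z where z: "z \<in> carrier R" "lookup R \<pi> w (\<kappa> s) z" "lookup R \<pi> v (\<kappa> s) z"
      using atoms \<kappa>_closed[OF s(1)] by blast
    moreover have "lookup R \<pi> w (\<kappa> s) (node_value R s e)" "node_value R s e \<in> carrier R"
      using w s node_value_closed nodes_consts unfolding codes_env_def by blast+
    ultimately have "z = node_value R s e"
      using lookup_\<kappa>_unique[of s w z "node_value R s e"] s(1) w unfolding codes_env_def by blast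
    then show ?thesis using z(3) run_value_atom[OF s(2)] by simp
  qed
  show "lookup R \<pi> v (\<kappa> (NVar i)) (run_value ?q e (NVar i))" if "NVar i \<in> S" for i
    using atom[OF that] by (simp add: is_atom_def)
  show "lookup R \<pi> v (\<kappa> (NConst c)) (run_value ?q e (NConst c))" if "NConst c \<in> S" for c
    using atom[OF that] by (simp add: is_atom_def)
  have op: "\<exists>z \<in> carrier R. lookup R \<pi> v (\<kappa> s) z \<and>
      (is_NAdd s \<longrightarrow> z = run_value ?q e a \<oplus> run_value ?q e b) \<and>
      (is_NMult s \<longrightarrow> z = run_value ?q e a \<otimes> run_value ?q e b) \<and>
      (is_NEq s \<longrightarrow> z = (if run_value ?q e a = run_value ?q e b then \<one> else \<zero>))"
    if s: "s \<in> S" "is_NAdd s \<or> is_NMult s \<or> is_NEq s" and ab: "a = left_child s" "b = right_child s"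
      and IH: "a \<in> S \<Longrightarrow> lookup R \<pi> v (\<kappa> a) (run_value ?q e a)" "b \<in> S \<Longrightarrow> lookup R \<pi> v (\<kappa> b) (run_value ?q e b)"
    for s a b
  proof -
    have S: "a \<in> S" "b \<in> S" "\<not> is_NEx s"
      using nodes_closed[OF s(1)] s(2) ab by (cases s; auto)+
    have closed: "run_value ?q e a \<in> carrier R" "run_value ?q e b \<in> carrier R"
      using run_value_closed nodes_consts S w unfolding codes_env_def by blast+
    have mem: "mem R \<pi> (\<pi> 3) (\<kappa> s) \<longleftrightarrow> is_NAdd s" "mem R \<pi> (\<pi> 4) (\<kappa> s) \<longleftrightarrow> is_NMult s"
      "mem R \<pi> (\<pi> 5) (\<kappa> s) \<longleftrightarrow> is_NEq s"
      using mem_\<kappa>[OF s(1)] \<kappa>_image_iff[OF s(1)] by simp_all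
    have "mem R \<pi> (\<pi> 3) (\<kappa> s) \<or> mem R \<pi> (\<pi> 4) (\<kappa> s) \<or> mem R \<pi> (\<pi> 5) (\<kappa> s)"
      unfolding mem by (rule s(2))
    from mp[OF bspec[OF ops \<kappa>_closed[OF s(1)]] this]
    obtain a' b' x y z where *: "a' \<in> carrier R" "b' \<in> carrier R" "x \<in> carrier R" "y \<in> carrier R"
      "z \<in> carrier R" "lookup R \<pi> (\<pi> 7) (\<kappa> s) a'" "lookup R \<pi> (\<pi> 8) (\<kappa> s) b'"
      "lookup R \<pi> v a' x" "lookup R \<pi> v b' y" "lookup R \<pi> v (\<kappa> s) z"
      "mem R \<pi> (\<pi> 3) (\<kappa> s) \<longrightarrow> z = x \<oplus> y" "mem R \<pi> (\<pi> 4) (\<kappa> s) \<longrightarrow> z = x \<otimes> y"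
      "mem R \<pi> (\<pi> 5) (\<kappa> s) \<longrightarrow> (x = y \<and> z = \<one>) \<or> (x \<noteq> y \<and> z = \<zero>)"
      by (elim bexE conjE) (rule that)
    have "a' = \<kappa> a" "b' = \<kappa> b"
      using *(1,2,6,7) lookup_left[OF s(1)] lookup_right[OF s(1)] ab S(3) by auto
    then have "x = run_value ?q e a" "y = run_value ?q e b"
      using lookup_\<kappa>_unique[OF S(1) v] lookup_\<kappa>_unique[OF S(2) v] IH S *(3,4,8,9) closed by auto
    then show ?thesis
      using *(5,10-13) unfolding mem by (intro bexI[of _ z]) auto
  qed
  show "lookup R \<pi> v (\<kappa> (NAdd a b)) (run_value ?q e (NAdd a b))"
    if "a \<in> S \<Longrightarrow> lookup R \<pi> v (\<kappa> a) (run_value ?q e a)" "b \<in> S \<Longrightarrow> lookup R \<pi> v (\<kappa> b) (run_value ?q e b)"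
      "NAdd a b \<in> S" for a b
    using op[OF that(3) _ _ _ that(1,2)] by auto
  show "lookup R \<pi> v (\<kappa> (NMult a b)) (run_value ?q e (NMult a b))"
    if "a \<in> S \<Longrightarrow> lookup R \<pi> v (\<kappa> a) (run_value ?q e a)" "b \<in> S \<Longrightarrow> lookup R \<pi> v (\<kappa> b) (run_value ?q e b)"
      "NMult a b \<in> S" for a b
    using op[OF that(3) _ _ _ that(1,2)] by auto
  show "lookup R \<pi> v (\<kappa> (NEq a b)) (run_value ?q e (NEq a b))"
    if "a \<in> S \<Longrightarrow> lookup R \<pi> v (\<kappa> a) (run_value ?q e a)" "b \<in> S \<Longrightarrow> lookup R \<pi> v (\<kappa> b) (run_value ?q e b)"
      "NEq a b \<in> S" for a b
    using op[OF that(3) _ _ _ that(1,2)] by auto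
  show "lookup R \<pi> v (\<kappa> (NEx X d)) (run_value ?q e (NEx X d))" if "NEx X d \<in> S" for X d
    using bspec[OF exs \<kappa>_closed[OF that]] mem_\<kappa>(5)[OF that] \<kappa>_image_iff[OF that] by auto
qed

text \<open>The existential over \<open>v\<close> is harmless: the finite table of
  \<open>run_value\<close> has a code that meets all conditions, and every valuation that meets them
  agrees with it on \<open>S\<close>.\<close>

lemma step_iff:
  assumes w: "codes_env w e" and s: "s \<in> S"
  shows "step R Q \<pi> (\<kappa> s) w \<longleftrightarrow> run_value (\<lambda>s. Q \<pi> (\<kappa> s) w) e s = \<one>"
proof
  let ?g = "run_value (\<lambda>s. Q \<pi> (\<kappa> s) w) e"
  have closed: "?g s \<in> carrier R" if "s \<in> S" for s
    using run_value_closed nodes_consts that w unfolding codes_env_def by blast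
  {
    assume "step R Q \<pi> (\<kappa> s) w"
    then obtain v where v: "v \<in> carrier R" "lookup R \<pi> v (\<kappa> s) \<one>" "lookup R \<pi> v (\<kappa> s) (?g s)"
      unfolding step_def by (elim bexE conjE) (rule that, assumption, assumption, rule step_valuation_unique[OF w _ _ _ _ s])
    then show "?g s = \<one>"
      using lookup_\<kappa>_unique[OF s v(1)] closed[OF s] by blast
  }
  assume one: "?g s = \<one>"
  obtain v where v: "v \<in> carrier R" and lv: "\<And>s. s \<in> S \<Longrightarrow> lookup R \<pi> v (\<kappa> s) (?g s)"
    using lookup_\<kappa>_exists[of ?g] closed by blast
  show "step R Q \<pi> (\<kappa> s) w"
    unfolding step_def
  proof (rule bexI[OF _ v], intro conjI ballI impI)
    show "lookup R \<pi> v (\<kappa> s) \<one>" using lv[OF s] one by simp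
  next
    fix j assume "j \<in> carrier R" "mem R \<pi> (\<pi> 2) j"
    then obtain s where s: "s \<in> S" "is_atom s" "j = \<kappa> s" using mem_atom by auto
    have "lookup R \<pi> w (\<kappa> s) (?g s)" using w s run_value_atom unfolding codes_env_def by auto
    then show "\<exists>z\<in>carrier R. lookup R \<pi> w j z \<and> lookup R \<pi> v j z"
      using lv[OF s(1)] s(3) closed[OF s(1)] by blast
  next
    fix j assume "j \<in> carrier R" "mem R \<pi> (\<pi> 6) j"
    then obtain s where s: "s \<in> S" "is_NEx s" "j = \<kappa> s" using mem_ex by auto
    then show "(Q \<pi> j w \<and> lookup R \<pi> v j \<one>) \<or> (\<not> Q \<pi> j w \<and> lookup R \<pi> v j \<zero>)"
      using lv[OF s(1)] by (cases s) (auto split: if_splits)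
  next
    fix j assume j: "j \<in> carrier R" "mem R \<pi> (\<pi> 3) j \<or> mem R \<pi> (\<pi> 4) j \<or> mem R \<pi> (\<pi> 5) j"
    then obtain s where s: "s \<in> S" "is_NAdd s \<or> is_NMult s \<or> is_NEq s" "j = \<kappa> s"
      using mem_add mem_mult mem_eq by auto
    define a b where ab: "a = left_child s" "b = right_child s"
    have S: "a \<in> S" "b \<in> S" "\<not> is_NEx s"
      using nodes_closed[OF s(1)] s(2) ab by (cases s; auto)+
    have mem: "mem R \<pi> (\<pi> 3) j \<longleftrightarrow> is_NAdd s" "mem R \<pi> (\<pi> 4) j \<longleftrightarrow> is_NMult s"
      "mem R \<pi> (\<pi> 5) j \<longleftrightarrow> is_NEq s"
      using mem_\<kappa>[OF s(1)] \<kappa>_image_iff[OF s(1)] s(3) by simp_all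
    have g: "is_NAdd s \<longrightarrow> ?g s = ?g a \<oplus> ?g b" "is_NMult s \<longrightarrow> ?g s = ?g a \<otimes> ?g b"
      "is_NEq s \<longrightarrow> (?g a = ?g b \<and> ?g s = \<one>) \<or> (?g a \<noteq> ?g b \<and> ?g s = \<zero>)"
      unfolding ab by (cases s; simp)+
    have look: "lookup R \<pi> (\<pi> 7) j (\<kappa> a)" "lookup R \<pi> (\<pi> 8) j (\<kappa> b)"
      using lookup_left[OF s(1)] lookup_right[OF s(1)] S \<kappa>_closed ab s(3) by auto
    show "\<exists>a \<in> carrier R. \<exists>b \<in> carrier R. \<exists>x \<in> carrier R. \<exists>y \<in> carrier R. \<exists>z \<in> carrier R.
           lookup R \<pi> (\<pi> 7) j a \<and> lookup R \<pi> (\<pi> 8) j b \<and>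
           lookup R \<pi> v a x \<and> lookup R \<pi> v b y \<and> lookup R \<pi> v j z \<and>
           (mem R \<pi> (\<pi> 3) j \<longrightarrow> z = x \<oplus> y) \<and>
           (mem R \<pi> (\<pi> 4) j \<longrightarrow> z = x \<otimes> y) \<and>
           (mem R \<pi> (\<pi> 5) j \<longrightarrow> (x = y \<and> z = \<one>) \<or> (x \<noteq> y \<and> z = \<zero>))"
      unfolding mem
      by (rule bexI[of _ "\<kappa> a"], rule bexI[of _ "\<kappa> b"], rule bexI[of _ "?g a"], rule bexI[of _ "?g b"],
          rule bexI[of _ "?g s"], intro conjI look g)
        (use lv S s closed \<kappa>_closed in auto)
  qed
qed

lemma block_iff:
  assumes w: "codes_env w e" and s: "NEx X d \<in> S"
    and T: "\<And>w' e'. codes_env w' e' \<Longrightarrow> T \<pi> (\<kappa> d) w' \<longleftrightarrow> node_value R d e' = \<one>"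
  shows "block R T \<pi> (\<kappa> (NEx X d)) w \<longleftrightarrow> node_value R (NEx X d) e = \<one>"
proof -
  have d: "d \<in> S" using nodes_closed[OF s] by auto
  have wc: "w \<in> carrier R" and e: "environment R e"
    and lw: "\<And>s. s \<in> S \<Longrightarrow> is_atom s \<Longrightarrow> lookup R \<pi> w (\<kappa> s) (node_value R s e)"
    using w by (auto simp: codes_env_def)
  have look: "lookup R \<pi> (\<pi> 7) (\<kappa> (NEx X d)) a \<longleftrightarrow> a = \<kappa> d"
    "lookup R \<pi> (\<pi> 8) (\<kappa> (NEx X d)) a \<longleftrightarrow> a = \<beta> X" if "a \<in> carrier R" for a
    using lookup_left[OF s that] lookup_right[OF s that] by simp_all
  have "block R T \<pi> (\<kappa> (NEx X d)) w \<longleftrightarrow>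
      (\<exists>w' \<in> carrier R. (\<forall>s \<in> S. is_atom s \<longrightarrow>
         (\<exists>z \<in> carrier R. lookup R \<pi> w' (\<kappa> s) z \<and> ((\<exists>i \<in> X. s = NVar i) \<or> lookup R \<pi> w (\<kappa> s) z))) \<and>
       T \<pi> (\<kappa> d) w')"
  proof -
    have "(\<forall>i \<in> carrier R. mem R \<pi> (\<pi> 2) i \<longrightarrow> P i (mem R \<pi> (\<beta> X) i)) \<longleftrightarrow>
        (\<forall>s \<in> S. is_atom s \<longrightarrow> P (\<kappa> s) (\<exists>i \<in> X. s = NVar i))" for P
    proof -
      have "(\<forall>i \<in> carrier R. mem R \<pi> (\<pi> 2) i \<longrightarrow> P i (mem R \<pi> (\<beta> X) i)) \<longleftrightarrow>
          (\<forall>s \<in> S. is_atom s \<longrightarrow> P (\<kappa> s) (mem R \<pi> (\<beta> X) (\<kappa> s)))"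
        using mem_atom \<kappa>_closed by auto
      also have "\<dots> \<longleftrightarrow> (\<forall>s \<in> S. is_atom s \<longrightarrow> P (\<kappa> s) (\<exists>i \<in> X. s = NVar i))"
        using mem_\<kappa>(6) \<kappa>_image_iff by simp
      finally show ?thesis .
    qed
    from this[of "\<lambda>j m. \<exists>z\<in>carrier R. lookup R \<pi> _ j z \<and> (m \<or> lookup R \<pi> w j z)"]
    show ?thesis
      unfolding block_def using look \<kappa>_closed[OF d] \<beta>_closed[of X]
      by (simp cong: bex_cong conj_cong)
  qed
  also have "\<dots> \<longleftrightarrow> (\<exists>e'. environment R e' \<and> (\<forall>i. i \<notin> X \<longrightarrow> e' i = e i) \<and> node_value R d e' = \<one>)"
    (is "?L \<longleftrightarrow> ?R")
  proof
    assume ?L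
    then obtain w' where w': "w' \<in> carrier R" "T \<pi> (\<kappa> d) w'"
      "\<And>s. s \<in> S \<Longrightarrow> is_atom s \<Longrightarrow>
         \<exists>z \<in> carrier R. lookup R \<pi> w' (\<kappa> s) z \<and> ((\<exists>i \<in> X. s = NVar i) \<or> lookup R \<pi> w (\<kappa> s) z)"
      by blast
    \<comment> \<open>Decoding \<open>w'\<close> fixes values only for bound variables with an atom
      in \<open>S\<close>. All other variables keep their value under \<open>e\<close>, so that
      \<open>e'\<close> differs from \<open>e\<close> only inside \<open>X\<close>.\<close>
    define e' where "e' i = (if i \<in> X \<and> NVar i \<in> S
      then SOME z. z \<in> carrier R \<and> lookup R \<pi> w' (\<kappa> (NVar i)) z else e i)" for i
    have e'X: "e' i \<in> carrier R \<and> lookup R \<pi> w' (\<kappa> (NVar i)) (e' i)" if "i \<in> X" "NVar i \<in> S" for i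
    proof -
      have "\<exists>z. z \<in> carrier R \<and> lookup R \<pi> w' (\<kappa> (NVar i)) z"
        using w'(3)[OF that(2)] by (auto simp: is_atom_def)
      from someI_ex[OF this] show ?thesis using that by (simp add: e'_def)
    qed
    have env: "environment R e'"
      unfolding environment_def
    proof
      fix i show "e' i \<in> carrier R"
        using e e'X[of i] by (cases "i \<in> X \<and> NVar i \<in> S") (auto simp: environment_def e'_def)
    qed
    have "lookup R \<pi> w' (\<kappa> s) (node_value R s e')" if s: "s \<in> S" "is_atom s" for s
    proof (cases "\<exists>i \<in> X. s = NVar i")
      case True
      then show ?thesis using e'X s(1) by auto
    next
      case False
      obtain z where z: "z \<in> carrier R" "lookup R \<pi> w' (\<kappa> s) z" "lookup R \<pi> w (\<kappa> s) z"
        using w'(3)[OF s] False by blast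
      have "z = node_value R s e"
        using lookup_\<kappa>_unique[OF s(1) wc z(3) lw[OF s] z(1)] node_value_closed nodes_consts s(1) e by blast
      moreover have "node_value R s e = node_value R s e'"
        using s(2) False by (cases s) (auto simp: is_atom_def e'_def)
      ultimately show ?thesis using z(2) by simp
    qed
    then have "codes_env w' e'" using w'(1) env by (simp add: codes_env_def)
    then have "node_value R d e' = \<one>" using T w'(2) by blast
    then show ?R using env by (intro exI[of _ e']) (auto simp: e'_def)
  next
    assume ?R
    then obtain e' where e': "environment R e'" "\<And>i. i \<notin> X \<Longrightarrow> e' i = e i" "node_value R d e' = \<one>"
      by blast
    obtain w' where w': "w' \<in> carrier R" "codes_env w' e'"
      using codes_env_exists[OF e'(1)] by blast
    have "\<exists>z \<in> carrier R. lookup R \<pi> w' (\<kappa> s) z \<and> ((\<exists>i \<in> X. s = NVar i) \<or> lookup R \<pi> w (\<kappa> s) z)"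
      if s: "s \<in> S" "is_atom s" for s
    proof (rule bexI[of _ "node_value R s e'"], intro conjI)
      show "lookup R \<pi> w' (\<kappa> s) (node_value R s e')" using w'(2) s by (simp add: codes_env_def)
      show "node_value R s e' \<in> carrier R" using node_value_closed nodes_consts s(1) e'(1) by blast
      have "node_value R s e' = node_value R s e" if "\<not> (\<exists>i \<in> X. s = NVar i)"
        using s(2) that e'(2) by (cases s) (auto simp: is_atom_def)
      then show "(\<exists>i \<in> X. s = NVar i) \<or> lookup R \<pi> w (\<kappa> s) (node_value R s e')"
        using lw[OF s] by metis
    qed
    moreover have "T \<pi> (\<kappa> d) w'" using T[OF w'(2)] e'(3) by simp
    ultimately show ?L using w'(1) by blast
  qed
  also have "\<dots> \<longleftrightarrow> node_value R (NEx X d) e = \<one>"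
    using one_not_zero by simp
  finally show ?thesis .
qed

lemma depth_subnodes: "s \<in> subnodes d \<Longrightarrow> depth s \<le> depth d"
  by (induction d) auto

text \<open>At level 0 there is no quantifier node, so the constant oracle is never consulted. At
  level \<open>Suc n\<close> every body of a quantifier node has depth at most \<open>n\<close>, so
  by \<open>block_iff\<close> the oracle answers correctly and \<open>step_iff\<close> does the
  rest.\<close>

lemma truth_iff:
  "codes_env w e \<Longrightarrow> s \<in> S \<Longrightarrow> depth s \<le> n \<Longrightarrow> truth R n \<pi> (\<kappa> s) w \<longleftrightarrow> node_value R s e = \<one>"
proof (induction n arbitrary: w e s)
  case 0
  have "run_value (\<lambda>s. False) e s = node_value R s e"
    using 0(3) depth_subnodes[of _ s] by (intro run_value_eq_node_value one_not_zero) fastforce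
  then show ?case using step_iff[OF 0(1,2), of "\<lambda>\<pi> j w. False"] by simp
next
  case (Suc n)
  have "block R (truth R n) \<pi> (\<kappa> (NEx X d)) w \<longleftrightarrow> node_value R (NEx X d) e = \<one>"
    if "NEx X d \<in> subnodes s" for X d
  proof (rule block_iff[OF Suc.prems(1)])
    show S: "NEx X d \<in> S" using nodes_closed[OF Suc.prems(2)] that by blast
    have "depth d \<le> n" using depth_subnodes[OF that] Suc.prems(3) by simp
    moreover have "d \<in> S" using nodes_closed[OF S] by auto
    ultimately show "truth R n \<pi> (\<kappa> d) w' \<longleftrightarrow> node_value R d e' = \<one>" if "codes_env w' e'" for w' e'
      using Suc.IH that by blast
  qed
  then have "run_value (\<lambda>s. block R (truth R n) \<pi> (\<kappa> s) w) e s = node_value R s e"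
    by (intro run_value_eq_node_value one_not_zero)
  then show ?case using step_iff[OF Suc.prems(1,2), of "block R (truth R n)"] by simp
qed

end

section \<open>Nodes representing boolean combinations of prenex formulas\<close>

definition represents :: "('a, 'm) ring_scheme \<Rightarrow> nat \<Rightarrow> 'a node \<Rightarrow> 'a fm \<Rightarrow> bool" where
  "represents R n d \<phi> \<longleftrightarrow> consts_node d \<subseteq> carrier R \<and> depth d \<le> n \<and>
     (\<forall>e. environment R e \<longrightarrow> node_value R d e = (if sat R e \<phi> then \<one>\<^bsub>R\<^esub> else \<zero>\<^bsub>R\<^esub>))"

abbreviation node_neg :: "('a, 'm) ring_scheme \<Rightarrow> 'a node \<Rightarrow> 'a node" where
  "node_neg R d \<equiv> NEq d (NConst \<zero>\<^bsub>R\<^esub>)"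

primrec node_of_tm :: "('a, 'm) ring_scheme \<Rightarrow> 'a tm \<Rightarrow> 'a node" where
  "node_of_tm R (Var i) = NVar i"
| "node_of_tm R (Const c) = NConst c"
| "node_of_tm R Zero = NConst \<zero>\<^bsub>R\<^esub>"
| "node_of_tm R One = NConst \<one>\<^bsub>R\<^esub>"
| "node_of_tm R (Add s u) = NAdd (node_of_tm R s) (node_of_tm R u)"
| "node_of_tm R (Mult s u) = NMult (node_of_tm R s) (node_of_tm R u)"

lemma node_value_node_of_tm [simp]: "node_value R (node_of_tm R s) e = eval_tm R e s"
  by (induction s) auto

lemma depth_node_of_tm [simp]: "depth (node_of_tm R s) = 0"
  by (induction s) auto

locale nonzero_ring = ring R for R (structure) +
  assumes one_neq_zero: "\<one> \<noteq> \<zero>"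
begin

lemma consts_node_of_tm: "consts_tm s \<subseteq> carrier R \<Longrightarrow> consts_node (node_of_tm R s) \<subseteq> carrier R"
  by (induction s) auto

lemma represents_Neg: "represents R n d \<phi> \<Longrightarrow> represents R n (node_neg R d) (Neg \<phi>)"
  using one_neq_zero by (auto simp: represents_def)

lemma represents_Conj:
  "represents R n d \<phi> \<Longrightarrow> represents R n d' \<psi> \<Longrightarrow> represents R n (NMult d d') (Conj \<phi> \<psi>)"
  by (auto simp: represents_def)

lemma represents_Disj:
  assumes "represents R n d \<phi>" "represents R n d' \<psi>"
  shows "represents R n (node_neg R (NMult (node_neg R d) (node_neg R d'))) (Disj \<phi> \<psi>)"
  using assms one_neq_zero by (auto simp: represents_def)

lemma represents_quantifier_free:
  "quantifier_free \<phi> \<Longrightarrow> consts_fm \<phi> \<subseteq> carrier R \<Longrightarrow> \<exists>d. represents R 0 d \<phi>"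
proof (induction \<phi>)
  case (Eq s u)
  then have "represents R 0 (NEq (node_of_tm R s) (node_of_tm R u)) (Eq s u)"
    using consts_node_of_tm by (auto simp: represents_def)
  then show ?case by blast
next
  case (Neg \<phi>)
  then show ?case using represents_Neg by fastforce
next
  case (Conj \<phi> \<psi>)
  then show ?case using represents_Conj by fastforce
next
  case (Disj \<phi> \<psi>)
  then show ?case using represents_Disj by fastforce
qed auto

lemma node_value_NEx_iff: "node_value R (NEx X d) e = \<one> \<longleftrightarrow>
    (\<exists>e'. environment R e' \<and> (\<forall>i. i \<notin> X \<longrightarrow> e' i = e i) \<and> node_value R d e' = \<one>)"
  using one_neq_zero by simp

lemma node_value_NEx_insert:
  assumes "environment R e"
  shows "node_value R (NEx (insert i X) d) e =
    (if \<exists>a \<in> carrier R. node_value R (NEx X d) (e(i := a)) = \<one> then \<one> else \<zero>)"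
proof -
  have "(\<exists>e'. environment R e' \<and> (\<forall>j. j \<notin> insert i X \<longrightarrow> e' j = e j) \<and> node_value R d e' = \<one>) \<longleftrightarrow>
    (\<exists>a \<in> carrier R. \<exists>e'. environment R e' \<and> (\<forall>j. j \<notin> X \<longrightarrow> e' j = (e(i := a)) j) \<and> node_value R d e' = \<one>)"
    (is "?L \<longleftrightarrow> ?R")
  proof
    assume ?L
    then obtain e' where e': "environment R e'" "\<forall>j. j \<notin> insert i X \<longrightarrow> e' j = e j" "node_value R d e' = \<one>"
      by blast
    have "e' i \<in> carrier R" using e'(1) by (simp add: environment_def)
    moreover have "\<forall>j. j \<notin> X \<longrightarrow> e' j = (e(i := e' i)) j" using e'(2) by auto
    ultimately show ?R using e'(1,3) by blast
  next
    assume ?R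
    then obtain a e' where "environment R e'" "\<forall>j. j \<notin> X \<longrightarrow> e' j = (e(i := a)) j" "node_value R d e' = \<one>"
      by blast
    moreover from this(2) have "\<forall>j. j \<notin> insert i X \<longrightarrow> e' j = e j" by auto
    ultimately show ?L by blast
  qed
  then show ?thesis
    unfolding node_value_NEx_iff node_value.simps(6)[of R "insert i X"] by (simp only:)
qed

lemma node_value_NEx_empty:
  assumes "environment R e"
  shows "node_value R (NEx {} d) e = (if node_value R d e = \<one> then \<one> else \<zero>)"
proof -
  have "(\<exists>e'. environment R e' \<and> (\<forall>j. j \<notin> {} \<longrightarrow> e' j = e j) \<and> node_value R d e' = \<one>) \<longleftrightarrow> node_value R d e = \<one>"
    using assms by (auto simp flip: fun_eq_iff)
  then show ?thesis by simp
qed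

lemma environment_upd: "environment R e \<Longrightarrow> a \<in> carrier R \<Longrightarrow> environment R (e(i := a))"
  by (auto simp: environment_def)

text \<open>Opens a new block: binding no variable changes no value, but it costs one level of depth
  and gives later quantifiers a place to go.\<close>

lemma represents_NEx_empty: "represents R n d \<phi> \<Longrightarrow> represents R (Suc n) (NEx {} d) \<phi>"
  unfolding represents_def using node_value_NEx_empty[of _ d] one_neq_zero by auto

text \<open>A quantifier merged into an existing block leaves the depth unchanged, so depth counts
  blocks and not quantifiers.\<close>

lemma represents_Ex:
  assumes "represents R n (NEx X d) \<phi>"
  shows "represents R n (NEx (insert i X) d) (Ex i \<phi>)"
proof -
  have "node_value R (NEx (insert i X) d) e = (if sat R e (Ex i \<phi>) then \<one> else \<zero>)" if "environment R e" for e
    using assms environment_upd[OF that] one_neq_zero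
    unfolding node_value_NEx_insert[OF that] represents_def by (auto simp del: node_value.simps)
  then show ?thesis using assms unfolding represents_def by simp
qed

lemma represents_All:
  assumes "represents R n (node_neg R (NEx X d)) \<phi>"
  shows "represents R n (node_neg R (NEx (insert i X) d)) (All i \<phi>)"
proof -
  \<comment> \<open>A quantifier node takes only the values 0 and 1, so the negation can be moved
    from the node to the formula, where \<open>represents_Ex\<close> applies.\<close>
  have *: "represents R n (NEx X d) (Neg \<phi>)"
    unfolding represents_def
  proof (intro conjI allI impI)
    fix e assume "environment R e"
    then have "(if node_value R (NEx X d) e = \<zero> then \<one> else \<zero>) = (if sat R e \<phi> then \<one> else \<zero>)"
      using assms unfolding represents_def by (simp only: node_value.simps(2,5))
    moreover have "node_value R (NEx X d) e = \<one> \<or> node_value R (NEx X d) e = \<zero>" by simp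
    ultimately show "node_value R (NEx X d) e = (if sat R e (Neg \<phi>) then \<one> else \<zero>)"
      using one_neq_zero by (cases "sat R e \<phi>") (auto simp del: node_value.simps split: if_splits)
  qed (use assms in \<open>auto simp: represents_def\<close>)
  have "represents R n (node_neg R (NEx (insert i X) d)) (Neg (Ex i (Neg \<phi>)))"
    by (intro represents_Neg represents_Ex *)
  then show ?thesis unfolding represents_def by simp
qed

text \<open>The second conjunct strengthens the induction: knowing the outermost shape of the node
  allows an equal quantifier in front to be merged into its block.\<close>

lemma represents_prenex:
  assumes "quantifier_free \<phi>" "consts_fm \<phi> \<subseteq> carrier R"
  shows "\<exists>d. represents R (quantifier_blocks qs) d (prenex qs \<phi>) \<and>
    (qs \<noteq> [] \<longrightarrow> (\<exists>X d'. d = (case fst (hd qs) of Exists \<Rightarrow> NEx X d' | Forall \<Rightarrow> node_neg R (NEx X d'))))"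
proof (induction qs)
  case Nil
  then show ?case
    using represents_quantifier_free[OF assms] by (simp add: prenex_def quantifier_blocks_def)
next
  case (Cons q qs)
  obtain Q i where q: "q = (Q, i)" by (cases q)
  obtain d where d: "represents R (quantifier_blocks qs) d (prenex qs \<phi>)"
    "qs \<noteq> [] \<longrightarrow> (\<exists>X d'. d = (case fst (hd qs) of Exists \<Rightarrow> NEx X d' | Forall \<Rightarrow> node_neg R (NEx X d')))"
    using Cons by blast
  have "\<exists>X d'. represents R (quantifier_blocks (q # qs))
      (case Q of Exists \<Rightarrow> NEx X d' | Forall \<Rightarrow> node_neg R (NEx X d')) (prenex qs \<phi>)"
  proof (cases "qs \<noteq> [] \<and> fst (hd qs) = Q")
    case True
    then have "quantifier_blocks (q # qs) = quantifier_blocks qs"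
      by (cases qs) (auto simp: quantifier_blocks_def q)
    then show ?thesis using d True by auto
  next
    case False
    then have blocks: "quantifier_blocks (q # qs) = Suc (quantifier_blocks qs)"
      by (cases qs) (auto simp: quantifier_blocks_def q)
    show ?thesis
    proof (cases Q)
      case Exists
      then show ?thesis using represents_NEx_empty[OF d(1)] blocks by auto
    next
      case Forall
      \<comment> \<open>Two negations around an empty block leave the formula unchanged and produce
        the shape that \<open>represents_All\<close> extends.\<close>
      have "represents R (quantifier_blocks (q # qs)) (node_neg R (NEx {} (node_neg R d))) (Neg (Neg (prenex qs \<phi>)))"
        unfolding blocks by (intro represents_Neg represents_NEx_empty d(1))
      then have "represents R (quantifier_blocks (q # qs)) (node_neg R (NEx {} (node_neg R d))) (prenex qs \<phi>)"
        unfolding represents_def by simp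
      then show ?thesis using Forall by auto
    qed
  qed
  then obtain X d' where "represents R (quantifier_blocks (q # qs))
      (case Q of Exists \<Rightarrow> NEx X d' | Forall \<Rightarrow> node_neg R (NEx X d')) (prenex qs \<phi>)" by blast
  then have "represents R (quantifier_blocks (q # qs))
      (case Q of Exists \<Rightarrow> NEx (insert i X) d' | Forall \<Rightarrow> node_neg R (NEx (insert i X) d')) (prenex (q # qs) \<phi>)"
    by (cases Q) (auto simp: q prenex_def intro: represents_Ex represents_All)
  then show ?case by (auto simp: q)
qed

lemma represents_boolean_combination:
  assumes "\<psi> \<in> boolean_combinations (Pi_formulas n (carrier R) \<union> Sigma_formulas n (carrier R))"
  shows "\<exists>d. represents R n d \<psi>"
  using assms
proof induction
  case (base \<phi>)
  then obtain qs \<chi> where "\<phi> = prenex qs \<chi>" "quantifier_blocks qs = n"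
    and \<chi>: "quantifier_free \<chi>" "consts_fm \<chi> \<subseteq> carrier R"
    by (auto simp: Pi_formulas_def Sigma_formulas_def prenex_class_def)
  then show ?case using represents_prenex[OF \<chi>, of qs] by blast
next
  case (Neg \<phi>)
  then show ?case using represents_Neg by blast
next
  case (Conj \<phi> \<psi>)
  then show ?case using represents_Conj by blast
next
  case (Disj \<phi> \<psi>)
  then show ?case using represents_Disj by blast
qed

end

section \<open>Diagonalization\<close>

lemma mem_cong: "\<pi> 0 = \<pi>' 0 \<Longrightarrow> mem R \<pi> = mem R \<pi>'"
  by (intro ext) (simp add: mem_def)

lemma lookup_cong: "\<pi> 0 = \<pi>' 0 \<Longrightarrow> \<pi> 1 = \<pi>' 1 \<Longrightarrow> lookup R \<pi> = lookup R \<pi>'"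
  by (intro ext) (simp add: lookup_def codes_pair_def)

primrec codes_tuple :: "('a, 'm) ring_scheme \<Rightarrow> (nat \<Rightarrow> 'a) \<Rightarrow> 'a \<Rightarrow> 'a list \<Rightarrow> bool" where
  "codes_tuple R \<pi> x [] \<longleftrightarrow> x = \<zero>\<^bsub>R\<^esub>"
| "codes_tuple R \<pi> x (a # as) \<longleftrightarrow> (\<exists>y \<in> carrier R. codes_pair R \<pi> x a y \<and> codes_tuple R \<pi> y as)"

lemma codes_tuple_cong:
  "\<pi> 0 = \<pi>' 0 \<Longrightarrow> \<pi> 1 = \<pi>' 1 \<Longrightarrow> codes_tuple R \<pi> x as \<longleftrightarrow> codes_tuple R \<pi>' x as"
  by (induction as arbitrary: x) (simp_all add: codes_pair_def)

lemma expressible_codes_tuple: "expressible R (\<lambda>e. codes_tuple R (\<lambda>i. e (r i)) (e x) (map (\<lambda>i. e (s i)) js))"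
proof (induction js arbitrary: r x s)
  case Nil
  then show ?case unfolding list.map codes_tuple.simps by (intro expressible_intros)
next
  case (Cons j js)
  show ?case
    unfolding list.map codes_tuple.simps by (intro expressible_intros expressible_codes_pair Cons)
qed

lemma expressible_cong: "expressible R Q \<Longrightarrow> (\<And>e. environment R e \<Longrightarrow> P e \<longleftrightarrow> Q e) \<Longrightarrow> expressible R P"
  unfolding expressible_def by simp

lemma prepend_Suc:
  "(\<lambda>i. if i < Suc m then (c(m := x)) i else e (i - Suc m)) =
   (\<lambda>i. if i < m then c i else case_nat x e (i - m))"
proof
  fix i
  consider "i < m" | "i = m" | k where "i = m + Suc k"
    by (metis less_iff_Suc_add linorder_neqE_nat add_Suc_right)
  then show "(if i < Suc m then (c(m := x)) i else e (i - Suc m)) =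
      (if i < m then c i else case_nat x e (i - m))"
    by cases auto
qed

text \<open>Only the first \<open>m\<close> values of \<open>c\<close> reach \<open>P\<close>, so
  quantifying over a whole environment amounts to \<open>m\<close> ordinary quantifiers, and
  induction on \<open>m\<close> peels off one of them.\<close>

lemma expressible_ex_block:
  assumes "expressible R P"
  shows "expressible R (\<lambda>e. \<exists>c. environment R c \<and> P (\<lambda>i. if i < m then c i else e (i - m)))"
proof (induction m)
  case 0
  show ?case by (rule expressible_cong[OF assms]) auto
next
  case (Suc m)
  define F where "F e \<longleftrightarrow> (\<exists>c. environment R c \<and> P (\<lambda>i. if i < m then c i else e (i - m)))" for e
  \<comment> \<open>Splitting \<open>e\<close> into head and tail exhibits the shape that the
    premise of \<open>expressible_ex\<close> requires.\<close>
  have eta: "case_nat (e 0) (\<lambda>i. e (Suc i)) = e" for e :: "nat \<Rightarrow> 'a"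
    by (auto split: nat.splits)
  have "expressible R (\<lambda>e. F (case_nat (e 0) (\<lambda>i. e (Suc i))))"
    using Suc unfolding eta F_def .
  then have "expressible R (\<lambda>e. \<exists>x \<in> carrier R. F (case_nat x e))"
    by (rule expressible_ex)
  then show ?case
  proof (rule expressible_cong)
    fix e
    show "(\<exists>c. environment R c \<and> P (\<lambda>i. if i < Suc m then c i else e (i - Suc m))) \<longleftrightarrow>
      (\<exists>x \<in> carrier R. F (case_nat x e))" (is "?L \<longleftrightarrow> ?R")
    proof
      assume ?L
      then obtain c where c: "environment R c" "P (\<lambda>i. if i < Suc m then c i else e (i - Suc m))"
        by (elim exE conjE)
      have "P (\<lambda>i. if i < m then c i else case_nat (c m) e (i - m))"
        using c(2) by (simp only: prepend_Suc[of m c "c m" e, symmetric] fun_upd_triv)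
      then have "F (case_nat (c m) e)" unfolding F_def using c(1) by (intro exI[of _ c] conjI)
      moreover have "c m \<in> carrier R" using c(1) by (simp add: environment_def)
      ultimately show ?R by (rule bexI)
    next
      assume ?R
      then obtain x c where c: "x \<in> carrier R" "environment R c"
          "P (\<lambda>i. if i < m then c i else case_nat x e (i - m))"
        unfolding F_def by (elim bexE exE conjE)
      have "environment R (c(m := x))" using c(1,2) by (auto simp: environment_def)
      moreover have "P (\<lambda>i. if i < Suc m then (c(m := x)) i else e (i - Suc m))"
        using c(3) by (simp only: prepend_Suc)
      ultimately show ?L by (intro exI[of _ "c(m := x)"] conjI)
    qed
  qed
qed

context coding_params
begin

lemma codes_tuple_exists:
  "set as \<subseteq> carrier R \<Longrightarrow> \<exists>x \<in> carrier R. codes_tuple R \<pi> x as"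
proof (induction as)
  case (Cons a as)
  then obtain y where "y \<in> carrier R" "codes_tuple R \<pi> y as" by auto
  then show ?case using codes_pair_exists[of a y] Cons.prems by auto
qed auto

text \<open>The length has to be known: 0 ends a list but also codes the pair of two zeros, so a
  list and its extension by zeros share a code.\<close>

lemma codes_tuple_unique:
  "codes_tuple R \<pi> x as \<Longrightarrow> codes_tuple R \<pi> x bs \<Longrightarrow> length as = length bs \<Longrightarrow>
   x \<in> carrier R \<Longrightarrow> set as \<subseteq> carrier R \<Longrightarrow> set bs \<subseteq> carrier R \<Longrightarrow> as = bs"
proof (induction as arbitrary: x bs)
  case (Cons a as)
  then obtain b bs' where bs: "bs = b # bs'" by (cases bs) auto
  obtain y z where "y \<in> carrier R" "codes_pair R \<pi> x a y" "codes_tuple R \<pi> y as"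
    "z \<in> carrier R" "codes_pair R \<pi> x b z" "codes_tuple R \<pi> z bs'"
    using Cons.prems(1,2) bs by auto
  then show ?case
    using codes_pair_unique[of x a y b z] Cons.IH[of y bs'] Cons.prems bs by auto
qed simp

end

text \<open>
  A code \<open>x\<close> of a program is variable 2 after the parameters \<open>t\<close> and \<open>t'\<close>; the ten components
  of \<open>x\<close> are bound as variables \<open>0, \<dots>, 9\<close>, in front of these three.
\<close>
definition diagonal_body :: "('a, 'm) ring_scheme \<Rightarrow> nat \<Rightarrow> (nat \<Rightarrow> 'a) \<Rightarrow> bool" where
  "diagonal_body R n e \<longleftrightarrow>
     codes_tuple R (\<lambda>i. e (10 + i)) (e 12) (map (\<lambda>i. e i) [0..<10]) \<and>
     (\<exists>w \<in> carrier R. lookup R (\<lambda>i. e (10 + i)) w (e 8) (e 12) \<and>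
        (\<forall>j \<in> carrier R. mem R (\<lambda>i. e (10 + i)) (e 0) j \<longrightarrow> j = e 8 \<or>
           (\<exists>z \<in> carrier R. lookup R (\<lambda>i. e (10 + i)) (e 7) j z \<and>
              lookup R (\<lambda>i. e (10 + i)) w j z)) \<and>
        \<not> truth R n (\<lambda>i. e (if i < 2 then 10 + i else i - 2)) (e 9) w)"

definition diagonal :: "('a, 'm) ring_scheme \<Rightarrow> nat \<Rightarrow> (nat \<Rightarrow> 'a) \<Rightarrow> bool" where
  "diagonal R n e \<longleftrightarrow>
     (\<exists>c. environment R c \<and> diagonal_body R n (\<lambda>i. if i < 10 then c i else e (i - 10)))"

lemma expressible_diagonal: "expressible R (diagonal R n)"
  unfolding diagonal_def
proof (rule expressible_ex_block)
  show "expressible R (diagonal_body R n)"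
    unfolding diagonal_body_def
    by (intro expressible_intros expressible_codes_tuple expressible_lookup expressible_mem expressible_truth)
qed

section \<open>The diagonal predicate differs from every represented formula\<close>

sublocale coding \<subseteq> nonzero_ring
  by unfold_locales (rule one_not_zero)

context coding
begin

text \<open>Stated for every \<open>\<pi>\<close> with the right entries 0 to 8, because it is
  needed twice: for the \<open>\<pi>\<close> from which the code is built, and for the one that the
  diagonal predicate reads off its variables, which may differ beyond index 8.\<close>

lemma program_exists:
  assumes S: "finite S" "\<forall>s \<in> S. subnodes s \<subseteq> S" "\<forall>s \<in> S. consts_node s \<subseteq> carrier R"
  shows "\<exists>p \<kappa> \<beta>. (\<forall>i. p i \<in> carrier R) \<and>
    (\<forall>\<pi>. \<pi> 0 = t \<and> \<pi> 1 = t' \<and> (\<forall>i \<in> {2..8}. \<pi> i = p i) \<longrightarrow> program R t t' \<pi> S \<kappa> \<beta>)"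
proof -
  define \<pi>0 where "\<pi>0 i = (if i = 0 then t else t')" for i :: nat
  interpret P: coding_params R t t' \<pi>0
    by unfold_locales (simp_all add: \<pi>0_def)
  obtain B where B: "finite B" "card B = card S" "B \<subseteq> Collect (scalar R)"
    using infinite_arbitrarily_large[OF infinite_scalars] by blast
  then obtain \<kappa> where \<kappa>: "bij_betw \<kappa> S B"
    using finite_same_card_bij[OF S(1) B(1)] by auto
  have sc: "scalar R (\<kappa> s)" if "s \<in> S" for s
    using \<kappa> B(3) that by (auto simp: bij_betw_def)
  have inj: "inj_on \<kappa> S" using \<kappa> by (simp add: bij_betw_def)
  have kc: "\<kappa> s \<in> carrier R" if "s \<in> S" for s using sc[OF that] by (rule scalar_closed)
  have "\<exists>d \<in> carrier R. \<forall>k \<in> carrier R. mem R \<pi>0 d k \<longleftrightarrow> k \<in> \<kappa> ` {s \<in> S. P s}" for P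
    using S(1) sc by (intro P.mem_exists) auto
  then obtain \<mu> where \<mu>: "\<mu> P \<in> carrier R"
      "\<And>k. k \<in> carrier R \<Longrightarrow> mem R \<pi>0 (\<mu> P) k \<longleftrightarrow> k \<in> \<kappa> ` {s \<in> S. P s}" for P
    by metis
  define \<beta> where "\<beta> X = \<mu> (\<lambda>s. \<exists>i \<in> X. s = NVar i)" for X
  have look: "\<exists>x \<in> carrier R. \<forall>s \<in> S. \<forall>z \<in> carrier R. lookup R \<pi>0 x (\<kappa> s) z \<longleftrightarrow> z = f s"
    if "\<forall>s \<in> S. f s \<in> carrier R" for f
  proof -
    have "\<exists>x \<in> carrier R. \<forall>k \<in> \<kappa> ` S. \<forall>z \<in> carrier R.
        lookup R \<pi>0 x k z \<longleftrightarrow> z = f (inv_into S \<kappa> k)"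
      using that sc S(1) inj by (intro P.lookup_exists) auto
    then show ?thesis using inj by simp
  qed
  have child: "left_child s \<in> S" "right_child s \<in> S" if "s \<in> S" for s
    using bspec[OF S(2) that] by (cases s; auto)+
  obtain l where l: "l \<in> carrier R"
      "\<And>s z. s \<in> S \<Longrightarrow> z \<in> carrier R \<Longrightarrow> lookup R \<pi>0 l (\<kappa> s) z \<longleftrightarrow> z = \<kappa> (left_child s)"
    using look[of "\<lambda>s. \<kappa> (left_child s)"] child kc by blast
  have right: "\<forall>s \<in> S. (if is_NEx s then \<beta> (bound_vars s) else \<kappa> (right_child s)) \<in> carrier R"
    using child(2) kc \<mu>(1) by (simp add: \<beta>_def)
  obtain r where r: "r \<in> carrier R"
      "\<And>s z. s \<in> S \<Longrightarrow> z \<in> carrier R \<Longrightarrow> lookup R \<pi>0 r (\<kappa> s) z \<longleftrightarrow>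
         z = (if is_NEx s then \<beta> (bound_vars s) else \<kappa> (right_child s))"
    using look[of "\<lambda>s. if is_NEx s then \<beta> (bound_vars s) else \<kappa> (right_child s)", OF right]
    by (elim bexE) (rule that, assumption, blast)
  define p where "p = nth [\<zero>, \<zero>, \<mu> is_atom, \<mu> is_NAdd, \<mu> is_NMult, \<mu> is_NEq, \<mu> is_NEx, l, r]"
  have p: "p 2 = \<mu> is_atom" "p 3 = \<mu> is_NAdd" "p 4 = \<mu> is_NMult" "p 5 = \<mu> is_NEq" "p 6 = \<mu> is_NEx"
    "p 7 = l" "p 8 = r" by (simp_all add: p_def)
  have "program R t t' \<pi> S \<kappa> \<beta>" if \<pi>: "\<pi> 0 = t" "\<pi> 1 = t'" "\<forall>i \<in> {2..8}. \<pi> i = p i" for \<pi>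
  proof -
    have eq: "mem R \<pi> = mem R \<pi>0" "lookup R \<pi> = lookup R \<pi>0"
      using \<pi>(1,2) by (auto intro!: mem_cong lookup_cong simp: \<pi>0_def)
    have \<pi>': "\<pi> 2 = \<mu> is_atom" "\<pi> 3 = \<mu> is_NAdd" "\<pi> 4 = \<mu> is_NMult" "\<pi> 5 = \<mu> is_NEq" "\<pi> 6 = \<mu> is_NEx"
      "\<pi> 7 = l" "\<pi> 8 = r"
      using \<pi>(3) p by simp_all
    show ?thesis
    proof unfold_locales
      show "\<pi> 0 = t" "\<pi> 1 = t'" by fact+
    qed (simp_all only: eq \<pi>' \<mu> l r S inj sc \<beta>_def)
  qed
  \<comment> \<open>Beyond the end of the list \<open>nth\<close> is unspecified, so large indices
    are redirected to entry 0; entries 0 and 1 are dummies, since those places of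
    \<open>\<pi>\<close> hold \<open>t\<close> and \<open>t'\<close>.\<close>
  moreover have "p (if i \<le> 8 then i else 0) \<in> carrier R" for i
  proof -
    have "(if i \<le> 8 then i else 0) < length [\<zero>, \<zero>, \<mu> is_atom, \<mu> is_NAdd, \<mu> is_NMult, \<mu> is_NEq, \<mu> is_NEx, l, r]"
      by simp
    from nth_mem[OF this] show ?thesis unfolding p_def using \<mu>(1) l(1) r(1) by auto
  qed
  ultimately show ?thesis
    by (intro exI[of _ "\<lambda>i. p (if i \<le> 8 then i else 0)"] exI[of _ \<kappa>] exI[of _ \<beta>]) auto
qed

text \<open>
  \<open>x\<close> codes a program for \<open>\<psi>\<close> and an assignment \<open>\<gamma>\<close> to all atoms other than variable 2;
  evaluating \<open>diagonal\<close> where variable 2 has the value \<open>x\<close> contradicts \<open>\<psi>\<close>.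
\<close>
lemma diagonal_not_represented:
  assumes d: "represents R n d \<psi>"
  shows "\<exists>e. environment R e \<and> (diagonal R n e \<longleftrightarrow> \<not> sat R e \<psi>)"
proof -
  \<comment> \<open>The formula to be refuted need not mention variable 2, but its label is needed
    in any case to plug in the code.\<close>
  define S where "S = insert (NVar 2) (subnodes d)"
  have S: "finite S" "\<forall>s \<in> S. subnodes s \<subseteq> S"
    using subnodes_trans[of _ d] unfolding S_def by auto
  have S_consts: "consts_node s \<subseteq> carrier R" if "s \<in> S" for s
    using that d consts_subnodes[of s d] unfolding S_def represents_def by auto
  then have S_consts': "\<forall>s \<in> S. consts_node s \<subseteq> carrier R" by blast
  obtain p \<kappa> \<beta> where p: "\<forall>i. p i \<in> carrier R"
    and program: "\<forall>\<pi>. \<pi> 0 = t \<and> \<pi> 1 = t' \<and> (\<forall>i \<in> {2..8}. \<pi> i = p i) \<longrightarrow> program R t t' \<pi> S \<kappa> \<beta>"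
    using program_exists[OF S S_consts'] by (elim exE conjE) (rule that)
  define \<pi>0 where "\<pi>0 i = (if i = 0 then t else if i = 1 then t' else p i)" for i
  interpret P: program R t t' \<pi>0 S \<kappa> \<beta>
    by (rule program[rule_format]) (auto simp: \<pi>0_def)
  have dS: "d \<in> S" "NVar 2 \<in> S" by (auto simp: S_def)
  define E where "E x i = (if i = 0 then t else if i = 1 then t' else if i = 2 then x else \<zero>)" for x :: 'a and i :: nat
  have E: "environment R (E x)" if "x \<in> carrier R" for x
    using that params_closed by (auto simp: environment_def E_def)
  \<comment> \<open>An assignment stored inside \<open>x\<close> cannot easily give variable 2 the
    value \<open>x\<close> itself. The circle is avoided by storing the dummy value 0 there;
    \<open>diagonal_body\<close> then asks for a \<open>w\<close> that agrees with
    \<open>\<gamma>\<close> at the other atoms and has \<open>x\<close> at variable 2.\<close>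
  obtain \<gamma> where \<gamma>: "\<gamma> \<in> carrier R" "P.codes_env \<gamma> (E \<zero>)"
    using P.codes_env_exists[OF E] by auto
  \<comment> \<open>Slots 0 to 6 hold the program entries \<open>\<pi> 2\<close> to
    \<open>\<pi> 8\<close>, hence the shift by 2; the remaining slots hold the stored assignment,
    the label of variable 2 and the label of the root.\<close>
  define c0 where "c0 i = (if i < 7 then p (i + 2) else if i = 7 then \<gamma> else if i = 8 then \<kappa> (NVar 2) else \<kappa> d)" for i :: nat
  have c0: "environment R c0"
    using p \<gamma>(1) P.\<kappa>_closed dS by (auto simp: environment_def c0_def)
  have "set (map c0 [0..<10]) \<subseteq> carrier R" using c0 by (auto simp: environment_def)
  then obtain x where x: "x \<in> carrier R" "codes_tuple R \<pi>0 x (map c0 [0..<10])"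
    using P.codes_tuple_exists by blast
  define e where "e = E x"
  have e: "environment R e" unfolding e_def using E[OF x(1)] .
  have e_simps: "e 0 = t" "e (Suc 0) = t'" "e 2 = x" by (simp_all add: e_def E_def)
  have node_value_E: "node_value R s (E \<zero>) = node_value R s e" if "is_atom s" "s \<noteq> NVar 2" for s
    using that by (cases s) (auto simp: is_atom_def e_def E_def)
  have codes: "P.codes_env w e" if w: "w \<in> carrier R" "lookup R \<pi>0 w (\<kappa> (NVar 2)) x"
    "\<forall>j \<in> carrier R. mem R \<pi>0 (\<pi>0 2) j \<longrightarrow> j = \<kappa> (NVar 2) \<or>
       (\<exists>z \<in> carrier R. lookup R \<pi>0 \<gamma> j z \<and> lookup R \<pi>0 w j z)" for w
    unfolding P.codes_env_def
  proof (intro conjI w(1) e ballI impI)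
    fix s assume s: "s \<in> S" "is_atom s"
    show "lookup R \<pi>0 w (\<kappa> s) (node_value R s e)"
    proof (cases "s = NVar 2")
      case True
      then show ?thesis using w(2) by (simp add: e_simps)
    next
      case False
      then have "\<kappa> s \<noteq> \<kappa> (NVar 2)" using P.\<kappa>_inj s(1) dS(2) by (auto dest: inj_onD)
      moreover have "mem R \<pi>0 (\<pi>0 2) (\<kappa> s)"
        using P.mem_\<kappa>(1)[OF s(1)] P.\<kappa>_image_iff[OF s(1)] s(2) by simp
      ultimately obtain z where z: "z \<in> carrier R" "lookup R \<pi>0 \<gamma> (\<kappa> s) z" "lookup R \<pi>0 w (\<kappa> s) z"
        using w(3) P.\<kappa>_closed[OF s(1)] by blast
      have "lookup R \<pi>0 \<gamma> (\<kappa> s) (node_value R s (E \<zero>))" "node_value R s (E \<zero>) \<in> carrier R"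
        using \<gamma>(2) s node_value_closed[OF S_consts[OF s(1)] E[OF zero_closed]] unfolding P.codes_env_def by blast+
      then have "z = node_value R s (E \<zero>)"
        using P.lookup_\<kappa>_unique[OF s(1) \<gamma>(1) z(2)] z(1) by blast
      then show ?thesis using z(3) node_value_E[OF s(2) False] by simp
    qed
  qed
  have sat: "node_value R d e = \<one> \<longleftrightarrow> sat R e \<psi>" and depth: "depth d \<le> n"
    using d e one_not_zero unfolding represents_def by auto
  have body: "diagonal_body R n (\<lambda>i. if i < 10 then c i else e (i - 10)) \<longleftrightarrow>
      (\<forall>i < 10. c i = c0 i) \<and> \<not> sat R e \<psi>" if c: "environment R c" for c
  proof -
    define e' where "e' i = (if i < 10 then c i else e (i - 10))" for i
    have pi: "mem R (\<lambda>i. e' (10 + i)) = mem R \<pi>0" "lookup R (\<lambda>i. e' (10 + i)) = lookup R \<pi>0"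
      by (auto intro!: mem_cong lookup_cong simp: \<pi>0_def e'_def e_simps)
    \<comment> \<open>Decoding is unique at length 10, so the existentially bound components can
      only be those put into \<open>x\<close>.\<close>
    have tuple: "codes_tuple R (\<lambda>i. e' (10 + i)) x (map e' [0..<10]) \<longleftrightarrow> (\<forall>i < 10. c i = c0 i)"
    proof -
      interpret Q: coding_params R t t' "\<lambda>i. e' (10 + i)"
        by unfold_locales (simp_all add: e'_def e_simps)
      have map: "map e' [0..<10] = map c [0..<10]" by (auto simp: e'_def)
      have "codes_tuple R (\<lambda>i. e' (10 + i)) x (map c0 [0..<10])"
        using x(2) codes_tuple_cong[of \<pi>0 "\<lambda>i. e' (10 + i)" R]
        by (simp add: \<pi>0_def e'_def e_simps)
      moreover have "set (map c [0..<10]) \<subseteq> carrier R" "set (map c0 [0..<10]) \<subseteq> carrier R"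
        using c c0 by (auto simp: environment_def)
      ultimately have "codes_tuple R (\<lambda>i. e' (10 + i)) x (map c [0..<10]) \<longleftrightarrow> map c [0..<10] = map c0 [0..<10]"
        using Q.codes_tuple_unique[of x "map c [0..<10]" "map c0 [0..<10]"] x(1)
        by (metis length_map)
      then show ?thesis unfolding map by auto
    qed
    have e': "e' 0 = c 0" "e' 7 = c 7" "e' 8 = c 8" "e' 9 = c 9" "e' 12 = x" by (simp_all add: e'_def e_simps)
    show ?thesis
    proof (cases "\<forall>i < 10. c i = c0 i")
      case True
      then have c_eq: "c 0 = \<pi>0 2" "c 7 = \<gamma>" "c 8 = \<kappa> (NVar 2)" "c 9 = \<kappa> d"
        by (simp_all add: c0_def \<pi>0_def numeral_2_eq_2)
      define \<pi> where "\<pi> i = e' (if i < 2 then 10 + i else i - 2)" for i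
      interpret Q: program R t t' \<pi> S \<kappa> \<beta>
      proof (rule program[rule_format], intro conjI)
        show "\<forall>i \<in> {2..8}. \<pi> i = p i"
        proof
          fix i :: nat assume "i \<in> {2..8}"
          then have "\<pi> i = c0 (i - 2)" "i - 2 < 7" "i - 2 + 2 = i"
            using True by (auto simp: \<pi>_def e'_def)
          then show "\<pi> i = p i" by (simp add: c0_def)
        qed
      qed (simp_all add: \<pi>_def e'_def e_simps)
      have lookup: "lookup R \<pi> = lookup R \<pi>0"
        by (rule lookup_cong) (simp_all add: \<pi>_def e'_def e_simps \<pi>0_def)
      have truth: "truth R n \<pi> (\<kappa> d) w \<longleftrightarrow> sat R e \<psi>" if "P.codes_env w e" for w
        using Q.truth_iff[of w e d n] that dS(1) depth sat
        by (simp add: Q.codes_env_def P.codes_env_def lookup)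
      have "(\<exists>w \<in> carrier R. lookup R \<pi>0 w (\<kappa> (NVar 2)) x \<and>
        (\<forall>j \<in> carrier R. mem R \<pi>0 (\<pi>0 2) j \<longrightarrow> j = \<kappa> (NVar 2) \<or>
           (\<exists>z \<in> carrier R. lookup R \<pi>0 \<gamma> j z \<and> lookup R \<pi>0 w j z)) \<and>
        \<not> truth R n \<pi> (\<kappa> d) w) \<longleftrightarrow> \<not> sat R e \<psi>" (is "?L \<longleftrightarrow> ?R")
      proof
        assume ?L
        then show ?R using codes truth by blast
      next
        assume ?R
        obtain w where w: "w \<in> carrier R" "P.codes_env w e" using P.codes_env_exists[OF e] by blast
        have "lookup R \<pi>0 w (\<kappa> (NVar 2)) (node_value R (NVar 2) e)"
          using w(2) dS(2) unfolding P.codes_env_def by (auto simp: is_atom_def)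
        moreover have "\<exists>z \<in> carrier R. lookup R \<pi>0 \<gamma> j z \<and> lookup R \<pi>0 w j z"
          if j: "j \<in> carrier R" "mem R \<pi>0 (\<pi>0 2) j" "j \<noteq> \<kappa> (NVar 2)" for j
        proof -
          obtain s where s: "s \<in> S" "is_atom s" "j = \<kappa> s" using P.mem_atom[OF j(1)] j(2) by auto
          then have "s \<noteq> NVar 2" using j(3) by auto
          then show ?thesis
            using s w(2) \<gamma>(2) node_value_E[OF s(2)] node_value_closed[OF S_consts[OF s(1)] e]
            unfolding P.codes_env_def by (intro bexI[of _ "node_value R s e"]) auto
        qed
        ultimately show ?L
          using w truth[OF w(2)] \<open>?R\<close> by (intro bexI[of _ w]) (auto simp: e_simps)
      qed
      then show ?thesis
        using True tuple unfolding diagonal_body_def e'_def[symmetric] pi e' c_eq \<pi>_def[symmetric]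
        by simp
    next
      case False
      then show ?thesis
        using tuple unfolding diagonal_body_def e'_def[symmetric] e' by blast
    qed
  qed
  have "diagonal R n e \<longleftrightarrow> \<not> sat R e \<psi>"
    unfolding diagonal_def using body c0 by blast
  then show ?thesis using e by blast
qed

theorem quantifier_hierarchy:
  "\<exists>\<phi>. consts_fm \<phi> = {} \<and>
    (\<forall>\<psi> \<in> boolean_combinations (Pi_formulas n (carrier R) \<union> Sigma_formulas n (carrier R)).
       \<not> equivalent_in R \<phi> \<psi>)"
proof -
  obtain \<phi> where \<phi>: "consts_fm \<phi> = {}" "\<And>e. environment R e \<Longrightarrow> sat R e \<phi> \<longleftrightarrow> diagonal R n e"
    using expressible_diagonal[of R n] unfolding expressible_def by blast
  have "\<not> equivalent_in R \<phi> \<psi>"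
    if \<psi>: "\<psi> \<in> boolean_combinations (Pi_formulas n (carrier R) \<union> Sigma_formulas n (carrier R))" for \<psi>
  proof -
    obtain d where "represents R n d \<psi>" using represents_boolean_combination[OF \<psi>] by blast
    from diagonal_not_represented[OF this] obtain e
      where "environment R e" "diagonal R n e \<longleftrightarrow> \<not> sat R e \<psi>" by blast
    then show ?thesis using \<phi>(2) unfolding equivalent_in_def environment_def by blast
  qed
  then show ?thesis using \<phi>(1) by blast
qed

end

section \<open>Word lengths in free groups\<close>

fun lcp :: "'a list \<Rightarrow> 'a list \<Rightarrow> nat" where
  "lcp (x # xs) (y # ys) = (if x = y then Suc (lcp xs ys) else 0)"
| "lcp _ _ = 0"

lemma lcp_Nil2 [simp]: "lcp xs [] = 0"
  by (cases xs) auto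

lemma lcp_commute: "lcp xs ys = lcp ys xs"
  by (induction xs ys rule: lcp.induct) auto

lemma lcp_ultrametric: "min (lcp xs ys) (lcp ys zs) \<le> lcp xs zs"
proof (induction xs ys arbitrary: zs rule: lcp.induct)
  case (1 x xs y ys)
  show ?case
  proof (cases zs)
    case (Cons z zs')
    then show ?thesis using 1[of zs'] by auto
  qed simp
qed auto

lemma nth_eq_if_less_lcp: "i < lcp xs ys \<Longrightarrow> i < length xs \<and> i < length ys \<and> xs ! i = ys ! i"
proof (induction xs ys arbitrary: i rule: lcp.induct)
  case (1 x xs y ys)
  then show ?case by (cases i) (auto split: if_splits)
qed auto

abbreviation inverse_word :: "'s word \<Rightarrow> 's word" where
  "inverse_word w \<equiv> rev (map inverse_letter w)"

lemma inverse_letter_neq [simp]: "inverse_letter x \<noteq> x"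
  by (cases x) (auto simp: inverse_letter_def)

lemma reduced_nth:
  assumes "reduced w" "Suc i < length w"
  shows "w ! Suc i \<noteq> inverse_letter (w ! i)"
  using assms by (simp add: reduced_def successively_conv_nth)

lemma foldr_push_letter_reduced_append:
  "reduced (u @ v) \<Longrightarrow> foldr push_letter u v = u @ v"
  by (induction u) (auto simp: reduced_Cons push_letter_reduced)

lemma reduced_inverse_word: "reduced w \<Longrightarrow> reduced (inverse_word w)"
  unfolding reduced_def successively_rev successively_map
  by (erule successively_mono) (auto simp: inverse_letter_def prod_eq_iff)

lemma reduced_append:
  "reduced u \<Longrightarrow> reduced v \<Longrightarrow> u = [] \<or> v = [] \<or> hd v \<noteq> inverse_letter (last u) \<Longrightarrow> reduced (u @ v)"
  by (auto simp: reduced_def successively_append_iff)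

text \<open>In the tree of reduced words \<open>lcp\<close> is the Gromov product at the empty word:
  forming the quotient cancels exactly the common prefix from both words.\<close>

lemma lcp_length_quotient:
  assumes "reduced u" "reduced v"
  shows "2 * lcp u v + length (foldr push_letter (inverse_word u) v) = length u + length v"
  using assms
proof (induction u v rule: lcp.induct)
  case (1 x xs y ys)
  show ?case
  proof (cases "x = y")
    case True
    have "push_letter (inverse_letter x) (y # ys) = ys"
      using True by (simp add: push_letter_def)
    then show ?thesis using 1 True by (simp add: reduced_Cons)
  next
    case False
    have "reduced (inverse_word (x # xs) @ y # ys)"
      using False 1(2,3) by (intro reduced_append reduced_inverse_word) auto
    then have "foldr push_letter (inverse_word (x # xs)) (y # ys) = inverse_word (x # xs) @ y # ys"
      by (rule foldr_push_letter_reduced_append)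
    then show ?thesis using False by simp
  qed
next
  case ("2_1" v)
  then show ?case by simp
next
  case ("2_2" u)
  then show ?case using foldr_push_letter_Nil[OF reduced_inverse_word[of u]] by simp
qed

text \<open>A common prefix reaching the middle of \<open>g\<close> would make the middle letter its
  own inverse (odd length) or the two middle letters inverse to each other (even length).\<close>

lemma lcp_inverse_word:
  assumes "reduced g" "g \<noteq> []"
  shows "2 * lcp g (inverse_word g) < length g"
proof (rule ccontr)
  assume "\<not> ?thesis"
  then have lcp: "length g \<le> 2 * lcp g (inverse_word g)" by simp
  define i where "i = (length g - 1) div 2"
  have i: "i < length g" "i < lcp g (inverse_word g)"
    using lcp length_greater_0_conv[of g] assms(2) unfolding i_def by linarith+
  have mirror: "g ! i = inverse_letter (g ! (length g - Suc i))"
    using nth_eq_if_less_lcp[OF i(2)] i(1) by (simp add: rev_nth)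
  consider "length g - Suc i = i" | "length g - Suc i = Suc i"
    using i(1) unfolding i_def by linarith
  then show False
  proof cases
    case 1
    then show False using mirror by (metis inverse_letter_neq)
  next
    case 2
    then have "g ! Suc i = inverse_letter (g ! i)"
      using arg_cong[OF mirror, of inverse_letter] by simp
    moreover have "Suc i < length g" using i(1) 2 by linarith
    then have "g ! Suc i \<noteq> inverse_letter (g ! i)" by (rule reduced_nth[OF assms(1)])
    ultimately show False by contradiction
  qed
qed

section \<open>Lengths of products and powers in a free group\<close>

context
  fixes S :: "'s set"
begin

interpretation F: group "free_group S" by (rule group_free_group)

lemma free_group_simps:
  "x \<in> carrier (free_group S) \<longleftrightarrow> set x \<subseteq> S \<times> UNIV \<and> reduced x"
  "x \<otimes>\<^bsub>free_group S\<^esub> y = foldr push_letter x y"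
  "\<one>\<^bsub>free_group S\<^esub> = []"
  by (simp_all add: free_group_def)

lemma inv_free_group:
  assumes "x \<in> carrier (free_group S)"
  shows "inv\<^bsub>free_group S\<^esub> x = inverse_word x"
proof (rule F.inv_equality)
  have x: "reduced x" "set x \<subseteq> S \<times> UNIV" using assms by (auto simp: free_group_simps)
  have "foldr push_letter (inverse_word x) (foldr push_letter x []) = []"
    by (rule foldr_push_letter_inverse) simp
  then show "inverse_word x \<otimes>\<^bsub>free_group S\<^esub> x = \<one>\<^bsub>free_group S\<^esub>"
    using x by (simp add: free_group_simps foldr_push_letter_Nil)
  show "inverse_word x \<in> carrier (free_group S)"
    using x reduced_inverse_word by (fastforce simp: free_group_simps inverse_letter_def)
qed (fact assms)

lemma length_inv_free_group:
  "x \<in> carrier (free_group S) \<Longrightarrow> length (inv\<^bsub>free_group S\<^esub> x) = length x"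
  by (simp add: inv_free_group)

lemma length_quotient:
  assumes "x \<in> carrier (free_group S)" "y \<in> carrier (free_group S)"
  shows "2 * lcp x y + length (inv\<^bsub>free_group S\<^esub> x \<otimes>\<^bsub>free_group S\<^esub> y) = length x + length y"
  using lcp_length_quotient[of x y] assms by (simp add: inv_free_group free_group_simps)

lemma length_product:
  assumes "x \<in> carrier (free_group S)" "y \<in> carrier (free_group S)"
  shows "2 * lcp (inv\<^bsub>free_group S\<^esub> x) y + length (x \<otimes>\<^bsub>free_group S\<^esub> y) = length x + length y"
  using length_quotient[of "inv\<^bsub>free_group S\<^esub> x" y] assms by (simp add: length_inv_free_group)

text \<open>Otherwise \<open>y\<close> shares at least half the length of \<open>g\<close> with both
  \<open>g\<close> and its inverse; by \<open>lcp_ultrametric\<close> so do \<open>g\<close> and its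
  inverse with each other, against \<open>lcp_inverse_word\<close>.\<close>

lemma length_mult_increases:
  assumes "g \<in> carrier (free_group S)" "y \<in> carrier (free_group S)" "g \<noteq> \<one>\<^bsub>free_group S\<^esub>"
  shows "length y < length (g \<otimes>\<^bsub>free_group S\<^esub> y) \<or>
    length y < length (inv\<^bsub>free_group S\<^esub> g \<otimes>\<^bsub>free_group S\<^esub> y)"
proof (rule ccontr)
  assume "\<not> ?thesis"
  then have "length g \<le> 2 * lcp (inv\<^bsub>free_group S\<^esub> g) y" "length g \<le> 2 * lcp g y"
    using length_product[OF assms(1,2)] length_quotient[OF assms(1,2)] by simp_all
  moreover have "min (lcp g y) (lcp (inv\<^bsub>free_group S\<^esub> g) y) \<le> lcp g (inv\<^bsub>free_group S\<^esub> g)"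
    using lcp_ultrametric[of g y "inv\<^bsub>free_group S\<^esub> g"]
    by (simp only: lcp_commute[of y "inv\<^bsub>free_group S\<^esub> g"])
  moreover have "2 * lcp g (inv\<^bsub>free_group S\<^esub> g) < length g"
    using assms lcp_inverse_word[of g] by (simp add: inv_free_group free_group_simps)
  ultimately show False by (simp add: min_def split: if_splits)
qed

text \<open>Multiplying \<open>g^(n+1)\<close> by the inverse of \<open>g\<close> gives the shorter
  word \<open>g^n\<close>, so by \<open>length_mult_increases\<close> multiplying by
  \<open>g\<close> must lengthen it.\<close>

lemma length_pow_less:
  assumes "g \<in> carrier (free_group S)" "g \<noteq> \<one>\<^bsub>free_group S\<^esub>"
  shows "length (g [^]\<^bsub>free_group S\<^esub> n) < length (g [^]\<^bsub>free_group S\<^esub> Suc n)"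
proof (induction n)
  case 0
  then show ?case using assms by (simp add: free_group_simps)
next
  case (Suc n)
  have "inv\<^bsub>free_group S\<^esub> g \<otimes>\<^bsub>free_group S\<^esub> g [^]\<^bsub>free_group S\<^esub> Suc n = g [^]\<^bsub>free_group S\<^esub> n"
    using assms(1) by (simp only: F.nat_pow_Suc2) (simp add: F.m_assoc[symmetric])
  moreover have "g \<otimes>\<^bsub>free_group S\<^esub> g [^]\<^bsub>free_group S\<^esub> Suc n = g [^]\<^bsub>free_group S\<^esub> Suc (Suc n)"
    using assms(1) by (metis F.nat_pow_Suc2)
  ultimately show ?case
    using length_mult_increases[of g "g [^]\<^bsub>free_group S\<^esub> Suc n"] assms Suc by auto
qed

lemma strict_mono_length_pow:
  assumes "g \<in> carrier (free_group S)" "g \<noteq> \<one>\<^bsub>free_group S\<^esub>"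
  shows "strict_mono (\<lambda>n::nat. length (g [^]\<^bsub>free_group S\<^esub> n))"
  using length_pow_less[OF assms] by (intro strict_mono_Suc_iff[THEN iffD2]) simp

text \<open>The quotient of \<open>g^n\<close> and \<open>g\<close> has the length of
  \<open>g^(n-1)\<close>, which is less than that of \<open>g^n\<close>;
  \<open>length_quotient\<close> turns this into a long common prefix.\<close>

lemma lcp_pow:
  assumes "g \<in> carrier (free_group S)" "g \<noteq> \<one>\<^bsub>free_group S\<^esub>" "(n::nat) > 0"
  shows "length g < 2 * lcp (g [^]\<^bsub>free_group S\<^esub> n) g"
proof -
  obtain m where n: "n = Suc m" using assms(3) by (cases n) auto
  have "inv\<^bsub>free_group S\<^esub> (g [^]\<^bsub>free_group S\<^esub> n) \<otimes>\<^bsub>free_group S\<^esub> g =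
      inv\<^bsub>free_group S\<^esub> (g [^]\<^bsub>free_group S\<^esub> m)"
    unfolding n using assms(1)
    by (simp only: F.nat_pow_Suc2) (simp add: F.inv_mult_group F.m_assoc)
  then show ?thesis
    using length_quotient[of "g [^]\<^bsub>free_group S\<^esub> n" g] assms(1) length_pow_less[OF assms(1,2), of m]
    by (simp add: n length_inv_free_group)
qed

text \<open>
  Here \<open>2 * lcp \<alpha> \<beta>\<close> is at most the shorter of the two lengths, whereas a proper power of \<open>\<alpha>\<close>
  agrees with \<open>\<alpha>\<close>, and with a word that its inverse does not lengthen, on more than half of \<open>\<alpha>\<close>.
\<close>
lemma independent_powers:
  assumes \<alpha>: "\<alpha> \<in> carrier (free_group S)" "\<alpha> \<noteq> \<one>\<^bsub>free_group S\<^esub>"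
    and \<beta>: "\<beta> \<in> carrier (free_group S)" "\<beta> \<noteq> \<one>\<^bsub>free_group S\<^esub>"
    and ge: "length \<alpha> \<le> length (inv\<^bsub>free_group S\<^esub> \<alpha> \<otimes>\<^bsub>free_group S\<^esub> \<beta>)"
      "length \<beta> \<le> length (inv\<^bsub>free_group S\<^esub> \<alpha> \<otimes>\<^bsub>free_group S\<^esub> \<beta>)"
    and y: "y \<in> carrier (free_group S)" and ij: "i \<ge> 2" "j \<ge> 2"
  shows "length y < length (inv\<^bsub>free_group S\<^esub> (\<alpha> [^]\<^bsub>free_group S\<^esub> (i::nat)) \<otimes>\<^bsub>free_group S\<^esub> y) \<or>
    length y < length (inv\<^bsub>free_group S\<^esub> (\<beta> [^]\<^bsub>free_group S\<^esub> (j::nat)) \<otimes>\<^bsub>free_group S\<^esub> y)"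
proof -
  let ?x = "\<alpha> [^]\<^bsub>free_group S\<^esub> i" and ?z = "\<beta> [^]\<^bsub>free_group S\<^esub> j"
  \<comment> \<open>This strictness requires exponents of at least 2. If \<open>y\<close> is not
    lengthened, \<open>2 * lcp ?x y\<close> is at least the length of \<open>?x\<close>, hence
    greater than that of \<open>\<alpha>\<close>, and likewise for \<open>?z\<close> and
    \<open>\<beta>\<close>; the ultrametric chain then exceeds the bound on
    \<open>lcp \<alpha> \<beta>\<close>.\<close>
  have "length \<alpha> < length ?x" "length \<beta> < length ?z"
    using strict_monoD[OF strict_mono_length_pow[OF \<alpha>], of 1 i]
      strict_monoD[OF strict_mono_length_pow[OF \<beta>], of 1 j] ij \<alpha>(1) \<beta>(1) by simp_all
  moreover have "length \<alpha> < 2 * lcp ?x \<alpha>" "length \<beta> < 2 * lcp ?z \<beta>"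
    using lcp_pow[OF \<alpha>, of i] lcp_pow[OF \<beta>, of j] ij by simp_all
  moreover have "?x \<in> carrier (free_group S)" "?z \<in> carrier (free_group S)"
    using \<alpha>(1) \<beta>(1) by simp_all
  moreover have x: "?x \<in> carrier (free_group S)" and z: "?z \<in> carrier (free_group S)"
    using \<alpha>(1) \<beta>(1) by simp_all
  moreover have "2 * lcp \<alpha> \<beta> \<le> length \<alpha>" "2 * lcp \<alpha> \<beta> \<le> length \<beta>"
    using length_quotient[OF \<alpha>(1) \<beta>(1)] ge by linarith+
  moreover have "min (lcp ?x y) (lcp ?z y) \<le> lcp ?x ?z"
    using lcp_ultrametric[of ?x y ?z] by (simp only: lcp_commute[of y ?z])
  moreover have "min (lcp ?x \<alpha>) (min (lcp ?x ?z) (lcp ?z \<beta>)) \<le> lcp \<alpha> \<beta>"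
    using lcp_ultrametric[of \<alpha> ?x ?z] lcp_ultrametric[of \<alpha> ?z \<beta>]
    unfolding lcp_commute[of \<alpha> ?x] by (simp add: min_le_iff_disj min.assoc) (metis le_trans)
  ultimately show ?thesis
    using length_quotient[OF x y] length_quotient[OF z y] by linarith
qed

end

section \<open>Group algebras of limit groups\<close>

lemma (in abelian_monoid) finsum_swap:
  assumes "finite A" "finite B" "\<And>x y. x \<in> A \<Longrightarrow> y \<in> B \<Longrightarrow> f x y \<in> carrier G"
  shows "(\<Oplus>x\<in>A. \<Oplus>y\<in>B. f x y) = (\<Oplus>y\<in>B. \<Oplus>x\<in>A. f x y)"
  using assms(1,3)
proof (induction A)
  case empty
  then show ?case by simp
next
  case (insert a A)
  have "(\<Oplus>x\<in>insert a A. \<Oplus>y\<in>B. f x y) = (\<Oplus>y\<in>B. f a y) \<oplus> (\<Oplus>y\<in>B. \<Oplus>x\<in>A. f x y)"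
    using insert by (simp add: Pi_iff)
  also have "\<dots> = (\<Oplus>y\<in>B. f a y \<oplus> (\<Oplus>x\<in>A. f x y))"
    using insert by (intro finsum_addf[symmetric]) (auto intro!: finsum_closed)
  also have "\<dots> = (\<Oplus>y\<in>B. \<Oplus>x\<in>insert a A. f x y)"
    using insert by (intro finsum_cong') (auto simp: Pi_iff intro!: finsum_closed)
  finally show ?case .
qed

section \<open>The group algebra is a ring\<close>

locale group_ring = G: group G + K: field K
  for G :: "('g, 'n) monoid_scheme" and K :: "('k, 'm) ring_scheme"
begin

abbreviation "KG \<equiv> group_algebra K G"

definition support :: "('g \<Rightarrow> 'k) \<Rightarrow> 'g set" where
  "support f = {x \<in> carrier G. f x \<noteq> \<zero>\<^bsub>K\<^esub>}"

lemma KG_iff: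
  "f \<in> carrier KG \<longleftrightarrow> (\<forall>x \<in> carrier G. f x \<in> carrier K) \<and> (\<forall>x. x \<notin> carrier G \<longrightarrow> f x = \<zero>\<^bsub>K\<^esub>) \<and>
     finite (support f)"
proof -
  have "{x. f x \<noteq> \<zero>\<^bsub>K\<^esub>} = support f" if "\<forall>x. x \<notin> carrier G \<longrightarrow> f x = \<zero>\<^bsub>K\<^esub>"
    using that by (auto simp: support_def)
  then show ?thesis by (auto simp: group_algebra_def)
qed

lemma KG_closed: "f \<in> carrier KG \<Longrightarrow> f x \<in> carrier K"
  unfolding KG_iff by (cases "x \<in> carrier G") auto

lemma KG_outside: "f \<in> carrier KG \<Longrightarrow> x \<notin> carrier G \<Longrightarrow> f x = \<zero>\<^bsub>K\<^esub>"
  unfolding KG_iff by blast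

lemma finite_support: "f \<in> carrier KG \<Longrightarrow> finite (support f)"
  unfolding KG_iff by blast

lemma support_subset: "support f \<subseteq> carrier G"
  by (auto simp: support_def)

lemma not_in_support: "f \<in> carrier KG \<Longrightarrow> x \<notin> support f \<Longrightarrow> f x = \<zero>\<^bsub>K\<^esub>"
  using KG_outside by (auto simp: support_def)

lemma KG_I:
  assumes "\<And>x. x \<in> carrier G \<Longrightarrow> f x \<in> carrier K" "\<And>x. x \<notin> carrier G \<Longrightarrow> f x = \<zero>\<^bsub>K\<^esub>"
    "finite A" "\<And>x. x \<in> carrier G \<Longrightarrow> x \<notin> A \<Longrightarrow> f x = \<zero>\<^bsub>K\<^esub>"
  shows "f \<in> carrier KG"
proof -
  have "support f \<subseteq> A" using assms(4) by (auto simp: support_def)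
  then show ?thesis unfolding KG_iff using assms(1-3) finite_subset by blast
qed

lemma KG_eqI:
  assumes "f \<in> carrier KG" "g \<in> carrier KG" "\<And>x. x \<in> carrier G \<Longrightarrow> f x = g x"
  shows "f = g"
proof
  fix x show "f x = g x"
    using assms(3) KG_outside[OF assms(1)] KG_outside[OF assms(2)] by (cases "x \<in> carrier G") auto
qed

lemma add_apply: "(f \<oplus>\<^bsub>KG\<^esub> g) x = f x \<oplus>\<^bsub>K\<^esub> g x"
  by (simp add: group_algebra_def)

lemma zero_apply: "\<zero>\<^bsub>KG\<^esub> x = \<zero>\<^bsub>K\<^esub>"
  by (simp add: group_algebra_def)

lemma one_apply: "\<one>\<^bsub>KG\<^esub> x = (if x = \<one>\<^bsub>G\<^esub> then \<one>\<^bsub>K\<^esub> else \<zero>\<^bsub>K\<^esub>)"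
  by (simp add: group_algebra_def)

lemma mult_outside: "x \<notin> carrier G \<Longrightarrow> (f \<otimes>\<^bsub>KG\<^esub> g) x = \<zero>\<^bsub>K\<^esub>"
  by (simp add: group_algebra_def)

text \<open>The index set may be any finite superset of the support, so that several products can be
  summed over one common set.\<close>

lemma mult_apply:
  assumes "f \<in> carrier KG" "g \<in> carrier KG" "finite A" "A \<subseteq> carrier G" "support f \<subseteq> A" "x \<in> carrier G"
  shows "(f \<otimes>\<^bsub>KG\<^esub> g) x = (\<Oplus>\<^bsub>K\<^esub>y\<in>A. f y \<otimes>\<^bsub>K\<^esub> g (inv\<^bsub>G\<^esub> y \<otimes>\<^bsub>G\<^esub> x))"
proof -
  have "(f \<otimes>\<^bsub>KG\<^esub> g) x = (\<Oplus>\<^bsub>K\<^esub>y\<in>support f. f y \<otimes>\<^bsub>K\<^esub> g (inv\<^bsub>G\<^esub> y \<otimes>\<^bsub>G\<^esub> x))"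
    using assms(6) by (simp add: group_algebra_def support_def)
  also have "\<dots> = (\<Oplus>\<^bsub>K\<^esub>y\<in>A. f y \<otimes>\<^bsub>K\<^esub> g (inv\<^bsub>G\<^esub> y \<otimes>\<^bsub>G\<^esub> x))"
    using assms KG_closed[OF assms(1)] KG_closed[OF assms(2)] not_in_support[OF assms(1)]
    by (intro K.add.finprod_mono_neutral_cong_left) auto
  finally show ?thesis .
qed

lemma mult_closed:
  assumes f: "f \<in> carrier KG" and g: "g \<in> carrier KG"
  shows "f \<otimes>\<^bsub>KG\<^esub> g \<in> carrier KG"
proof (rule KG_I)
  let ?A = "(\<lambda>(y, z). y \<otimes>\<^bsub>G\<^esub> z) ` (support f \<times> support g)"
  show "finite ?A" using finite_support[OF f] finite_support[OF g] by simp
  fix x assume x: "x \<in> carrier G"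
  note fg = mult_apply[OF f g finite_support[OF f] support_subset subset_refl x]
  show "(f \<otimes>\<^bsub>KG\<^esub> g) x \<in> carrier K"
    unfolding fg using KG_closed[OF f] KG_closed[OF g] by (intro K.finsum_closed) auto
  show "(f \<otimes>\<^bsub>KG\<^esub> g) x = \<zero>\<^bsub>K\<^esub>" if "x \<notin> ?A"
    unfolding fg
  proof (rule K.add.finprod_one_eqI)
    fix y assume y: "y \<in> support f"
    then have yc: "y \<in> carrier G" using support_subset by blast
    then have "x = y \<otimes>\<^bsub>G\<^esub> (inv\<^bsub>G\<^esub> y \<otimes>\<^bsub>G\<^esub> x)" using x by (simp add: G.m_assoc[symmetric])
    then have "inv\<^bsub>G\<^esub> y \<otimes>\<^bsub>G\<^esub> x \<notin> support g" using that y by force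
    then show "f y \<otimes>\<^bsub>K\<^esub> g (inv\<^bsub>G\<^esub> y \<otimes>\<^bsub>G\<^esub> x) = \<zero>\<^bsub>K\<^esub>"
      using not_in_support[OF g] KG_closed[OF f] by simp
  qed
qed (rule mult_outside)

lemma add_closed:
  assumes "f \<in> carrier KG" "g \<in> carrier KG"
  shows "f \<oplus>\<^bsub>KG\<^esub> g \<in> carrier KG"
proof (rule KG_I)
  show "finite (support f \<union> support g)" using assms finite_support by simp
qed (use KG_closed[OF assms(1)] KG_closed[OF assms(2)] KG_outside[OF assms(1)] KG_outside[OF assms(2)]
    not_in_support[OF assms(1)] not_in_support[OF assms(2)] in \<open>auto simp: add_apply\<close>)

lemma zero_closed: "\<zero>\<^bsub>KG\<^esub> \<in> carrier KG"
  by (rule KG_I[where A = "{}"]) (auto simp: zero_apply)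

lemma one_closed: "\<one>\<^bsub>KG\<^esub> \<in> carrier KG"
  by (rule KG_I[where A = "{\<one>\<^bsub>G\<^esub>}"]) (auto simp: one_apply)

lemma abelian_group_KG: "abelian_group KG"
proof (rule abelian_groupI)
  fix f assume f: "f \<in> carrier KG"
  define g where "g x = \<ominus>\<^bsub>K\<^esub> f x" for x
  have "g \<in> carrier KG"
    using KG_closed[OF f] KG_outside[OF f] not_in_support[OF f] finite_support[OF f]
    by (intro KG_I[where A = "support f"]) (auto simp: g_def)
  moreover have "g \<oplus>\<^bsub>KG\<^esub> f = \<zero>\<^bsub>KG\<^esub>"
    using KG_closed[OF f] by (intro ext) (simp add: add_apply zero_apply g_def K.l_neg)
  ultimately show "\<exists>g \<in> carrier KG. g \<oplus>\<^bsub>KG\<^esub> f = \<zero>\<^bsub>KG\<^esub>" by blast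
next
  fix f assume "f \<in> carrier KG"
  then show "\<zero>\<^bsub>KG\<^esub> \<oplus>\<^bsub>KG\<^esub> f = f" using KG_closed by (intro ext) (simp add: add_apply zero_apply)
next
  fix f g assume "f \<in> carrier KG" "g \<in> carrier KG"
  then show "f \<oplus>\<^bsub>KG\<^esub> g = g \<oplus>\<^bsub>KG\<^esub> f"
    using KG_closed by (intro ext) (simp add: add_apply K.a_comm)
next
  fix f g h assume "f \<in> carrier KG" "g \<in> carrier KG" "h \<in> carrier KG"
  then show "f \<oplus>\<^bsub>KG\<^esub> g \<oplus>\<^bsub>KG\<^esub> h = f \<oplus>\<^bsub>KG\<^esub> (g \<oplus>\<^bsub>KG\<^esub> h)"
    using KG_closed by (intro ext) (simp add: add_apply K.a_assoc)
qed (auto simp: add_closed zero_closed)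

lemma mult_assoc:
  assumes f: "f \<in> carrier KG" and g: "g \<in> carrier KG" and h: "h \<in> carrier KG"
  shows "f \<otimes>\<^bsub>KG\<^esub> g \<otimes>\<^bsub>KG\<^esub> h = f \<otimes>\<^bsub>KG\<^esub> (g \<otimes>\<^bsub>KG\<^esub> h)"
proof (rule KG_eqI)
  fix x assume x: "x \<in> carrier G"
  define A B where "A = support f" and "B = support g"
  \<comment> \<open>\<open>Z\<close> contains every product of support elements and does not depend
    on the outer index, so the two sums can be swapped.\<close>
  define Z where "Z = (\<lambda>(y, z). y \<otimes>\<^bsub>G\<^esub> z) ` (A \<times> B)"
  have A: "finite A" "A \<subseteq> carrier G" and B: "finite B" "B \<subseteq> carrier G"
    using finite_support f g support_subset by (auto simp: A_def B_def)
  have Z: "finite Z" "Z \<subseteq> carrier G" using A B by (auto simp: Z_def)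
  have cl: "f y \<in> carrier K" "g y \<in> carrier K" "h y \<in> carrier K" for y
    using KG_closed f g h by auto
  note fg = mult_closed[OF f g] and gh = mult_closed[OF g h]
  have "support (f \<otimes>\<^bsub>KG\<^esub> g) \<subseteq> Z"
  proof
    fix z assume z: "z \<in> support (f \<otimes>\<^bsub>KG\<^esub> g)"
    then have zc: "z \<in> carrier G" using support_subset by blast
    show "z \<in> Z"
    proof (rule ccontr)
      assume nz: "z \<notin> Z"
      have "(f \<otimes>\<^bsub>KG\<^esub> g) z = (\<Oplus>\<^bsub>K\<^esub>y\<in>A. f y \<otimes>\<^bsub>K\<^esub> g (inv\<^bsub>G\<^esub> y \<otimes>\<^bsub>G\<^esub> z))"
        using mult_apply[OF f g A] zc by (simp add: A_def)
      also have "\<dots> = \<zero>\<^bsub>K\<^esub>"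
      proof (rule K.add.finprod_one_eqI)
        fix y assume y: "y \<in> A"
        then have "z = y \<otimes>\<^bsub>G\<^esub> (inv\<^bsub>G\<^esub> y \<otimes>\<^bsub>G\<^esub> z)" using zc A(2) by (auto simp: G.m_assoc[symmetric])
        then have "inv\<^bsub>G\<^esub> y \<otimes>\<^bsub>G\<^esub> z \<notin> B" using nz y unfolding Z_def by force
        then show "f y \<otimes>\<^bsub>K\<^esub> g (inv\<^bsub>G\<^esub> y \<otimes>\<^bsub>G\<^esub> z) = \<zero>\<^bsub>K\<^esub>"
          using not_in_support[OF g] cl by (simp add: B_def)
      qed
      finally show False using z by (simp add: support_def)
    qed
  qed
  then have "(f \<otimes>\<^bsub>KG\<^esub> g \<otimes>\<^bsub>KG\<^esub> h) x =
      (\<Oplus>\<^bsub>K\<^esub>z\<in>Z. (f \<otimes>\<^bsub>KG\<^esub> g) z \<otimes>\<^bsub>K\<^esub> h (inv\<^bsub>G\<^esub> z \<otimes>\<^bsub>G\<^esub> x))"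
    using mult_apply[OF fg h Z] x by blast
  also have "\<dots> = (\<Oplus>\<^bsub>K\<^esub>z\<in>Z. \<Oplus>\<^bsub>K\<^esub>y\<in>A. f y \<otimes>\<^bsub>K\<^esub> g (inv\<^bsub>G\<^esub> y \<otimes>\<^bsub>G\<^esub> z) \<otimes>\<^bsub>K\<^esub> h (inv\<^bsub>G\<^esub> z \<otimes>\<^bsub>G\<^esub> x))"
  proof (rule K.finsum_cong')
    fix z assume "z \<in> Z"
    then have "z \<in> carrier G" using Z by blast
    then have "(f \<otimes>\<^bsub>KG\<^esub> g) z = (\<Oplus>\<^bsub>K\<^esub>y\<in>A. f y \<otimes>\<^bsub>K\<^esub> g (inv\<^bsub>G\<^esub> y \<otimes>\<^bsub>G\<^esub> z))"
      using mult_apply[OF f g A] by (simp add: A_def)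
    then show "(f \<otimes>\<^bsub>KG\<^esub> g) z \<otimes>\<^bsub>K\<^esub> h (inv\<^bsub>G\<^esub> z \<otimes>\<^bsub>G\<^esub> x) =
        (\<Oplus>\<^bsub>K\<^esub>y\<in>A. f y \<otimes>\<^bsub>K\<^esub> g (inv\<^bsub>G\<^esub> y \<otimes>\<^bsub>G\<^esub> z) \<otimes>\<^bsub>K\<^esub> h (inv\<^bsub>G\<^esub> z \<otimes>\<^bsub>G\<^esub> x))"
      using A(1) cl by (simp add: K.finsum_ldistr Pi_iff)
  qed (use cl in \<open>auto intro!: K.finsum_closed\<close>)
  also have "\<dots> = (\<Oplus>\<^bsub>K\<^esub>y\<in>A. \<Oplus>\<^bsub>K\<^esub>z\<in>Z. f y \<otimes>\<^bsub>K\<^esub> g (inv\<^bsub>G\<^esub> y \<otimes>\<^bsub>G\<^esub> z) \<otimes>\<^bsub>K\<^esub> h (inv\<^bsub>G\<^esub> z \<otimes>\<^bsub>G\<^esub> x))"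
    using A(1) Z(1) cl by (intro K.finsum_swap) auto
  also have "\<dots> = (\<Oplus>\<^bsub>K\<^esub>y\<in>A. f y \<otimes>\<^bsub>K\<^esub> (g \<otimes>\<^bsub>KG\<^esub> h) (inv\<^bsub>G\<^esub> y \<otimes>\<^bsub>G\<^esub> x))"
  proof (rule K.finsum_cong')
    fix y assume y: "y \<in> A"
    then have yc: "y \<in> carrier G" using A by blast
    \<comment> \<open>After the swap \<open>y\<close> is fixed: since \<open>g\<close> vanishes off
      \<open>B\<close>, only \<open>z\<close> in the translate \<open>y B\<close> contribute, and
      the substitution \<open>z = y w\<close> follows.\<close>
    have "(\<Oplus>\<^bsub>K\<^esub>z\<in>Z. f y \<otimes>\<^bsub>K\<^esub> g (inv\<^bsub>G\<^esub> y \<otimes>\<^bsub>G\<^esub> z) \<otimes>\<^bsub>K\<^esub> h (inv\<^bsub>G\<^esub> z \<otimes>\<^bsub>G\<^esub> x)) =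
        (\<Oplus>\<^bsub>K\<^esub>z\<in>(\<otimes>\<^bsub>G\<^esub>) y ` B. f y \<otimes>\<^bsub>K\<^esub> g (inv\<^bsub>G\<^esub> y \<otimes>\<^bsub>G\<^esub> z) \<otimes>\<^bsub>K\<^esub> h (inv\<^bsub>G\<^esub> z \<otimes>\<^bsub>G\<^esub> x))"
    proof (rule K.add.finprod_mono_neutral_cong_right)
      show "\<And>z. z \<in> Z - (\<otimes>\<^bsub>G\<^esub>) y ` B \<Longrightarrow>
          f y \<otimes>\<^bsub>K\<^esub> g (inv\<^bsub>G\<^esub> y \<otimes>\<^bsub>G\<^esub> z) \<otimes>\<^bsub>K\<^esub> h (inv\<^bsub>G\<^esub> z \<otimes>\<^bsub>G\<^esub> x) = \<zero>\<^bsub>K\<^esub>"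
      proof -
        fix z assume z: "z \<in> Z - (\<otimes>\<^bsub>G\<^esub>) y ` B"
        then have "z = y \<otimes>\<^bsub>G\<^esub> (inv\<^bsub>G\<^esub> y \<otimes>\<^bsub>G\<^esub> z)" using yc Z(2) by (auto simp: G.m_assoc[symmetric])
        then have "inv\<^bsub>G\<^esub> y \<otimes>\<^bsub>G\<^esub> z \<notin> B" using z by blast
        then have "g (inv\<^bsub>G\<^esub> y \<otimes>\<^bsub>G\<^esub> z) = \<zero>\<^bsub>K\<^esub>" using not_in_support[OF g] by (simp add: B_def)
        then show "f y \<otimes>\<^bsub>K\<^esub> g (inv\<^bsub>G\<^esub> y \<otimes>\<^bsub>G\<^esub> z) \<otimes>\<^bsub>K\<^esub> h (inv\<^bsub>G\<^esub> z \<otimes>\<^bsub>G\<^esub> x) = \<zero>\<^bsub>K\<^esub>"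
          using cl by simp
      qed
      show "(\<otimes>\<^bsub>G\<^esub>) y ` B \<subseteq> Z" using y by (auto simp: Z_def)
    qed (use Z(1) cl in auto)
    also have "\<dots> = (\<Oplus>\<^bsub>K\<^esub>w\<in>B. f y \<otimes>\<^bsub>K\<^esub> g (inv\<^bsub>G\<^esub> y \<otimes>\<^bsub>G\<^esub> (y \<otimes>\<^bsub>G\<^esub> w)) \<otimes>\<^bsub>K\<^esub> h (inv\<^bsub>G\<^esub> (y \<otimes>\<^bsub>G\<^esub> w) \<otimes>\<^bsub>G\<^esub> x))"
      using cl subsetD[OF B(2)] yc by (intro K.finsum_reindex inj_onI) auto
    also have "\<dots> = (\<Oplus>\<^bsub>K\<^esub>w\<in>B. f y \<otimes>\<^bsub>K\<^esub> (g w \<otimes>\<^bsub>K\<^esub> h (inv\<^bsub>G\<^esub> w \<otimes>\<^bsub>G\<^esub> (inv\<^bsub>G\<^esub> y \<otimes>\<^bsub>G\<^esub> x))))"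
    proof (rule K.finsum_cong')
      fix w assume w: "w \<in> B"
      then have wc: "w \<in> carrier G" using B by blast
      have "inv\<^bsub>G\<^esub> y \<otimes>\<^bsub>G\<^esub> (y \<otimes>\<^bsub>G\<^esub> w) = w" using yc wc by (simp add: G.m_assoc[symmetric])
      moreover have "inv\<^bsub>G\<^esub> (y \<otimes>\<^bsub>G\<^esub> w) \<otimes>\<^bsub>G\<^esub> x = inv\<^bsub>G\<^esub> w \<otimes>\<^bsub>G\<^esub> (inv\<^bsub>G\<^esub> y \<otimes>\<^bsub>G\<^esub> x)"
        using yc wc x by (simp add: G.inv_mult_group G.m_assoc)
      ultimately show "f y \<otimes>\<^bsub>K\<^esub> g (inv\<^bsub>G\<^esub> y \<otimes>\<^bsub>G\<^esub> (y \<otimes>\<^bsub>G\<^esub> w)) \<otimes>\<^bsub>K\<^esub> h (inv\<^bsub>G\<^esub> (y \<otimes>\<^bsub>G\<^esub> w) \<otimes>\<^bsub>G\<^esub> x) =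
          f y \<otimes>\<^bsub>K\<^esub> (g w \<otimes>\<^bsub>K\<^esub> h (inv\<^bsub>G\<^esub> w \<otimes>\<^bsub>G\<^esub> (inv\<^bsub>G\<^esub> y \<otimes>\<^bsub>G\<^esub> x)))"
        using cl by (simp add: K.m_assoc)
    qed (use cl in auto)
    also have "\<dots> = f y \<otimes>\<^bsub>K\<^esub> (g \<otimes>\<^bsub>KG\<^esub> h) (inv\<^bsub>G\<^esub> y \<otimes>\<^bsub>G\<^esub> x)"
      using mult_apply[OF g h B, of "inv\<^bsub>G\<^esub> y \<otimes>\<^bsub>G\<^esub> x"] yc x B(1) cl
      by (simp add: B_def K.finsum_rdistr Pi_iff)
    finally show "(\<Oplus>\<^bsub>K\<^esub>z\<in>Z. f y \<otimes>\<^bsub>K\<^esub> g (inv\<^bsub>G\<^esub> y \<otimes>\<^bsub>G\<^esub> z) \<otimes>\<^bsub>K\<^esub> h (inv\<^bsub>G\<^esub> z \<otimes>\<^bsub>G\<^esub> x)) =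
      f y \<otimes>\<^bsub>K\<^esub> (g \<otimes>\<^bsub>KG\<^esub> h) (inv\<^bsub>G\<^esub> y \<otimes>\<^bsub>G\<^esub> x)" .
  qed (use cl KG_closed[OF gh] in \<open>auto intro!: K.finsum_closed\<close>)
  also have "\<dots> = (f \<otimes>\<^bsub>KG\<^esub> (g \<otimes>\<^bsub>KG\<^esub> h)) x"
    using mult_apply[OF f gh A] x by (simp add: A_def)
  finally show "(f \<otimes>\<^bsub>KG\<^esub> g \<otimes>\<^bsub>KG\<^esub> h) x = (f \<otimes>\<^bsub>KG\<^esub> (g \<otimes>\<^bsub>KG\<^esub> h)) x" .
qed (use f g h in \<open>auto intro!: mult_closed\<close>)

definition single :: "'g \<Rightarrow> 'k \<Rightarrow> 'g \<Rightarrow> 'k" where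
  "single a k x = (if x = a then k else \<zero>\<^bsub>K\<^esub>)"

lemma single_closed: "a \<in> carrier G \<Longrightarrow> k \<in> carrier K \<Longrightarrow> single a k \<in> carrier KG"
  by (rule KG_I[where A = "{a}"]) (auto simp: single_def)

lemma single_mult_apply:
  assumes "a \<in> carrier G" "k \<in> carrier K" "f \<in> carrier KG" "x \<in> carrier G"
  shows "(single a k \<otimes>\<^bsub>KG\<^esub> f) x = k \<otimes>\<^bsub>K\<^esub> f (inv\<^bsub>G\<^esub> a \<otimes>\<^bsub>G\<^esub> x)"
proof -
  have "support (single a k) \<subseteq> {a}" by (auto simp: support_def single_def)
  then show ?thesis
    using mult_apply[OF single_closed[OF assms(1,2)] assms(3), of "{a}" x] assms KG_closed[OF assms(3)]
    by (simp add: single_def)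
qed

lemma mult_single_one_apply:
  assumes "k \<in> carrier K" "f \<in> carrier KG" "x \<in> carrier G"
  shows "(f \<otimes>\<^bsub>KG\<^esub> single \<one>\<^bsub>G\<^esub> k) x = f x \<otimes>\<^bsub>K\<^esub> k"
proof -
  \<comment> \<open>\<open>x\<close> is added because it may lie outside the support, while the only
    term that survives is the one at \<open>y = x\<close>.\<close>
  have A: "finite (insert x (support f))" "insert x (support f) \<subseteq> carrier G"
    using assms(3) finite_support[OF assms(2)] support_subset by auto
  have "(f \<otimes>\<^bsub>KG\<^esub> single \<one>\<^bsub>G\<^esub> k) x =
      (\<Oplus>\<^bsub>K\<^esub>y\<in>insert x (support f). f y \<otimes>\<^bsub>K\<^esub> single \<one>\<^bsub>G\<^esub> k (inv\<^bsub>G\<^esub> y \<otimes>\<^bsub>G\<^esub> x))"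
    using mult_apply[OF assms(2) single_closed[OF G.one_closed assms(1)] A] assms(3) by blast
  also have "\<dots> = (\<Oplus>\<^bsub>K\<^esub>y\<in>insert x (support f). if x = y then f y \<otimes>\<^bsub>K\<^esub> k else \<zero>\<^bsub>K\<^esub>)"
  proof (rule K.finsum_cong')
    fix y assume "y \<in> insert x (support f)"
    then have y: "y \<in> carrier G" using A(2) by blast
    have "inv\<^bsub>G\<^esub> y \<otimes>\<^bsub>G\<^esub> x = \<one>\<^bsub>G\<^esub> \<longleftrightarrow> x = y"
      using y assms(3) by (metis G.inv_closed G.inv_inv G.inv_equality G.l_inv)
    then show "f y \<otimes>\<^bsub>K\<^esub> single \<one>\<^bsub>G\<^esub> k (inv\<^bsub>G\<^esub> y \<otimes>\<^bsub>G\<^esub> x) = (if x = y then f y \<otimes>\<^bsub>K\<^esub> k else \<zero>\<^bsub>K\<^esub>)"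
      using KG_closed[OF assms(2)] by (simp add: single_def)
  qed (use assms KG_closed[OF assms(2)] in auto)
  also have "\<dots> = f x \<otimes>\<^bsub>K\<^esub> k"
    using A assms KG_closed[OF assms(2)] by (intro K.finsum_singleton) auto
  finally show ?thesis .
qed

lemma one_eq_single: "\<one>\<^bsub>KG\<^esub> = single \<one>\<^bsub>G\<^esub> \<one>\<^bsub>K\<^esub>"
  by (intro ext) (simp add: one_apply single_def)

lemma ring_KG: "ring KG"
proof (rule ringI[OF abelian_group_KG])
  show "monoid KG"
  proof (rule monoidI)
    fix f assume f: "f \<in> carrier KG"
    show "\<one>\<^bsub>KG\<^esub> \<otimes>\<^bsub>KG\<^esub> f = f"
      using f KG_closed[OF f] by (intro KG_eqI) (auto simp: one_closed mult_closed one_eq_single single_mult_apply single_closed)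
    show "f \<otimes>\<^bsub>KG\<^esub> \<one>\<^bsub>KG\<^esub> = f"
      using f KG_closed[OF f] by (intro KG_eqI) (auto simp: one_closed mult_closed one_eq_single mult_single_one_apply single_closed)
  qed (auto simp: mult_closed one_closed mult_assoc)
next
  fix f g h assume f: "f \<in> carrier KG" and g: "g \<in> carrier KG" and h: "h \<in> carrier KG"
  have cl: "f y \<in> carrier K" "g y \<in> carrier K" "h y \<in> carrier K" for y
    using KG_closed f g h by auto
  show "(f \<oplus>\<^bsub>KG\<^esub> g) \<otimes>\<^bsub>KG\<^esub> h = f \<otimes>\<^bsub>KG\<^esub> h \<oplus>\<^bsub>KG\<^esub> g \<otimes>\<^bsub>KG\<^esub> h"
  proof (rule KG_eqI)
    fix x assume x: "x \<in> carrier G"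
    define A where "A = support f \<union> support g"
    have A: "finite A" "A \<subseteq> carrier G" "support f \<subseteq> A" "support g \<subseteq> A" "support (f \<oplus>\<^bsub>KG\<^esub> g) \<subseteq> A"
      using finite_support f g support_subset by (auto simp: A_def support_def add_apply)
    have "((f \<oplus>\<^bsub>KG\<^esub> g) \<otimes>\<^bsub>KG\<^esub> h) x = (\<Oplus>\<^bsub>K\<^esub>y\<in>A. (f y \<oplus>\<^bsub>K\<^esub> g y) \<otimes>\<^bsub>K\<^esub> h (inv\<^bsub>G\<^esub> y \<otimes>\<^bsub>G\<^esub> x))"
      using mult_apply[OF add_closed[OF f g] h A(1,2,5) x] by (simp add: add_apply)
    also have "\<dots> = (\<Oplus>\<^bsub>K\<^esub>y\<in>A. f y \<otimes>\<^bsub>K\<^esub> h (inv\<^bsub>G\<^esub> y \<otimes>\<^bsub>G\<^esub> x) \<oplus>\<^bsub>K\<^esub> g y \<otimes>\<^bsub>K\<^esub> h (inv\<^bsub>G\<^esub> y \<otimes>\<^bsub>G\<^esub> x))"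
      using cl by (simp add: K.l_distr)
    also have "\<dots> = (f \<otimes>\<^bsub>KG\<^esub> h \<oplus>\<^bsub>KG\<^esub> g \<otimes>\<^bsub>KG\<^esub> h) x"
      using cl by (simp add: add_apply mult_apply[OF f h A(1,2,3) x] mult_apply[OF g h A(1,2,4) x] K.finsum_addf Pi_iff)
    finally show "((f \<oplus>\<^bsub>KG\<^esub> g) \<otimes>\<^bsub>KG\<^esub> h) x = (f \<otimes>\<^bsub>KG\<^esub> h \<oplus>\<^bsub>KG\<^esub> g \<otimes>\<^bsub>KG\<^esub> h) x" .
  qed (use f g h in \<open>auto intro!: mult_closed add_closed\<close>)
  show "h \<otimes>\<^bsub>KG\<^esub> (f \<oplus>\<^bsub>KG\<^esub> g) = h \<otimes>\<^bsub>KG\<^esub> f \<oplus>\<^bsub>KG\<^esub> h \<otimes>\<^bsub>KG\<^esub> g"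
  proof (rule KG_eqI)
    fix x assume x: "x \<in> carrier G"
    note A = finite_support[OF h] support_subset subset_refl x
    show "(h \<otimes>\<^bsub>KG\<^esub> (f \<oplus>\<^bsub>KG\<^esub> g)) x = (h \<otimes>\<^bsub>KG\<^esub> f \<oplus>\<^bsub>KG\<^esub> h \<otimes>\<^bsub>KG\<^esub> g) x"
      using cl by (simp add: add_apply mult_apply[OF h f A] mult_apply[OF h g A]
          mult_apply[OF h add_closed[OF f g] A] K.r_distr K.finsum_addf Pi_iff)
  qed (use f g h in \<open>auto intro!: mult_closed add_closed\<close>)
qed

end

section \<open>Minimal non-commuting pairs\<close>

context group
begin

text \<open>Used in contrapositive form, like the next two lemmas: Nielsen moves on a pair preserve
  that it does not commute.\<close>

lemma commute_if_quotient_commutes_left: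
  assumes "a \<in> carrier G" "b \<in> carrier G" "a \<otimes> (inv a \<otimes> b) = (inv a \<otimes> b) \<otimes> a"
  shows "a \<otimes> b = b \<otimes> a"
proof -
  have "a \<otimes> b = a \<otimes> (a \<otimes> (inv a \<otimes> b))" using assms(1,2) by (simp add: m_assoc[symmetric])
  also have "\<dots> = a \<otimes> ((inv a \<otimes> b) \<otimes> a)" by (simp only: assms(3))
  also have "\<dots> = b \<otimes> a" using assms(1,2) by (simp add: m_assoc[symmetric])
  finally show ?thesis .
qed

lemma commute_if_inverse_commutes:
  assumes "a \<in> carrier G" "b \<in> carrier G" "inv a \<otimes> b = b \<otimes> inv a"
  shows "a \<otimes> b = b \<otimes> a"
proof -
  have "b \<otimes> a = a \<otimes> (inv a \<otimes> b) \<otimes> a" using assms(1,2) by (simp add: m_assoc[symmetric])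
  also have "\<dots> = a \<otimes> (b \<otimes> inv a) \<otimes> a" by (simp only: assms(3))
  also have "\<dots> = a \<otimes> b" using assms(1,2) by (simp add: m_assoc)
  finally show ?thesis by simp
qed

lemma commute_if_quotient_commutes_right:
  assumes "a \<in> carrier G" "b \<in> carrier G" "(inv a \<otimes> b) \<otimes> b = b \<otimes> (inv a \<otimes> b)"
  shows "a \<otimes> b = b \<otimes> a"
proof (rule commute_if_inverse_commutes[OF assms(1,2)])
  have "(inv a \<otimes> b) \<otimes> b = (b \<otimes> inv a) \<otimes> b"
    using assms by (simp add: m_assoc)
  then show "inv a \<otimes> b = b \<otimes> inv a" using assms(1,2) by simp
qed

end

lemma finite_has_maximal_length:
  assumes "finite C" "C \<noteq> {}"
  shows "\<exists>c \<in> C. \<forall>c' \<in> C. length (h c') \<le> length (h c)"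
proof -
  have "Max ((\<lambda>c. length (h c)) ` C) \<in> (\<lambda>c. length (h c)) ` C"
    using assms by (intro Max_in) auto
  then obtain c where "c \<in> C" "length (h c) = Max ((\<lambda>c. length (h c)) ` C)" by auto
  then show ?thesis using assms(1) by (intro bexI[of _ c]) auto
qed

text \<open>
  A non-commuting pair of minimal total length in the image of \<open>h\<close> is Nielsen reduced enough
  for \<open>independent_powers\<close>.
\<close>
lemma reduced_pair_exists:
  assumes "group G" "h \<in> hom G (free_group S)"
    and "x0 \<in> carrier G" "y0 \<in> carrier G"
    and "h x0 \<otimes>\<^bsub>free_group S\<^esub> h y0 \<noteq> h y0 \<otimes>\<^bsub>free_group S\<^esub> h x0"
  shows "\<exists>x \<in> carrier G. \<exists>y \<in> carrier G.
    h x \<otimes>\<^bsub>free_group S\<^esub> h y \<noteq> h y \<otimes>\<^bsub>free_group S\<^esub> h x \<and>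
    (\<forall>\<alpha> \<in> {h x, inv\<^bsub>free_group S\<^esub> h x}. \<forall>\<beta> \<in> {h y, inv\<^bsub>free_group S\<^esub> h y}.
       length \<alpha> \<le> length (inv\<^bsub>free_group S\<^esub> \<alpha> \<otimes>\<^bsub>free_group S\<^esub> \<beta>) \<and>
       length \<beta> \<le> length (inv\<^bsub>free_group S\<^esub> \<alpha> \<otimes>\<^bsub>free_group S\<^esub> \<beta>))"
proof -
  interpret F: group "free_group S" by (rule group_free_group)
  interpret G: group G by fact
  interpret h: group_hom G "free_group S" h
    using assms(2) by unfold_locales
  let ?F = "free_group S"
  define P where "P p \<longleftrightarrow> fst p \<in> carrier G \<and> snd p \<in> carrier G \<and>
    h (fst p) \<otimes>\<^bsub>?F\<^esub> h (snd p) \<noteq> h (snd p) \<otimes>\<^bsub>?F\<^esub> h (fst p)" for p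
  define m where "m p = length (h (fst p)) + length (h (snd p))" for p
  have "P (x0, y0)" using assms(3-5) by (simp add: P_def)
  then obtain p where p: "P p" and min: "\<And>q. P q \<Longrightarrow> m p \<le> m q"
    using ex_has_least_nat[of P _ m] by blast
  obtain x y where xy: "p = (x, y)" by (cases p)
  have c: "x \<in> carrier G" "y \<in> carrier G" "h x \<otimes>\<^bsub>?F\<^esub> h y \<noteq> h y \<otimes>\<^bsub>?F\<^esub> h x"
    using p by (simp_all add: P_def xy)
  \<comment> \<open>Replacing either entry of a minimal pair by the quotient keeps it non-commuting,
    so the quotient cannot be shorter than the entry it replaces.\<close>
  have quotient: "length (h u) \<le> length (inv\<^bsub>?F\<^esub> h u \<otimes>\<^bsub>?F\<^esub> h v) \<and>
      length (h v) \<le> length (inv\<^bsub>?F\<^esub> h u \<otimes>\<^bsub>?F\<^esub> h v)"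
    if "P (u, v)" "m (u, v) = m p" for u v
  proof -
    have uv: "u \<in> carrier G" "v \<in> carrier G" "h u \<otimes>\<^bsub>?F\<^esub> h v \<noteq> h v \<otimes>\<^bsub>?F\<^esub> h u"
      using that(1) by (simp_all add: P_def)
    have h: "h (inv\<^bsub>G\<^esub> u \<otimes>\<^bsub>G\<^esub> v) = inv\<^bsub>?F\<^esub> h u \<otimes>\<^bsub>?F\<^esub> h v" using uv(1,2) by simp
    have "P (u, inv\<^bsub>G\<^esub> u \<otimes>\<^bsub>G\<^esub> v)"
      using uv F.commute_if_quotient_commutes_left[of "h u" "h v"] by (auto simp: P_def h)
    moreover have "P (inv\<^bsub>G\<^esub> u \<otimes>\<^bsub>G\<^esub> v, v)"
      using uv F.commute_if_quotient_commutes_right[of "h u" "h v"] by (auto simp: P_def h)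
    ultimately show ?thesis
      using min[of "(u, inv\<^bsub>G\<^esub> u \<otimes>\<^bsub>G\<^esub> v)"] min[of "(inv\<^bsub>G\<^esub> u \<otimes>\<^bsub>G\<^esub> v, v)"] that(2)
      by (simp add: m_def h)
  qed
  \<comment> \<open>Inverting an entry changes no length, so all four sign choices give minimal
    pairs and the bound holds for each.\<close>
  have len: "length (h (inv\<^bsub>G\<^esub> u)) = length (h u)" if "u \<in> carrier G" for u
    using that by (simp add: length_inv_free_group)
  have inv_l: "P (inv\<^bsub>G\<^esub> u, v)" if "P (u, v)" for u v
    using that F.commute_if_inverse_commutes[of "h u" "h v"] by (auto simp: P_def)
  have inv_r: "P (u, inv\<^bsub>G\<^esub> v)" if "P (u, v)" for u v
    using that F.commute_if_inverse_commutes[of "h v" "h u"] by (auto simp: P_def)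
  have Pxy: "P (x, y)" using p xy by simp
  note pairs = quotient[OF Pxy] quotient[OF inv_l[OF Pxy]] quotient[OF inv_r[OF Pxy]]
    quotient[OF inv_l[OF inv_r[OF Pxy]]]
  show ?thesis
    using c pairs len[OF c(1)] len[OF c(2)]
    by (intro bexI[OF _ c(1)] bexI[OF _ c(2)]) (simp add: m_def xy)
qed

section \<open>Units, scalars and independent binomials over a limit group\<close>

locale limit_group_ring = group_ring +
  assumes fully_residually_free: "fully_residually_free G"
begin

lemma injective_hom:
  assumes "finite X" "X \<subseteq> carrier G"
  obtains S :: "nat set" and h where "group_hom G (free_group S) h" "inj_on h X"
proof -
  obtain S :: "nat set" and h where h: "h \<in> hom G (free_group S)" "inj_on h X"
    using fully_residually_free assms unfolding fully_residually_free_def by blast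
  interpret F: group "free_group S" by (rule group_free_group)
  have "group_hom G (free_group S) h" using h(1) by unfold_locales
  then show ?thesis using h(2) that by blast
qed

text \<open>
  A product of maximal length under a homomorphism that is injective on all products is
  represented uniquely, so its coefficient does not vanish.
\<close>
lemma unit_support:
  assumes u: "u \<in> carrier KG" and w: "w \<in> carrier KG" and uw: "u \<otimes>\<^bsub>KG\<^esub> w = \<one>\<^bsub>KG\<^esub>"
  obtains a where "a \<in> carrier G" "support u = {a}"
proof -
  define A B where "A = support u" and "B = support w"
  have A: "finite A" "A \<subseteq> carrier G" and B: "finite B" "B \<subseteq> carrier G"
    using finite_support u w support_subset by (auto simp: A_def B_def)
  define C where "C = (\<lambda>(y, z). y \<otimes>\<^bsub>G\<^esub> z) ` (A \<times> B)"
  have C: "finite C" "C \<subseteq> carrier G" using A B by (auto simp: C_def)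
  have CI: "a \<otimes>\<^bsub>G\<^esub> b \<in> C" if "a \<in> A" "b \<in> B" for a b using that by (auto simp: C_def)
  obtain S :: "nat set" and h where "group_hom G (free_group S) h" and inj: "inj_on h (insert \<one>\<^bsub>G\<^esub> C)"
    using injective_hom[of "insert \<one>\<^bsub>G\<^esub> C"] C by blast
  then interpret h: group_hom G "free_group S" h by simp
  let ?F = "free_group S"
  have prod: "(u \<otimes>\<^bsub>KG\<^esub> w) x = (\<Oplus>\<^bsub>K\<^esub>y\<in>A. u y \<otimes>\<^bsub>K\<^esub> w (inv\<^bsub>G\<^esub> y \<otimes>\<^bsub>G\<^esub> x))" if "x \<in> carrier G" for x
    using mult_apply[OF u w A _ that] by (simp add: A_def)
  have "C \<noteq> {}"
  proof
    assume "C = {}"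
    then have "A = {} \<or> B = {}" by (auto simp: C_def)
    then have "u y = \<zero>\<^bsub>K\<^esub> \<or> w z = \<zero>\<^bsub>K\<^esub>" for y z
      using not_in_support[OF u, of y] not_in_support[OF w, of z] by (auto simp: A_def B_def)
    then have "u y \<otimes>\<^bsub>K\<^esub> w z = \<zero>\<^bsub>K\<^esub>" for y z
      using KG_closed[OF u, of y] KG_closed[OF w, of z] by (metis K.l_null K.r_null)
    then have "(u \<otimes>\<^bsub>KG\<^esub> w) \<one>\<^bsub>G\<^esub> = \<zero>\<^bsub>K\<^esub>" using prod by simp
    then show False using uw by (simp add: one_apply)
  qed
  then obtain c where c: "c \<in> C" and max: "\<And>c'. c' \<in> C \<Longrightarrow> length (h c') \<le> length (h c)"
    using finite_has_maximal_length[OF C(1), of h] by blast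
  then obtain a b where ab: "a \<in> A" "b \<in> B" "c = a \<otimes>\<^bsub>G\<^esub> b" by (auto simp: C_def)
  have abc: "a \<in> carrier G" "b \<in> carrier G" "c \<in> carrier G" using ab A B by auto
  have unique: "a' = a" if a': "a' \<in> A" "inv\<^bsub>G\<^esub> a' \<otimes>\<^bsub>G\<^esub> c \<in> B" for a'
  proof (rule ccontr)
    assume neq: "a' \<noteq> a"
    define b' where "b' = inv\<^bsub>G\<^esub> a' \<otimes>\<^bsub>G\<^esub> c"
    have c': "a' \<in> carrier G" "b' \<in> carrier G" using a' A B by (auto simp: b'_def)
    have cb': "c = a' \<otimes>\<^bsub>G\<^esub> b'" using c' abc by (simp add: b'_def G.m_assoc[symmetric])
    \<comment> \<open>With a second factorization \<open>c = a' b'\<close>, the crossed products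
      \<open>a b'\<close> and \<open>a' b\<close> are \<open>g c\<close> and \<open>g^-1 c\<close>.
      Both lie in \<open>C\<close>, but one of them has a longer image than
      \<open>c\<close>.\<close>
    define g where "g = a \<otimes>\<^bsub>G\<^esub> inv\<^bsub>G\<^esub> a'"
    have g: "g \<in> carrier G" using abc c' by (simp add: g_def)
    have "a \<otimes>\<^bsub>G\<^esub> b' = g \<otimes>\<^bsub>G\<^esub> c"
      using abc(1,3) c'(1) by (simp add: g_def b'_def G.m_assoc)
    moreover have "a' \<otimes>\<^bsub>G\<^esub> b = inv\<^bsub>G\<^esub> g \<otimes>\<^bsub>G\<^esub> c"
    proof -
      have "inv\<^bsub>G\<^esub> g \<otimes>\<^bsub>G\<^esub> c = a' \<otimes>\<^bsub>G\<^esub> (inv\<^bsub>G\<^esub> a \<otimes>\<^bsub>G\<^esub> (a \<otimes>\<^bsub>G\<^esub> b))"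
        using abc(1,2) c'(1) by (simp add: g_def G.inv_mult_group G.m_assoc ab(3))
      also have "inv\<^bsub>G\<^esub> a \<otimes>\<^bsub>G\<^esub> (a \<otimes>\<^bsub>G\<^esub> b) = b" using abc(1,2) by (simp add: G.m_assoc[symmetric])
      finally show ?thesis by simp
    qed
    moreover have b'B: "b' \<in> B" using a' by (simp add: b'_def)
    ultimately have gc: "g \<otimes>\<^bsub>G\<^esub> c \<in> C" "inv\<^bsub>G\<^esub> g \<otimes>\<^bsub>G\<^esub> c \<in> C"
      using CI[OF ab(1) b'B] CI[OF a'(1) ab(2)] by simp_all
    have "h g \<noteq> \<one>\<^bsub>?F\<^esub>"
    proof
      assume "h g = \<one>\<^bsub>?F\<^esub>"
      then have "h (g \<otimes>\<^bsub>G\<^esub> c) = h c" using g abc by simp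
      then have "g \<otimes>\<^bsub>G\<^esub> c = c" using inj gc(1) c by (auto dest: inj_onD)
      then have "g = \<one>\<^bsub>G\<^esub>" using g abc(3) by (metis G.r_cancel_one')
      then have "a = a'" using abc c' by (metis G.inv_equality G.inv_inv G.inv_closed g_def)
      then show False using neq by simp
    qed
    then have "length (h c) < length (h g \<otimes>\<^bsub>?F\<^esub> h c) \<or> length (h c) < length (inv\<^bsub>?F\<^esub> h g \<otimes>\<^bsub>?F\<^esub> h c)"
      using g abc(3) by (intro length_mult_increases) auto
    then show False using max[OF gc(1)] max[OF gc(2)] g abc(3) by auto
  qed
  have "(u \<otimes>\<^bsub>KG\<^esub> w) c = (\<Oplus>\<^bsub>K\<^esub>y\<in>A. if a = y then u y \<otimes>\<^bsub>K\<^esub> w (inv\<^bsub>G\<^esub> y \<otimes>\<^bsub>G\<^esub> c) else \<zero>\<^bsub>K\<^esub>)"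
    unfolding prod[OF abc(3)]
  proof (rule K.finsum_cong')
    fix y assume y: "y \<in> A"
    have "w (inv\<^bsub>G\<^esub> y \<otimes>\<^bsub>G\<^esub> c) = \<zero>\<^bsub>K\<^esub>" if "a \<noteq> y"
      using unique[OF y] that not_in_support[OF w] by (auto simp: B_def)
    then show "u y \<otimes>\<^bsub>K\<^esub> w (inv\<^bsub>G\<^esub> y \<otimes>\<^bsub>G\<^esub> c) =
        (if a = y then u y \<otimes>\<^bsub>K\<^esub> w (inv\<^bsub>G\<^esub> y \<otimes>\<^bsub>G\<^esub> c) else \<zero>\<^bsub>K\<^esub>)"
      using KG_closed[OF u] by simp
  qed (use KG_closed[OF u] KG_closed[OF w] in auto)
  also have "\<dots> = u a \<otimes>\<^bsub>K\<^esub> w (inv\<^bsub>G\<^esub> a \<otimes>\<^bsub>G\<^esub> c)"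
    using A(1) ab(1) KG_closed[OF u] KG_closed[OF w] by (intro K.finsum_singleton) auto
  also have "inv\<^bsub>G\<^esub> a \<otimes>\<^bsub>G\<^esub> c = b" using abc ab(3) by (simp add: G.m_assoc[symmetric])
  finally have "(u \<otimes>\<^bsub>KG\<^esub> w) c = u a \<otimes>\<^bsub>K\<^esub> w b" .
  moreover have "u a \<otimes>\<^bsub>K\<^esub> w b \<noteq> \<zero>\<^bsub>K\<^esub>"
    using ab(1,2) KG_closed[OF u] KG_closed[OF w] by (auto simp: A_def B_def support_def K.integral_iff)
  ultimately have "c = \<one>\<^bsub>G\<^esub>" using uw by (auto simp: one_apply split: if_splits)
  \<comment> \<open>The longest product is the identity, so all products have images of length 0.
    Since \<open>h\<close> is injective on \<open>C\<close> with the identity added, they are all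
    equal to the identity, and cancelling \<open>b\<close> leaves one element in
    \<open>A\<close>.\<close>
  then have "h c' = h \<one>\<^bsub>G\<^esub>" if "c' \<in> C" for c'
    using max[OF that] by (simp add: free_group_simps)
  then have C1: "c' = \<one>\<^bsub>G\<^esub>" if "c' \<in> C" for c'
    using inj_onD[OF inj, of c' "\<one>\<^bsub>G\<^esub>"] that by simp
  have "a' = a" if a': "a' \<in> A" for a'
  proof -
    have "a' \<otimes>\<^bsub>G\<^esub> b = a \<otimes>\<^bsub>G\<^esub> b" using C1[OF CI[OF a' ab(2)]] C1[OF CI[OF ab(1,2)]] by simp
    then show ?thesis using a' A abc by (metis G.right_cancel subsetD)
  qed
  then have "A = {a}" using ab(1) by blast
  then have "support u = {a}" by (simp only: A_def)
  then show ?thesis using that abc(1) by blast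
qed

lemma single_if_unit:
  assumes u: "u \<in> carrier KG" and w: "w \<in> carrier KG" "u \<otimes>\<^bsub>KG\<^esub> w = \<one>\<^bsub>KG\<^esub>"
  shows "\<exists>a \<in> carrier G. \<exists>k \<in> carrier K. k \<noteq> \<zero>\<^bsub>K\<^esub> \<and> u = single a k"
proof -
  obtain a where a: "a \<in> carrier G" "support u = {a}" using unit_support[OF u w] by blast
  have "u = single a (u a)"
  proof
    fix x show "u x = single a (u a) x"
      using not_in_support[OF u, of x] a(2) by (auto simp: single_def)
  qed
  moreover have "u a \<noteq> \<zero>\<^bsub>K\<^esub>" using a(2) by (auto simp: support_def)
  ultimately show ?thesis using a(1) KG_closed[OF u] by blast
qed

lemma single_mult_single:
  assumes "a \<in> carrier G" "b \<in> carrier G" "k \<in> carrier K" "l \<in> carrier K"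
  shows "single a k \<otimes>\<^bsub>KG\<^esub> single b l = single (a \<otimes>\<^bsub>G\<^esub> b) (k \<otimes>\<^bsub>K\<^esub> l)"
proof (rule KG_eqI)
  fix x assume x: "x \<in> carrier G"
  have "inv\<^bsub>G\<^esub> a \<otimes>\<^bsub>G\<^esub> x = b \<longleftrightarrow> x = a \<otimes>\<^bsub>G\<^esub> b"
    using assms(1,2) x by (metis G.inv_solve_left)
  then show "(single a k \<otimes>\<^bsub>KG\<^esub> single b l) x = single (a \<otimes>\<^bsub>G\<^esub> b) (k \<otimes>\<^bsub>K\<^esub> l) x"
    using assms x by (simp add: single_mult_apply single_closed) (simp add: single_def)
qed (use assms in \<open>auto intro!: mult_closed single_closed\<close>)

text \<open>Units are monomials \<open>k g\<close>. For \<open>g\<close> other than the identity,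
  \<open>k g + 1\<close> has two points in its support and is no unit; for constants the two
  conditions only exclude 0 and -1.\<close>

lemma scalar_iff:
  "scalar KG u \<longleftrightarrow> (\<exists>k \<in> carrier K. k \<noteq> \<zero>\<^bsub>K\<^esub> \<and> k \<oplus>\<^bsub>K\<^esub> \<one>\<^bsub>K\<^esub> \<noteq> \<zero>\<^bsub>K\<^esub> \<and> u = single \<one>\<^bsub>G\<^esub> k)"
proof
  have plus_one: "single \<one>\<^bsub>G\<^esub> k \<oplus>\<^bsub>KG\<^esub> \<one>\<^bsub>KG\<^esub> = single \<one>\<^bsub>G\<^esub> (k \<oplus>\<^bsub>K\<^esub> \<one>\<^bsub>K\<^esub>)" if "k \<in> carrier K" for k
    by (intro ext) (simp add: add_apply one_apply single_def)
  {
    assume "scalar KG u"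
    then obtain w w' where u: "u \<in> carrier KG" and w: "w \<in> carrier KG" "u \<otimes>\<^bsub>KG\<^esub> w = \<one>\<^bsub>KG\<^esub>"
      and w': "w' \<in> carrier KG" "(u \<oplus>\<^bsub>KG\<^esub> \<one>\<^bsub>KG\<^esub>) \<otimes>\<^bsub>KG\<^esub> w' = \<one>\<^bsub>KG\<^esub>"
      unfolding scalar_def by blast
    obtain a k where a: "a \<in> carrier G" "k \<in> carrier K" "k \<noteq> \<zero>\<^bsub>K\<^esub>" "u = single a k"
      using single_if_unit[OF u w] by blast
    obtain b l where b: "b \<in> carrier G" "l \<in> carrier K" "l \<noteq> \<zero>\<^bsub>K\<^esub>" "u \<oplus>\<^bsub>KG\<^esub> \<one>\<^bsub>KG\<^esub> = single b l"
      using single_if_unit[OF add_closed[OF u one_closed] w'] by blast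
    have eq: "u x \<oplus>\<^bsub>K\<^esub> \<one>\<^bsub>KG\<^esub> x = single b l x" for x
      using fun_cong[OF b(4), of x] by (simp add: add_apply)
    have "a = \<one>\<^bsub>G\<^esub>"
    proof (rule ccontr)
      assume "a \<noteq> \<one>\<^bsub>G\<^esub>"
      then have "single b l a = k" "single b l \<one>\<^bsub>G\<^esub> = \<one>\<^bsub>K\<^esub>"
        using eq[of a] eq[of "\<one>\<^bsub>G\<^esub>"] a(2) unfolding a(4) by (simp_all add: single_def one_apply)
      then have "b = a" "b = \<one>\<^bsub>G\<^esub>" using a(3) by (auto simp: single_def split: if_splits)
      then show False using \<open>a \<noteq> \<one>\<^bsub>G\<^esub>\<close> by simp
    qed
    moreover have "k \<oplus>\<^bsub>K\<^esub> \<one>\<^bsub>K\<^esub> \<noteq> \<zero>\<^bsub>K\<^esub>"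
    proof
      assume "k \<oplus>\<^bsub>K\<^esub> \<one>\<^bsub>K\<^esub> = \<zero>\<^bsub>K\<^esub>"
      then have "single b l = single \<one>\<^bsub>G\<^esub> \<zero>\<^bsub>K\<^esub>"
        using plus_one[OF a(2)] b(4) a(4) \<open>a = \<one>\<^bsub>G\<^esub>\<close> by simp
      from fun_cong[OF this, of b] show False using b(3) by (simp add: single_def split: if_splits)
    qed
    ultimately show "\<exists>k \<in> carrier K. k \<noteq> \<zero>\<^bsub>K\<^esub> \<and> k \<oplus>\<^bsub>K\<^esub> \<one>\<^bsub>K\<^esub> \<noteq> \<zero>\<^bsub>K\<^esub> \<and> u = single \<one>\<^bsub>G\<^esub> k"
      using a(2-4) by blast
  }
  have unit: "\<exists>w \<in> carrier KG. single \<one>\<^bsub>G\<^esub> k \<otimes>\<^bsub>KG\<^esub> w = \<one>\<^bsub>KG\<^esub>" if "k \<in> carrier K" "k \<noteq> \<zero>\<^bsub>K\<^esub>" for k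
    using that K.field_Units
    by (intro bexI[of _ "single \<one>\<^bsub>G\<^esub> (inv\<^bsub>K\<^esub> k)"])
      (auto simp: single_mult_single one_eq_single intro!: single_closed)
  assume "\<exists>k \<in> carrier K. k \<noteq> \<zero>\<^bsub>K\<^esub> \<and> k \<oplus>\<^bsub>K\<^esub> \<one>\<^bsub>K\<^esub> \<noteq> \<zero>\<^bsub>K\<^esub> \<and> u = single \<one>\<^bsub>G\<^esub> k"
  then show "scalar KG u"
    unfolding scalar_def using unit plus_one by (auto intro: single_closed)
qed

lemma single_one_central:
  "k \<in> carrier K \<Longrightarrow> f \<in> carrier KG \<Longrightarrow> single \<one>\<^bsub>G\<^esub> k \<otimes>\<^bsub>KG\<^esub> f = f \<otimes>\<^bsub>KG\<^esub> single \<one>\<^bsub>G\<^esub> k"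
  by (rule KG_eqI)
    (auto simp: single_mult_apply mult_single_one_apply KG_closed K.m_comm intro!: mult_closed single_closed)

lemma minus_apply:
  assumes "f \<in> carrier KG" "g \<in> carrier KG"
  shows "(f \<ominus>\<^bsub>KG\<^esub> g) x = f x \<ominus>\<^bsub>K\<^esub> g x"
proof -
  interpret R: ring KG by (rule ring_KG)
  have "(f \<ominus>\<^bsub>KG\<^esub> g) x \<oplus>\<^bsub>K\<^esub> g x = (f \<ominus>\<^bsub>KG\<^esub> g \<oplus>\<^bsub>KG\<^esub> g) x" by (simp add: add_apply)
  also have "f \<ominus>\<^bsub>KG\<^esub> g \<oplus>\<^bsub>KG\<^esub> g = f"
    by (rule iffD2[OF R.add_eq_iff_eq_minus refl]) (use assms in auto)
  finally show ?thesis
    using assms by (intro iffD1[OF K.add_eq_iff_eq_minus] KG_closed R.minus_closed)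
qed

lemma single_one_unit:
  assumes "k \<in> Units K"
  shows "single \<one>\<^bsub>G\<^esub> k \<in> Units KG"
proof -
  have k: "k \<in> carrier K" "inv\<^bsub>K\<^esub> k \<in> carrier K" using assms by auto
  have "single \<one>\<^bsub>G\<^esub> (inv\<^bsub>K\<^esub> k) \<otimes>\<^bsub>KG\<^esub> single \<one>\<^bsub>G\<^esub> k = \<one>\<^bsub>KG\<^esub>"
    "single \<one>\<^bsub>G\<^esub> k \<otimes>\<^bsub>KG\<^esub> single \<one>\<^bsub>G\<^esub> (inv\<^bsub>K\<^esub> k) = \<one>\<^bsub>KG\<^esub>"
    using k assms by (simp_all add: single_mult_single one_eq_single)
  then show ?thesis
    unfolding Units_def[of KG] using k single_closed by blast
qed

lemma scalar_minus_unit: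
  assumes "scalar KG u" "scalar KG v" "u \<noteq> v"
  shows "u \<ominus>\<^bsub>KG\<^esub> v \<in> Units KG"
proof -
  obtain k l where k: "k \<in> carrier K" "u = single \<one>\<^bsub>G\<^esub> k" and l: "l \<in> carrier K" "v = single \<one>\<^bsub>G\<^esub> l"
    using assms by (auto simp: scalar_iff)
  have "u \<ominus>\<^bsub>KG\<^esub> v = single \<one>\<^bsub>G\<^esub> (k \<ominus>\<^bsub>K\<^esub> l)"
    using k l by (intro ext) (simp add: minus_apply single_closed, simp add: single_def K.minus_eq)
  moreover have "k \<ominus>\<^bsub>K\<^esub> l \<noteq> \<zero>\<^bsub>K\<^esub>" using assms(3) k l K.eq_if_minus_eq_zero by blast
  then have "k \<ominus>\<^bsub>K\<^esub> l \<in> Units K" using k l K.field_Units by simp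
  then have "single \<one>\<^bsub>G\<^esub> (k \<ominus>\<^bsub>K\<^esub> l) \<in> Units KG" by (rule single_one_unit)
  ultimately show ?thesis by simp
qed

lemma infinite_scalars:
  assumes "infinite (carrier K)"
  shows "infinite (Collect (scalar KG))"
proof
  assume fin: "finite (Collect (scalar KG))"
  let ?X = "carrier K - {\<zero>\<^bsub>K\<^esub>, \<ominus>\<^bsub>K\<^esub> \<one>\<^bsub>K\<^esub>}"
  have "scalar KG (single \<one>\<^bsub>G\<^esub> k)" if k: "k \<in> ?X" for k
  proof -
    have "k \<oplus>\<^bsub>K\<^esub> \<one>\<^bsub>K\<^esub> \<noteq> \<zero>\<^bsub>K\<^esub>" using K.minus_equality[of k "\<one>\<^bsub>K\<^esub>"] k by auto
    then show ?thesis unfolding scalar_iff using k by blast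
  qed
  then have "single \<one>\<^bsub>G\<^esub> ` ?X \<subseteq> Collect (scalar KG)" by blast
  then have "finite (single \<one>\<^bsub>G\<^esub> ` ?X)" using fin finite_subset by blast
  moreover have "inj_on (single \<one>\<^bsub>G\<^esub>) ?X"
    by (intro inj_onI) (metis single_def)
  ultimately have "finite ?X" by (rule finite_imageD)
  then show False using assms by simp
qed

lemma binomial_mult_apply:
  assumes "a \<in> carrier G" "k \<in> carrier K" "u \<in> carrier KG" "x \<in> carrier G"
  shows "((single a \<one>\<^bsub>K\<^esub> \<ominus>\<^bsub>KG\<^esub> single \<one>\<^bsub>G\<^esub> k) \<otimes>\<^bsub>KG\<^esub> u) x =
    u (inv\<^bsub>G\<^esub> a \<otimes>\<^bsub>G\<^esub> x) \<ominus>\<^bsub>K\<^esub> k \<otimes>\<^bsub>K\<^esub> u x"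
proof -
  interpret R: ring KG by (rule ring_KG)
  have s: "single a \<one>\<^bsub>K\<^esub> \<in> carrier KG" "single \<one>\<^bsub>G\<^esub> k \<in> carrier KG"
    using assms by (auto intro: single_closed)
  have "(single a \<one>\<^bsub>K\<^esub> \<ominus>\<^bsub>KG\<^esub> single \<one>\<^bsub>G\<^esub> k) \<otimes>\<^bsub>KG\<^esub> u =
      single a \<one>\<^bsub>K\<^esub> \<otimes>\<^bsub>KG\<^esub> u \<ominus>\<^bsub>KG\<^esub> single \<one>\<^bsub>G\<^esub> k \<otimes>\<^bsub>KG\<^esub> u"
    using s assms(3) by algebra
  then show ?thesis
    using assms s KG_closed[OF assms(3)] by (simp add: minus_apply mult_closed single_mult_apply)
qed

text \<open>A finite support misses some point of the infinite ray \<open>a^n y\<close>, and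
  \<open>step\<close> carries the zero from there back to \<open>y\<close>.\<close>

lemma vanishes_on_ray:
  assumes u: "u \<in> carrier KG" and y: "y \<in> carrier G"
    and a: "a \<in> carrier G" "inj (\<lambda>n::nat. a [^]\<^bsub>G\<^esub> n)"
    and step: "\<And>n::nat. u (a [^]\<^bsub>G\<^esub> Suc n \<otimes>\<^bsub>G\<^esub> y) = \<zero>\<^bsub>K\<^esub> \<Longrightarrow> u (a [^]\<^bsub>G\<^esub> n \<otimes>\<^bsub>G\<^esub> y) = \<zero>\<^bsub>K\<^esub>"
  shows "u y = \<zero>\<^bsub>K\<^esub>"
proof -
  have "inj (\<lambda>n::nat. a [^]\<^bsub>G\<^esub> n \<otimes>\<^bsub>G\<^esub> y)"
    using a y by (auto simp: inj_on_def)
  then have "infinite (range (\<lambda>n::nat. a [^]\<^bsub>G\<^esub> n \<otimes>\<^bsub>G\<^esub> y))"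
    using finite_imageD infinite_UNIV_char_0 by blast
  then have "\<not> range (\<lambda>n::nat. a [^]\<^bsub>G\<^esub> n \<otimes>\<^bsub>G\<^esub> y) \<subseteq> support u"
    using finite_support[OF u] finite_subset by blast
  then obtain n :: nat where "a [^]\<^bsub>G\<^esub> n \<otimes>\<^bsub>G\<^esub> y \<notin> support u" by blast
  then have "u (a [^]\<^bsub>G\<^esub> n \<otimes>\<^bsub>G\<^esub> y) = \<zero>\<^bsub>K\<^esub>" by (rule not_in_support[OF u])
  then have "u (a [^]\<^bsub>G\<^esub> (0::nat) \<otimes>\<^bsub>G\<^esub> y) = \<zero>\<^bsub>K\<^esub>"
  proof (induction n)
    case (Suc n)
    then show ?case using step by blast
  qed
  then show ?thesis using y by simp
qed

text \<open>A zero product means \<open>u (a^n y) = k u (a^(n+1) y)\<close>, so zeros propagate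
  backwards along every ray.\<close>

lemma binomial_factor_zero:
  assumes a: "a \<in> carrier G" "inj (\<lambda>n::nat. a [^]\<^bsub>G\<^esub> n)"
    and k: "k \<in> carrier K" and u: "u \<in> carrier KG"
    and zero: "(single a \<one>\<^bsub>K\<^esub> \<ominus>\<^bsub>KG\<^esub> single \<one>\<^bsub>G\<^esub> k) \<otimes>\<^bsub>KG\<^esub> u = \<zero>\<^bsub>KG\<^esub>"
  shows "u = \<zero>\<^bsub>KG\<^esub>"
proof (rule KG_eqI[OF u zero_closed])
  fix y assume y: "y \<in> carrier G"
  show "u y = \<zero>\<^bsub>KG\<^esub> y"
    unfolding zero_apply
  proof (rule vanishes_on_ray[OF u y a])
    fix n :: nat
    have "inv\<^bsub>G\<^esub> a \<otimes>\<^bsub>G\<^esub> (a [^]\<^bsub>G\<^esub> Suc n \<otimes>\<^bsub>G\<^esub> y) = a [^]\<^bsub>G\<^esub> n \<otimes>\<^bsub>G\<^esub> y"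
      using a(1) y by (simp only: G.nat_pow_Suc2) (simp add: G.m_assoc[symmetric])
    then have "u (a [^]\<^bsub>G\<^esub> n \<otimes>\<^bsub>G\<^esub> y) \<ominus>\<^bsub>K\<^esub> k \<otimes>\<^bsub>K\<^esub> u (a [^]\<^bsub>G\<^esub> Suc n \<otimes>\<^bsub>G\<^esub> y) = \<zero>\<^bsub>K\<^esub>"
      using binomial_mult_apply[OF a(1) k u, of "a [^]\<^bsub>G\<^esub> Suc n \<otimes>\<^bsub>G\<^esub> y"] a(1) y
      by (simp add: zero zero_apply del: G.nat_pow_Suc)
    then show "u (a [^]\<^bsub>G\<^esub> n \<otimes>\<^bsub>G\<^esub> y) = \<zero>\<^bsub>K\<^esub>" if "u (a [^]\<^bsub>G\<^esub> Suc n \<otimes>\<^bsub>G\<^esub> y) = \<zero>\<^bsub>K\<^esub>"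
      using that k KG_closed[OF u] by (simp add: K.minus_eq del: G.nat_pow_Suc)
  qed
qed

text \<open>
  A single point \<open>y\<close> of the support on its \<open>\<langle>a\<rangle>\<close>-orbit would force the finitely supported
  \<open>u\<close> to be geometric on both rays of the orbit, hence zero.
\<close>
lemma binomial_multiple_support:
  assumes a: "a \<in> carrier G" "inj (\<lambda>n::nat. a [^]\<^bsub>G\<^esub> n)"
    and k: "k \<in> carrier K" "k \<noteq> \<zero>\<^bsub>K\<^esub>" and u: "u \<in> carrier KG" and y: "y \<in> carrier G"
    and f: "f = (single a \<one>\<^bsub>K\<^esub> \<ominus>\<^bsub>KG\<^esub> single \<one>\<^bsub>G\<^esub> k) \<otimes>\<^bsub>KG\<^esub> u" and fy: "f y \<noteq> \<zero>\<^bsub>K\<^esub>"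
  shows "\<exists>n::nat. n > 0 \<and>
    (f (a [^]\<^bsub>G\<^esub> n \<otimes>\<^bsub>G\<^esub> y) \<noteq> \<zero>\<^bsub>K\<^esub> \<or> f (inv\<^bsub>G\<^esub> (a [^]\<^bsub>G\<^esub> n) \<otimes>\<^bsub>G\<^esub> y) \<noteq> \<zero>\<^bsub>K\<^esub>)"
proof (rule ccontr)
  assume "\<not> ?thesis"
  then have vanish: "f (a [^]\<^bsub>G\<^esub> n \<otimes>\<^bsub>G\<^esub> y) = \<zero>\<^bsub>K\<^esub>" "f (inv\<^bsub>G\<^esub> (a [^]\<^bsub>G\<^esub> n) \<otimes>\<^bsub>G\<^esub> y) = \<zero>\<^bsub>K\<^esub>"
    if "n > 0" for n :: nat
    using that by blast+
  have f_apply: "f x = u (inv\<^bsub>G\<^esub> a \<otimes>\<^bsub>G\<^esub> x) \<ominus>\<^bsub>K\<^esub> k \<otimes>\<^bsub>K\<^esub> u x" if "x \<in> carrier G" for x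
    unfolding f using binomial_mult_apply[OF a(1) k(1) u that] .
  have uc: "u x \<in> carrier K" for x using KG_closed[OF u] .
  have "u y = \<zero>\<^bsub>K\<^esub>"
  proof (rule vanishes_on_ray[OF u y a])
    fix n :: nat
    have "inv\<^bsub>G\<^esub> a \<otimes>\<^bsub>G\<^esub> (a [^]\<^bsub>G\<^esub> Suc n \<otimes>\<^bsub>G\<^esub> y) = a [^]\<^bsub>G\<^esub> n \<otimes>\<^bsub>G\<^esub> y"
      using a(1) y by (simp only: G.nat_pow_Suc2) (simp add: G.m_assoc[symmetric])
    then have "u (a [^]\<^bsub>G\<^esub> n \<otimes>\<^bsub>G\<^esub> y) \<ominus>\<^bsub>K\<^esub> k \<otimes>\<^bsub>K\<^esub> u (a [^]\<^bsub>G\<^esub> Suc n \<otimes>\<^bsub>G\<^esub> y) = \<zero>\<^bsub>K\<^esub>"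
      using f_apply[of "a [^]\<^bsub>G\<^esub> Suc n \<otimes>\<^bsub>G\<^esub> y"] vanish(1)[of "Suc n"] a(1) y
      by (simp del: G.nat_pow_Suc)
    then show "u (a [^]\<^bsub>G\<^esub> n \<otimes>\<^bsub>G\<^esub> y) = \<zero>\<^bsub>K\<^esub>" if "u (a [^]\<^bsub>G\<^esub> Suc n \<otimes>\<^bsub>G\<^esub> y) = \<zero>\<^bsub>K\<^esub>"
      using that k uc by (simp add: K.minus_eq del: G.nat_pow_Suc)
  qed
  \<comment> \<open>On the opposite ray the recurrence is \<open>u (a^-1 x) = k u x\<close>, so
    carrying a zero back towards \<open>y\<close> divides by \<open>k\<close>. The ray starts at
    \<open>a^-1 y\<close>, because \<open>f y\<close> is built from \<open>u y\<close> and this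
    value.\<close>
  moreover have "u (inv\<^bsub>G\<^esub> a \<otimes>\<^bsub>G\<^esub> y) = \<zero>\<^bsub>K\<^esub>"
  proof (rule vanishes_on_ray[OF u])
    show "inj (\<lambda>n::nat. inv\<^bsub>G\<^esub> a [^]\<^bsub>G\<^esub> n)"
      using a by (auto simp: inj_on_def G.nat_pow_inv)
    fix n :: nat
    define x where "x = inv\<^bsub>G\<^esub> a [^]\<^bsub>G\<^esub> n \<otimes>\<^bsub>G\<^esub> (inv\<^bsub>G\<^esub> a \<otimes>\<^bsub>G\<^esub> y)"
    have x: "x \<in> carrier G" using a(1) y by (simp add: x_def)
    have "x = inv\<^bsub>G\<^esub> a [^]\<^bsub>G\<^esub> Suc n \<otimes>\<^bsub>G\<^esub> y"
      using a(1) y by (simp add: x_def G.m_assoc)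
    also have "\<dots> = inv\<^bsub>G\<^esub> (a [^]\<^bsub>G\<^esub> Suc n) \<otimes>\<^bsub>G\<^esub> y"
      using a(1) by (simp only: G.nat_pow_inv)
    finally have "x = inv\<^bsub>G\<^esub> (a [^]\<^bsub>G\<^esub> Suc n) \<otimes>\<^bsub>G\<^esub> y" .
    then have "f x = \<zero>\<^bsub>K\<^esub>" using vanish(2)[of "Suc n"] by simp
    then have zero: "u (inv\<^bsub>G\<^esub> a \<otimes>\<^bsub>G\<^esub> x) \<ominus>\<^bsub>K\<^esub> k \<otimes>\<^bsub>K\<^esub> u x = \<zero>\<^bsub>K\<^esub>" using f_apply[OF x] by simp
    have shift: "inv\<^bsub>G\<^esub> a [^]\<^bsub>G\<^esub> Suc n \<otimes>\<^bsub>G\<^esub> (inv\<^bsub>G\<^esub> a \<otimes>\<^bsub>G\<^esub> y) = inv\<^bsub>G\<^esub> a \<otimes>\<^bsub>G\<^esub> x"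
      unfolding x_def using a(1) y by (simp only: G.nat_pow_Suc2 G.inv_closed) (simp add: G.m_assoc)
    show "u x = \<zero>\<^bsub>K\<^esub>" if "u (inv\<^bsub>G\<^esub> a [^]\<^bsub>G\<^esub> Suc n \<otimes>\<^bsub>G\<^esub> (inv\<^bsub>G\<^esub> a \<otimes>\<^bsub>G\<^esub> y)) = \<zero>\<^bsub>K\<^esub>"
    proof -
      have "k \<otimes>\<^bsub>K\<^esub> u x = \<zero>\<^bsub>K\<^esub>"
        using K.eq_if_minus_eq_zero[OF zero] that uc k(1) unfolding shift by simp
      then show ?thesis using k uc K.integral by blast
    qed
  qed (use a(1) y in auto)
  ultimately show False
    using fy f_apply[OF y] k(1) by (simp add: K.minus_eq)
qed

end

context limit_group_ring
begin

text \<open>By \<open>binomial_multiple_support\<close> the orbit of \<open>z\<close> under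
  \<open>T\<close> meets the support again, at a point that is no longer than \<open>z\<close>. As
  \<open>T\<close> is a square, that point is reached by an exponent \<open>2 n\<close> of
  \<open>x\<close>; the sign of the power decides between \<open>h x\<close> and its
  inverse.\<close>

lemma shortening_power:
  assumes h: "group_hom G (free_group S) h" and x: "x \<in> carrier G"
    and T: "T = x [^]\<^bsub>G\<^esub> (2::nat)" "inj (\<lambda>n::nat. T [^]\<^bsub>G\<^esub> n)"
    and k: "k \<in> carrier K" "k \<noteq> \<zero>\<^bsub>K\<^esub>" and u: "u \<in> carrier KG"
    and f: "f = (single T \<one>\<^bsub>K\<^esub> \<ominus>\<^bsub>KG\<^esub> single \<one>\<^bsub>G\<^esub> k) \<otimes>\<^bsub>KG\<^esub> u"
    and z: "z \<in> support f" and max: "\<And>z'. z' \<in> support f \<Longrightarrow> length (h z') \<le> length (h z)"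
  shows "\<exists>\<alpha> \<in> {h x, inv\<^bsub>free_group S\<^esub> h x}. \<exists>i \<ge> (2::nat).
    length (inv\<^bsub>free_group S\<^esub> (\<alpha> [^]\<^bsub>free_group S\<^esub> i) \<otimes>\<^bsub>free_group S\<^esub> h z) \<le> length (h z)"
proof -
  interpret h: group_hom G "free_group S" h by (rule h)
  have zc: "z \<in> carrier G" "f z \<noteq> \<zero>\<^bsub>K\<^esub>" using z by (auto simp: support_def)
  have Tc: "T \<in> carrier G" using x T(1) by simp
  have pow: "h (T [^]\<^bsub>G\<^esub> n) = h x [^]\<^bsub>free_group S\<^esub> (2 * n)" for n :: nat
    using x by (simp add: T(1) G.nat_pow_pow h.hom_nat_pow)
  obtain n :: nat where n: "n > 0"
    "f (T [^]\<^bsub>G\<^esub> n \<otimes>\<^bsub>G\<^esub> z) \<noteq> \<zero>\<^bsub>K\<^esub> \<or> f (inv\<^bsub>G\<^esub> (T [^]\<^bsub>G\<^esub> n) \<otimes>\<^bsub>G\<^esub> z) \<noteq> \<zero>\<^bsub>K\<^esub>"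
    using binomial_multiple_support[OF Tc T(2) k u zc(1) f zc(2)] by blast
  have hx: "h x \<in> carrier (free_group S)" using x by simp
  from n(2) show ?thesis
  proof
    assume "f (T [^]\<^bsub>G\<^esub> n \<otimes>\<^bsub>G\<^esub> z) \<noteq> \<zero>\<^bsub>K\<^esub>"
    then have "length (h (T [^]\<^bsub>G\<^esub> n \<otimes>\<^bsub>G\<^esub> z)) \<le> length (h z)"
      using Tc zc(1) by (intro max) (simp add: support_def)
    moreover have "h (T [^]\<^bsub>G\<^esub> n \<otimes>\<^bsub>G\<^esub> z) =
        inv\<^bsub>free_group S\<^esub> ((inv\<^bsub>free_group S\<^esub> h x) [^]\<^bsub>free_group S\<^esub> (2 * n)) \<otimes>\<^bsub>free_group S\<^esub> h z"
      using Tc zc(1) hx by (simp add: pow h.H.nat_pow_inv)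
    ultimately show ?thesis using n(1) by (intro bexI[of _ "inv\<^bsub>free_group S\<^esub> h x"] exI[of _ "2 * n"]) auto
  next
    assume "f (inv\<^bsub>G\<^esub> (T [^]\<^bsub>G\<^esub> n) \<otimes>\<^bsub>G\<^esub> z) \<noteq> \<zero>\<^bsub>K\<^esub>"
    then have "length (h (inv\<^bsub>G\<^esub> (T [^]\<^bsub>G\<^esub> n) \<otimes>\<^bsub>G\<^esub> z)) \<le> length (h z)"
      using Tc zc(1) by (intro max) (simp add: support_def)
    moreover have "h (inv\<^bsub>G\<^esub> (T [^]\<^bsub>G\<^esub> n) \<otimes>\<^bsub>G\<^esub> z) =
        inv\<^bsub>free_group S\<^esub> (h x [^]\<^bsub>free_group S\<^esub> (2 * n)) \<otimes>\<^bsub>free_group S\<^esub> h z"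
      using Tc zc(1) by (simp add: pow)
    ultimately show ?thesis using n(1) by (intro bexI[of _ "h x"] exI[of _ "2 * n"]) auto
  qed
qed

lemma inj_square_powers:
  assumes "group_hom G (free_group S) h" "x \<in> carrier G" "h x \<noteq> \<one>\<^bsub>free_group S\<^esub>"
  shows "inj (\<lambda>n::nat. (x [^]\<^bsub>G\<^esub> (2::nat)) [^]\<^bsub>G\<^esub> n)"
proof -
  interpret h: group_hom G "free_group S" h by fact
  have "inj (\<lambda>n::nat. length (h x [^]\<^bsub>free_group S\<^esub> n))"
    by (rule strict_mono_imp_inj_on[OF strict_mono_length_pow]) (use assms(2,3) in auto)
  then have length_inj: "m = n"
    if "length (h x [^]\<^bsub>free_group S\<^esub> m) = length (h x [^]\<^bsub>free_group S\<^esub> n)" for m n :: nat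
    using that by (rule injD)
  have pow: "h ((x [^]\<^bsub>G\<^esub> (2::nat)) [^]\<^bsub>G\<^esub> n) = h x [^]\<^bsub>free_group S\<^esub> (2 * n)" for n :: nat
    using assms(2) by (simp add: G.nat_pow_pow h.hom_nat_pow)
  show ?thesis
  proof (rule injI)
    fix m n :: nat
    assume "(x [^]\<^bsub>G\<^esub> (2::nat)) [^]\<^bsub>G\<^esub> m = (x [^]\<^bsub>G\<^esub> (2::nat)) [^]\<^bsub>G\<^esub> n"
    from arg_cong[OF this, of h] have "2 * m = 2 * n"
      unfolding pow by (rule length_inj[OF arg_cong[where f = length]])
    then show "m = n" by simp
  qed
qed

lemma coding_exists:
  assumes "\<not> comm_group G" "infinite (carrier K)"
  shows "\<exists>t t'. coding KG t t'"
proof -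
  obtain x0 y0 where xy0: "x0 \<in> carrier G" "y0 \<in> carrier G" "x0 \<otimes>\<^bsub>G\<^esub> y0 \<noteq> y0 \<otimes>\<^bsub>G\<^esub> x0"
    using assms(1) G.group_comm_groupI by blast
  \<comment> \<open>Separating these two products is enough. Independence compares only lengths
    under \<open>h\<close> and never needs injectivity on a support, so one homomorphism, and hence
    one pair \<open>t\<close>, \<open>t'\<close>, serves all \<open>u\<close> and
    \<open>v\<close>.\<close>
  obtain S :: "nat set" and h where hom: "group_hom G (free_group S) h"
    and inj: "inj_on h {x0 \<otimes>\<^bsub>G\<^esub> y0, y0 \<otimes>\<^bsub>G\<^esub> x0}"
    using injective_hom[of "{x0 \<otimes>\<^bsub>G\<^esub> y0, y0 \<otimes>\<^bsub>G\<^esub> x0}"] xy0(1,2) by blast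
  interpret h: group_hom G "free_group S" h by (rule hom)
  have "h x0 \<otimes>\<^bsub>free_group S\<^esub> h y0 \<noteq> h y0 \<otimes>\<^bsub>free_group S\<^esub> h x0"
    using inj xy0 by (auto simp: inj_on_def)
  then obtain x y where xy: "x \<in> carrier G" "y \<in> carrier G"
    and noncomm: "h x \<otimes>\<^bsub>free_group S\<^esub> h y \<noteq> h y \<otimes>\<^bsub>free_group S\<^esub> h x"
    and ge: "\<forall>\<alpha> \<in> {h x, inv\<^bsub>free_group S\<^esub> h x}. \<forall>\<beta> \<in> {h y, inv\<^bsub>free_group S\<^esub> h y}.
       length \<alpha> \<le> length (inv\<^bsub>free_group S\<^esub> \<alpha> \<otimes>\<^bsub>free_group S\<^esub> \<beta>) \<and>
       length \<beta> \<le> length (inv\<^bsub>free_group S\<^esub> \<alpha> \<otimes>\<^bsub>free_group S\<^esub> \<beta>)"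
    using reduced_pair_exists[OF G.group_axioms h.homh xy0(1,2)] by blast
  have neq: "h x \<noteq> \<one>\<^bsub>free_group S\<^esub>" "h y \<noteq> \<one>\<^bsub>free_group S\<^esub>"
    using noncomm xy by auto
  have inv_neq: "inv\<^bsub>free_group S\<^esub> h x \<noteq> \<one>\<^bsub>free_group S\<^esub>" "inv\<^bsub>free_group S\<^esub> h y \<noteq> \<one>\<^bsub>free_group S\<^esub>"
    using neq xy by simp_all
  define T T' where "T = x [^]\<^bsub>G\<^esub> (2::nat)" and "T' = y [^]\<^bsub>G\<^esub> (2::nat)"
  have Tc: "T \<in> carrier G" "T' \<in> carrier G" using xy by (simp_all add: T_def T'_def)
  have T_inj: "inj (\<lambda>n::nat. T [^]\<^bsub>G\<^esub> n)" "inj (\<lambda>n::nat. T' [^]\<^bsub>G\<^esub> n)"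
    unfolding T_def T'_def using inj_square_powers[OF hom] xy neq by blast+
  interpret R: ring KG by (rule ring_KG)
  have "coding KG (single T \<one>\<^bsub>K\<^esub>) (single T' \<one>\<^bsub>K\<^esub>)"
  proof unfold_locales
    show "\<one>\<^bsub>KG\<^esub> \<noteq> \<zero>\<^bsub>KG\<^esub>"
    proof
      assume "\<one>\<^bsub>KG\<^esub> = \<zero>\<^bsub>KG\<^esub>"
      from fun_cong[OF this, of "\<one>\<^bsub>G\<^esub>"] show False by (simp add: one_apply zero_apply)
    qed
    show "single T \<one>\<^bsub>K\<^esub> \<in> carrier KG" "single T' \<one>\<^bsub>K\<^esub> \<in> carrier KG"
      using Tc by (auto intro: single_closed)
    show "infinite (Collect (scalar KG))" by (rule infinite_scalars) fact
    show "k \<otimes>\<^bsub>KG\<^esub> u = u \<otimes>\<^bsub>KG\<^esub> k" if "scalar KG k" "u \<in> carrier KG" for k u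
      using that single_one_central by (auto simp: scalar_iff)
    show "k \<ominus>\<^bsub>KG\<^esub> l \<in> Units KG" if "scalar KG k" "scalar KG l" "k \<noteq> l" for k l
      using that by (rule scalar_minus_unit)
    show "u = \<zero>\<^bsub>KG\<^esub> \<and> v = \<zero>\<^bsub>KG\<^esub>"
      if kappa: "scalar KG \<kappa> \<or> \<kappa> = \<one>\<^bsub>KG\<^esub>" and uv: "u \<in> carrier KG" "v \<in> carrier KG"
        and eq: "(single T \<one>\<^bsub>K\<^esub> \<ominus>\<^bsub>KG\<^esub> \<kappa>) \<otimes>\<^bsub>KG\<^esub> u = (single T' \<one>\<^bsub>K\<^esub> \<ominus>\<^bsub>KG\<^esub> \<kappa>) \<otimes>\<^bsub>KG\<^esub> v" for \<kappa> u v
    proof -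
      obtain k where k: "k \<in> carrier K" "k \<noteq> \<zero>\<^bsub>K\<^esub>" "\<kappa> = single \<one>\<^bsub>G\<^esub> k"
        using kappa scalar_iff one_eq_single K.one_closed K.one_not_zero by blast
      define f where "f = (single T \<one>\<^bsub>K\<^esub> \<ominus>\<^bsub>KG\<^esub> single \<one>\<^bsub>G\<^esub> k) \<otimes>\<^bsub>KG\<^esub> u"
      have f': "f = (single T' \<one>\<^bsub>K\<^esub> \<ominus>\<^bsub>KG\<^esub> single \<one>\<^bsub>G\<^esub> k) \<otimes>\<^bsub>KG\<^esub> v"
        unfolding f_def using eq k(3) by simp
      have fc: "f \<in> carrier KG"
        unfolding f_def using Tc k(1) uv(1) single_closed by (intro mult_closed R.minus_closed) auto
      have "support f = {}"
      proof (rule ccontr)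
        assume "support f \<noteq> {}"
        then obtain z where z: "z \<in> support f"
          and max: "\<And>z'. z' \<in> support f \<Longrightarrow> length (h z') \<le> length (h z)"
          using finite_has_maximal_length[OF finite_support[OF fc], of h] by blast
        obtain \<alpha> i where \<alpha>: "\<alpha> \<in> {h x, inv\<^bsub>free_group S\<^esub> h x}" "(2::nat) \<le> i"
          "length (inv\<^bsub>free_group S\<^esub> (\<alpha> [^]\<^bsub>free_group S\<^esub> i) \<otimes>\<^bsub>free_group S\<^esub> h z) \<le> length (h z)"
          using shortening_power[OF hom xy(1) T_def T_inj(1) k(1,2) uv(1) f_def z max] by blast
        obtain \<beta> j where \<beta>: "\<beta> \<in> {h y, inv\<^bsub>free_group S\<^esub> h y}" "(2::nat) \<le> j"
          "length (inv\<^bsub>free_group S\<^esub> (\<beta> [^]\<^bsub>free_group S\<^esub> j) \<otimes>\<^bsub>free_group S\<^esub> h z) \<le> length (h z)"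
          using shortening_power[OF hom xy(2) T'_def T_inj(2) k(1,2) uv(2) f' z max] by blast
        have \<alpha>': "\<alpha> \<in> carrier (free_group S)" "\<alpha> \<noteq> \<one>\<^bsub>free_group S\<^esub>"
          using \<alpha>(1) xy(1) by (elim insertE emptyE; simp add: neq(1))+
        have \<beta>': "\<beta> \<in> carrier (free_group S)" "\<beta> \<noteq> \<one>\<^bsub>free_group S\<^esub>"
          using \<beta>(1) xy(2) by (elim insertE emptyE; simp add: neq(2))+
        have "h z \<in> carrier (free_group S)" using z support_subset h.hom_closed by blast
        then show False
          using independent_powers[OF \<alpha>' \<beta>' _ _ _ \<alpha>(2) \<beta>(2), of "h z"]
            bspec[OF bspec[OF ge \<alpha>(1)] \<beta>(1)] \<alpha>(3) \<beta>(3) by linarith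
      qed
      then have "f = \<zero>\<^bsub>KG\<^esub>"
        using not_in_support[OF fc] by (intro KG_eqI[OF fc zero_closed]) (simp add: zero_apply)
      then show ?thesis
        using binomial_factor_zero[OF Tc(1) T_inj(1) k(1) uv(1)] binomial_factor_zero[OF Tc(2) T_inj(2) k(1) uv(2)]
          f_def f' by simp
    qed
  qed
  then show ?thesis by blast
qed

end

theorem theorem19:
  fixes G :: "('g, 'n) monoid_scheme" and K :: "('k, 'm) ring_scheme"
  assumes "limit_group G"
    and "\<not> comm_group G"
    and "field K"
    and "infinite (carrier K)"
    and "interpretable_in K nat_arithmetic"
  shows "\<forall>n :: nat. \<exists>\<phi> :: ('g \<Rightarrow> 'k) fm. consts_fm \<phi> = {} \<and>
    (\<forall>\<psi> \<in> boolean_combinations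
            (Pi_formulas n (carrier (group_algebra K G)) \<union>
             Sigma_formulas n (carrier (group_algebra K G))).
       \<not> equivalent_in (group_algebra K G) \<phi> \<psi>)"
proof
  fix n
  interpret G: group G
    using assms(1) by (simp add: limit_group_def finitely_generated_group_def)
  interpret K: field K by fact
  interpret limit_group_ring G K
    using assms(1) by unfold_locales (simp add: limit_group_def)
  obtain t t' where "coding (group_algebra K G) t t'"
    using coding_exists[OF assms(2,4)] by blast
  then interpret coding "group_algebra K G" t t' .
  show "\<exists>\<phi> :: ('g \<Rightarrow> 'k) fm. consts_fm \<phi> = {} \<and>
    (\<forall>\<psi> \<in> boolean_combinations
            (Pi_formulas n (carrier (group_algebra K G)) \<union>
             Sigma_formulas n (carrier (group_algebra K G))).
       \<not> equivalent_in (group_algebra K G) \<phi> \<psi>)"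
    by (rule quantifier_hierarchy)
qed

end
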